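(* Let $\mathfrak{g}$ be a finite-dimensional simple Lie algebra over $\mathbb{C}$ of rank $\ell$ with simple roots $\alpha_1,\dots,\alpha_\ell$ and Cartan matrix $C=(a_{ij})_{i,j=1}^{\ell}$, $a_{ij}=\alpha_i(H_j)$, where $H_j$ is the simple coroot of $\alpha_j$. Let $k$ be a positive integer and let $L(k,\lambda)$ be an integrable irreducible highest weight module of level $k$ for the untwisted affine Lie algebra $\hat{\mathfrak{g}}$. Then, for each $1\le i\le \ell$, the multi-parameter character $\chi_{L(k,\lambda)}$ satisfies $$\chi_{L(k,\lambda)}(x_1,\dots,x_{\ell};q) = (x_iq)^{\frac{2}{\langle\alpha_i,\alpha_i\rangle}k}\,\chi_{L(k,\lambda)}(x_1q^{a_{1i}},\dots,x_{\ell}q^{a_{\ell i}};q).$$ In particular, if $\mathfrak{g}$ is simply-laced, then for each $1\le i\le \ell$, $$\chi_{L(k,\lambda)}(x_1,\dots,x_{\ell};q) = (x_iq)^{k}\,\chi_{L(k,\lambda)}(x_1q^{a_{1i}},\dots,x_{\ell}q^{a_{\ell i}};q).$$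
   Context: Fix a Cartan subalgebra $\mathfrak{h}$ of $\mathfrak{g}$ and let $\langle\cdot,\cdot\rangle$ be the normalized Killing form, with $\langle\alpha,\alpha\rangle=2$ for long roots $\alpha$ (the form on $\mathfrak{h}^*$ is the induced one). $E_i,F_i,H_i$ ($1\le i\le\ell$) are Chevalley generators. $H^{(1)},\dots,H^{(\ell)}\in\mathfrak{h}$ are the fundamental coweights, defined by $\alpha_i(H^{(j)})=\delta_{i,j}$. The untwisted affine Lie algebra is $\hat{\mathfrak{g}}=\mathfrak{g}\otimes\mathbb{C}[t,t^{-1}]\oplus\mathbb{C}c$ with $c$ central and $[a\otimes t^m,b\otimes t^n]=[a,b]\otimes t^{m+n}+m\langle a,b\rangle\delta_{m+n,0}c$. For $a\in\mathfrak{g}$, $n\in\mathbb{Z}$, $a(n)$ denotes the operator by which $a\otimes t^n$ acts on a $\hat{\mathfrak{g}}$-module. $L(k,\lambda)$ is the irreducible highest weight module generated by a highest weight vector annihilated by $\mathfrak{g}\otimes t\mathbb{C}[t]$ and by $E_i\otimes 1$ ($1\le i\le \ell$), on which $\mathfrak{h}=\mathfrak{h}\otimes 1$ acts by $\lambda\in\mathfrak{h}^*$, and with $c$ acting as $k$. Integrability here means $\lambda$ is a dominant integral weight of $\mathfrak{g}$ with $\lambda(H_\theta)\le k$, where $\theta$ is the highest root and $H_\theta$ its coroot. $L(0)$ is the Virasoro (Sugawara) degree operator on $L(k,\lambda)$: it satisfies $[L(0),a(n)]=-n\,a(n)$ for $a\in\mathfrak{g}$, $n\in\mathbb{Z}$,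 and acts on the highest weight vector by the scalar $\mu=\frac{\langle\lambda,\lambda+2\rho\rangle}{2(k+h^\vee)}$, where $\rho$ is the half-sum of positive roots and $h^\vee$ the dual Coxeter number. The multi-parameter character is the formal sum $$\chi_{L(k,\lambda)}(x_1,\dots,x_\ell;q)=\mathrm{tr}_{L(k,\lambda)}\,x_1^{H^{(1)}(0)}\cdots x_\ell^{H^{(\ell)}(0)}q^{L(0)},$$ i.e. the coefficient of $x_1^{n_1}\cdots x_\ell^{n_\ell}q^r$ (exponents may be rational) is the (finite) dimension of the joint eigenspace on which $H^{(j)}(0)$ acts by $n_j$ for all $j$ and $L(0)$ acts by $r$. The substitution $x_j\mapsto x_jq^{a_{ji}}$ is the monomial substitution performed termwise. "Simply-laced" means all roots of $\mathfrak{g}$ have the same length. *)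

theory Defs
  imports Complex_Main "HOL-Library.Poly_Mapping" "HOL-Library.Product_Plus"
begin

section \<open>Lie algebras and modules\<close>

text \<open>Vector spaces are whole types with an explicit complex scalar multiplication (the
  library locale \<^locale>\<open>vector_space\<close>).\<close>

locale lie_algebra = vector_space scale
  for scale :: "complex \<Rightarrow> 'g::ab_group_add \<Rightarrow> 'g" +
  fixes br :: "'g \<Rightarrow> 'g \<Rightarrow> 'g"
  assumes linear_left: "\<And>y. Vector_Spaces.linear scale scale (\<lambda>x. br x y)"
    and linear_right: "\<And>x. Vector_Spaces.linear scale scale (br x)"
    and br_self: "\<And>x. br x x = 0"
    and jacobi: "\<And>x y z. br x (br y z) + br y (br z x) + br z (br x y) = 0"

definition lie_ideal ::
  "(complex \<Rightarrow> 'g::ab_group_add \<Rightarrow> 'g) \<Rightarrow> ('g \<Rightarrow> 'g \<Rightarrow> 'g) \<Rightarrow> 'g set \<Rightarrow> bool" where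
  "lie_ideal s br I \<longleftrightarrow> module.subspace s I \<and> (\<forall>x. \<forall>y\<in>I. br x y \<in> I)"

definition fd_simple_lie_algebra ::
  "(complex \<Rightarrow> 'g::ab_group_add \<Rightarrow> 'g) \<Rightarrow> ('g \<Rightarrow> 'g \<Rightarrow> 'g) \<Rightarrow> bool" where
  "fd_simple_lie_algebra s br \<longleftrightarrow>
     lie_algebra s br \<and>
     (\<exists>B. finite B \<and> module.span s B = UNIV) \<and>
     (\<exists>x y. br x y \<noteq> 0) \<and>
     (\<forall>I. lie_ideal s br I \<longrightarrow> I = {0} \<or> I = UNIV)"

definition lie_module ::
  "(complex \<Rightarrow> 'g::ab_group_add \<Rightarrow> 'g) \<Rightarrow> ('g \<Rightarrow> 'g \<Rightarrow> 'g) \<Rightarrow>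
   (complex \<Rightarrow> 'v::ab_group_add \<Rightarrow> 'v) \<Rightarrow> ('g \<Rightarrow> 'v \<Rightarrow> 'v) \<Rightarrow> bool" where
  "lie_module s br sV act \<longleftrightarrow>
     (\<forall>w. Vector_Spaces.linear s sV (\<lambda>x. act x w)) \<and>
     (\<forall>x. Vector_Spaces.linear sV sV (act x)) \<and>
     (\<forall>x y w. act (br x y) w = act x (act y w) - act y (act x w))"

definition submodule ::
  "(complex \<Rightarrow> 'v::ab_group_add \<Rightarrow> 'v) \<Rightarrow> ('g \<Rightarrow> 'v \<Rightarrow> 'v) \<Rightarrow> 'v set \<Rightarrow> bool" where
  "submodule sV act W \<longleftrightarrow> module.subspace sV W \<and> (\<forall>x. \<forall>w\<in>W. act x w \<in> W)"

definition irreducible_module ::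
  "(complex \<Rightarrow> 'v::ab_group_add \<Rightarrow> 'v) \<Rightarrow> ('g \<Rightarrow> 'v \<Rightarrow> 'v) \<Rightarrow> bool" where
  "irreducible_module sV act \<longleftrightarrow>
     (\<exists>w::'v. w \<noteq> 0) \<and> (\<forall>W. submodule sV act W \<longrightarrow> W = {0} \<or> W = UNIV)"

section \<open>Cartan subalgebras and roots\<close>

definition diagonalizable ::
  "(complex \<Rightarrow> 'g::ab_group_add \<Rightarrow> 'g) \<Rightarrow> ('g \<Rightarrow> 'g) \<Rightarrow> bool" where
  "diagonalizable s f \<longleftrightarrow> module.span s {x. \<exists>c. f x = s c x} = UNIV"

definition abelian_subalgebra ::
  "(complex \<Rightarrow> 'g::ab_group_add \<Rightarrow> 'g) \<Rightarrow> ('g \<Rightarrow> 'g \<Rightarrow> 'g) \<Rightarrow> 'g set \<Rightarrow> bool" where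
  "abelian_subalgebra s br A \<longleftrightarrow> module.subspace s A \<and> (\<forall>x\<in>A. \<forall>y\<in>A. br x y = 0)"

text \<open>The usual definition for complex semisimple Lie algebras (Helgason): a maximal abelian
  subalgebra all of whose elements are ad-diagonalizable.\<close>

definition cartan_subalgebra ::
  "(complex \<Rightarrow> 'g::ab_group_add \<Rightarrow> 'g) \<Rightarrow> ('g \<Rightarrow> 'g \<Rightarrow> 'g) \<Rightarrow> 'g set \<Rightarrow> bool" where
  "cartan_subalgebra s br \<hh> \<longleftrightarrow>
     abelian_subalgebra s br \<hh> \<and>
     (\<forall>A. abelian_subalgebra s br A \<and> \<hh> \<subseteq> A \<longrightarrow> A = \<hh>) \<and>
     (\<forall>h\<in>\<hh>. diagonalizable s (br h))"

text \<open>Linear functionals on the subspace \<open>\<hh>\<close>. Their values outside \<open>\<hh>\<close> are fixed to be \<open>0\<close>,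
  so that equality of functions is equality of functionals on \<open>\<hh>\<close>.\<close>

definition dual_space ::
  "(complex \<Rightarrow> 'g::ab_group_add \<Rightarrow> 'g) \<Rightarrow> 'g set \<Rightarrow> ('g \<Rightarrow> complex) set" where
  "dual_space s \<hh> = {f.
     (\<forall>x\<in>\<hh>. \<forall>y\<in>\<hh>. f (x + y) = f x + f y) \<and>
     (\<forall>c. \<forall>x\<in>\<hh>. f (s c x) = c * f x) \<and>
     (\<forall>x. x \<notin> \<hh> \<longrightarrow> f x = 0)}"

definition root_space ::
  "(complex \<Rightarrow> 'g::ab_group_add \<Rightarrow> 'g) \<Rightarrow> ('g \<Rightarrow> 'g \<Rightarrow> 'g) \<Rightarrow> 'g set \<Rightarrow>
   ('g \<Rightarrow> complex) \<Rightarrow> 'g set" where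
  "root_space s br \<hh> \<beta> = {x. \<forall>h\<in>\<hh>. br h x = s (\<beta> h) x}"

definition roots ::
  "(complex \<Rightarrow> 'g::ab_group_add \<Rightarrow> 'g) \<Rightarrow> ('g \<Rightarrow> 'g \<Rightarrow> 'g) \<Rightarrow> 'g set \<Rightarrow>
   ('g \<Rightarrow> complex) set" where
  "roots s br \<hh> = {\<beta> \<in> dual_space s \<hh>. \<beta> \<noteq> (\<lambda>_. 0) \<and> root_space s br \<hh> \<beta> \<noteq> {0}}"

text \<open>The coroot of \<open>\<beta>\<close> is the element \<open>h\<close> of \<open>[\<gg>\<^sub>\<beta>, \<gg>\<^sub>-\<^sub>\<beta>]\<close> with \<open>\<beta>(h) = 2\<close>.\<close>

definition is_coroot ::
  "(complex \<Rightarrow> 'g::ab_group_add \<Rightarrow> 'g) \<Rightarrow> ('g \<Rightarrow> 'g \<Rightarrow> 'g) \<Rightarrow> 'g set \<Rightarrow>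
   ('g \<Rightarrow> complex) \<Rightarrow> 'g \<Rightarrow> bool" where
  "is_coroot s br \<hh> \<beta> h \<longleftrightarrow>
     h \<in> module.span s {br e f | e f. e \<in> root_space s br \<hh> \<beta> \<and>
                                      f \<in> root_space s br \<hh> (\<lambda>x. - \<beta> x)} \<and>
     \<beta> h = 2"

text \<open>Simple roots are indexed by a finite type \<open>'i\<close>, so the rank is \<open>CARD('i)\<close>.\<close>

definition nonneg_comb :: "('i::finite \<Rightarrow> 'g \<Rightarrow> complex) \<Rightarrow> ('g \<Rightarrow> complex) set" where
  "nonneg_comb \<alpha> = {(\<lambda>h. \<Sum>i\<in>UNIV. of_nat (n i) * \<alpha> i h) | n :: 'i \<Rightarrow> nat. True}"

definition simple_roots ::
  "(complex \<Rightarrow> 'g::ab_group_add \<Rightarrow> 'g) \<Rightarrow> ('g \<Rightarrow> 'g \<Rightarrow> 'g) \<Rightarrow> 'g set \<Rightarrow>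
   ('i::finite \<Rightarrow> 'g \<Rightarrow> complex) \<Rightarrow> bool" where
  "simple_roots s br \<hh> \<alpha> \<longleftrightarrow>
     (\<forall>i. \<alpha> i \<in> roots s br \<hh>) \<and>
     (\<forall>c. (\<forall>h\<in>\<hh>. (\<Sum>i\<in>UNIV. c i * \<alpha> i h) = 0) \<longrightarrow> (\<forall>i. c i = 0)) \<and>
     (\<forall>\<beta>\<in>roots s br \<hh>. \<beta> \<in> nonneg_comb \<alpha> \<or> (\<lambda>h. - \<beta> h) \<in> nonneg_comb \<alpha>)"

definition positive_roots ::
  "(complex \<Rightarrow> 'g::ab_group_add \<Rightarrow> 'g) \<Rightarrow> ('g \<Rightarrow> 'g \<Rightarrow> 'g) \<Rightarrow> 'g set \<Rightarrow>
   ('i::finite \<Rightarrow> 'g \<Rightarrow> complex) \<Rightarrow> ('g \<Rightarrow> complex) set" where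
  "positive_roots s br \<hh> \<alpha> = roots s br \<hh> \<inter> nonneg_comb \<alpha>"

definition weyl_vector ::
  "(complex \<Rightarrow> 'g::ab_group_add \<Rightarrow> 'g) \<Rightarrow> ('g \<Rightarrow> 'g \<Rightarrow> 'g) \<Rightarrow> 'g set \<Rightarrow>
   ('i::finite \<Rightarrow> 'g \<Rightarrow> complex) \<Rightarrow> 'g \<Rightarrow> complex" where
  "weyl_vector s br \<hh> \<alpha> = (\<lambda>h. (\<Sum>\<beta>\<in>positive_roots s br \<hh> \<alpha>. \<beta> h) / 2)"

definition is_highest_root ::
  "(complex \<Rightarrow> 'g::ab_group_add \<Rightarrow> 'g) \<Rightarrow> ('g \<Rightarrow> 'g \<Rightarrow> 'g) \<Rightarrow> 'g set \<Rightarrow>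
   ('i::finite \<Rightarrow> 'g \<Rightarrow> complex) \<Rightarrow> ('g \<Rightarrow> complex) \<Rightarrow> bool" where
  "is_highest_root s br \<hh> \<alpha> \<theta> \<longleftrightarrow>
     \<theta> \<in> roots s br \<hh> \<and> (\<forall>\<beta>\<in>roots s br \<hh>. (\<lambda>h. \<theta> h - \<beta> h) \<in> nonneg_comb \<alpha>)"

definition chevalley_generators ::
  "(complex \<Rightarrow> 'g::ab_group_add \<Rightarrow> 'g) \<Rightarrow> ('g \<Rightarrow> 'g \<Rightarrow> 'g) \<Rightarrow> 'g set \<Rightarrow>
   ('i \<Rightarrow> 'g \<Rightarrow> complex) \<Rightarrow> ('i \<Rightarrow> 'g) \<Rightarrow> ('i \<Rightarrow> 'g) \<Rightarrow> ('i \<Rightarrow> 'g) \<Rightarrow> bool" where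
  "chevalley_generators s br \<hh> \<alpha> E F H \<longleftrightarrow> (\<forall>i.
     E i \<in> root_space s br \<hh> (\<alpha> i) \<and>
     F i \<in> root_space s br \<hh> (\<lambda>h. - \<alpha> i h) \<and>
     br (E i) (F i) = H i \<and>
     is_coroot s br \<hh> (\<alpha> i) (H i))"

definition fundamental_coweights ::
  "'g set \<Rightarrow> ('i \<Rightarrow> 'g \<Rightarrow> complex) \<Rightarrow> ('i \<Rightarrow> 'g) \<Rightarrow> bool" where
  "fundamental_coweights \<hh> \<alpha> \<omega> \<longleftrightarrow>
     (\<forall>j. \<omega> j \<in> \<hh>) \<and> (\<forall>i j. \<alpha> i (\<omega> j) = (if i = j then 1 else 0))"

section \<open>The normalized Killing form\<close>

definition trace :: "(complex \<Rightarrow> 'g::ab_group_add \<Rightarrow> 'g) \<Rightarrow> ('g \<Rightarrow> 'g) \<Rightarrow> complex" where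
  "trace s f = (let B = (SOME B. \<not> module.dependent s B \<and> module.span s B = UNIV)
                in \<Sum>b\<in>B. module.representation s B (f b) b)"

definition killing_form ::
  "(complex \<Rightarrow> 'g::ab_group_add \<Rightarrow> 'g) \<Rightarrow> ('g \<Rightarrow> 'g \<Rightarrow> 'g) \<Rightarrow> 'g \<Rightarrow> 'g \<Rightarrow> complex" where
  "killing_form s br x y = trace s (\<lambda>z. br x (br y z))"

text \<open>The form induced on the dual of \<open>\<hh>\<close> by a form \<open>B\<close> that is nondegenerate on \<open>\<hh>\<close>.\<close>

definition dual_vector :: "('g \<Rightarrow> 'g \<Rightarrow> complex) \<Rightarrow> 'g set \<Rightarrow> ('g \<Rightarrow> complex) \<Rightarrow> 'g" where
  "dual_vector B \<hh> \<beta> = (THE t. t \<in> \<hh> \<and> (\<forall>h\<in>\<hh>. B t h = \<beta> h))"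

definition dual_form ::
  "('g \<Rightarrow> 'g \<Rightarrow> complex) \<Rightarrow> 'g set \<Rightarrow> ('g \<Rightarrow> complex) \<Rightarrow> ('g \<Rightarrow> complex) \<Rightarrow> complex" where
  "dual_form B \<hh> \<beta> \<gamma> = B (dual_vector B \<hh> \<beta>) (dual_vector B \<hh> \<gamma>)"

text \<open>For \<open>B\<close> a multiple of the Killing form, the squared lengths of the roots are real up to a
  common factor. The requirement below that the \<^const>\<open>Re\<close>-maximal one is \<open>2\<close> forces that factor
  to be positive, so that the long roots are the expected ones.\<close>

definition long_root ::
  "(complex \<Rightarrow> 'g::ab_group_add \<Rightarrow> 'g) \<Rightarrow> ('g \<Rightarrow> 'g \<Rightarrow> 'g) \<Rightarrow> 'g set \<Rightarrow>
   ('g \<Rightarrow> 'g \<Rightarrow> complex) \<Rightarrow> ('g \<Rightarrow> complex) \<Rightarrow> bool" where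
  "long_root s br \<hh> B \<beta> \<longleftrightarrow> \<beta> \<in> roots s br \<hh> \<and>
     (\<forall>\<gamma>\<in>roots s br \<hh>. Re (dual_form B \<hh> \<gamma> \<gamma>) \<le> Re (dual_form B \<hh> \<beta> \<beta>))"

definition normalized_killing_form ::
  "(complex \<Rightarrow> 'g::ab_group_add \<Rightarrow> 'g) \<Rightarrow> ('g \<Rightarrow> 'g \<Rightarrow> 'g) \<Rightarrow> 'g set \<Rightarrow>
   ('g \<Rightarrow> 'g \<Rightarrow> complex) \<Rightarrow> bool" where
  "normalized_killing_form s br \<hh> B \<longleftrightarrow>
     (\<exists>c. B = (\<lambda>x y. c * killing_form s br x y)) \<and>
     (\<forall>\<beta>. long_root s br \<hh> B \<beta> \<longrightarrow> dual_form B \<hh> \<beta> \<beta> = 2)"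

definition simply_laced ::
  "(complex \<Rightarrow> 'g::ab_group_add \<Rightarrow> 'g) \<Rightarrow> ('g \<Rightarrow> 'g \<Rightarrow> 'g) \<Rightarrow> 'g set \<Rightarrow>
   ('g \<Rightarrow> 'g \<Rightarrow> complex) \<Rightarrow> bool" where
  "simply_laced s br \<hh> B \<longleftrightarrow>
     (\<forall>\<beta>\<in>roots s br \<hh>. \<forall>\<gamma>\<in>roots s br \<hh>. dual_form B \<hh> \<beta> \<beta> = dual_form B \<hh> \<gamma> \<gamma>)"

text \<open>\<open>h\<^sup>\<or> = 1 + \<rho>(H\<^sub>\<theta>)\<close>.\<close>

definition dual_coxeter_number ::
  "(complex \<Rightarrow> 'g::ab_group_add \<Rightarrow> 'g) \<Rightarrow> ('g \<Rightarrow> 'g \<Rightarrow> 'g) \<Rightarrow> 'g set \<Rightarrow>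
   ('i::finite \<Rightarrow> 'g \<Rightarrow> complex) \<Rightarrow> 'g \<Rightarrow> complex" where
  "dual_coxeter_number s br \<hh> \<alpha> H\<theta> = 1 + weyl_vector s br \<hh> \<alpha> H\<theta>"

section \<open>The untwisted affine Lie algebra\<close>

text \<open>The pair \<open>(f, z)\<close> stands for \<open>(\<Sum>n. f n \<otimes> t\<^sup>n) + z c\<close>.\<close>

type_synonym 'g affine = "(int \<Rightarrow>\<^sub>0 'g) \<times> complex"

definition loop :: "'g::ab_group_add \<Rightarrow> int \<Rightarrow> 'g affine" where
  "loop a n = (Poly_Mapping.single n a, 0)"

definition central :: "'g::ab_group_add affine" where
  "central = (0, 1)"

definition affine_scale ::
  "(complex \<Rightarrow> 'g::ab_group_add \<Rightarrow> 'g) \<Rightarrow> complex \<Rightarrow> 'g affine \<Rightarrow> 'g affine" where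
  "affine_scale s c x = (Poly_Mapping.map (s c) (fst x), c * snd x)"

definition affine_bracket ::
  "('g::ab_group_add \<Rightarrow> 'g \<Rightarrow> 'g) \<Rightarrow> ('g \<Rightarrow> 'g \<Rightarrow> complex) \<Rightarrow>
   'g affine \<Rightarrow> 'g affine \<Rightarrow> 'g affine" where
  "affine_bracket br B x y =
     (\<Sum>m\<in>Poly_Mapping.keys (fst x). \<Sum>n\<in>Poly_Mapping.keys (fst y).
        (let a = Poly_Mapping.lookup (fst x) m; b = Poly_Mapping.lookup (fst y) n
         in (Poly_Mapping.single (m + n) (br a b),
             if m + n = 0 then of_int m * B a b else 0)))"

section \<open>Integrable highest weight modules and their characters\<close>

definition integrable_weight ::
  "(complex \<Rightarrow> 'g::ab_group_add \<Rightarrow> 'g) \<Rightarrow> 'g set \<Rightarrow> ('i \<Rightarrow> 'g) \<Rightarrow> 'g \<Rightarrow>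
   nat \<Rightarrow> ('g \<Rightarrow> complex) \<Rightarrow> bool" where
  "integrable_weight s \<hh> H H\<theta> k \<Lambda> \<longleftrightarrow>
     \<Lambda> \<in> dual_space s \<hh> \<and> (\<forall>i. \<Lambda> (H i) \<in> \<nat>) \<and> Re (\<Lambda> H\<theta>) \<le> real k"

text \<open>The given module is a copy of \<open>L(k, \<Lambda>)\<close> with highest weight vector \<open>v\<close>.\<close>

definition irreducible_highest_weight_module ::
  "(complex \<Rightarrow> 'g::ab_group_add \<Rightarrow> 'g) \<Rightarrow> ('g \<Rightarrow> 'g \<Rightarrow> 'g) \<Rightarrow> 'g set \<Rightarrow>
   ('g \<Rightarrow> 'g \<Rightarrow> complex) \<Rightarrow> ('i \<Rightarrow> 'g) \<Rightarrow> nat \<Rightarrow> ('g \<Rightarrow> complex) \<Rightarrow>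
   (complex \<Rightarrow> 'v::ab_group_add \<Rightarrow> 'v) \<Rightarrow> ('g affine \<Rightarrow> 'v \<Rightarrow> 'v) \<Rightarrow> 'v \<Rightarrow> bool" where
  "irreducible_highest_weight_module s br \<hh> B E k \<Lambda> sV act v \<longleftrightarrow>
     lie_module (affine_scale s) (affine_bracket br B) sV act \<and>
     irreducible_module sV act \<and>
     v \<noteq> 0 \<and>
     (\<forall>W. submodule sV act W \<and> v \<in> W \<longrightarrow> W = UNIV) \<and>
     (\<forall>a n. n > 0 \<longrightarrow> act (loop a n) v = 0) \<and>
     (\<forall>i. act (loop (E i) 0) v = 0) \<and>
     (\<forall>h\<in>\<hh>. act (loop h 0) v = sV (\<Lambda> h) v) \<and>
     (\<forall>w. act central w = sV (of_nat k) w)"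

text \<open>The two conditions determine \<open>L(0)\<close> uniquely, since \<open>v\<close> generates the module.\<close>

definition is_degree_operator ::
  "(complex \<Rightarrow> 'v::ab_group_add \<Rightarrow> 'v) \<Rightarrow> ('g::ab_group_add affine \<Rightarrow> 'v \<Rightarrow> 'v) \<Rightarrow> 'v \<Rightarrow>
   complex \<Rightarrow> ('v \<Rightarrow> 'v) \<Rightarrow> bool" where
  "is_degree_operator sV act v \<mu> L0 \<longleftrightarrow>
     Vector_Spaces.linear sV sV L0 \<and>
     (\<forall>a n w. L0 (act (loop a n) w) - act (loop a n) (L0 w) = sV (- of_int n) (act (loop a n) w)) \<and>
     L0 v = sV \<mu> v"

definition conformal_weight ::
  "(complex \<Rightarrow> 'g::ab_group_add \<Rightarrow> 'g) \<Rightarrow> ('g \<Rightarrow> 'g \<Rightarrow> 'g) \<Rightarrow> 'g set \<Rightarrow>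
   ('g \<Rightarrow> 'g \<Rightarrow> complex) \<Rightarrow> ('i::finite \<Rightarrow> 'g \<Rightarrow> complex) \<Rightarrow> 'g \<Rightarrow>
   nat \<Rightarrow> ('g \<Rightarrow> complex) \<Rightarrow> complex" where
  "conformal_weight s br \<hh> B \<alpha> H\<theta> k \<Lambda> =
     dual_form B \<hh> \<Lambda> (\<lambda>h. \<Lambda> h + 2 * weyl_vector s br \<hh> \<alpha> h) /
       (2 * (of_nat k + dual_coxeter_number s br \<hh> \<alpha> H\<theta>))"

text \<open>A formal sum in \<open>x\<^sub>i\<close> (\<open>i :: 'i\<close>) and \<open>q\<close> with arbitrary (complex) exponents: the value at
  \<open>(n, r)\<close> is the coefficient of \<open>(\<Prod>i. x\<^sub>i\<^sup>n\<^sup>i) q\<^sup>r\<close>.\<close>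

type_synonym 'i formal_sum = "('i \<Rightarrow> complex) \<times> complex \<Rightarrow> nat"

text \<open>The joint eigenspaces are finite dimensional in \<open>L(k, \<Lambda>)\<close>, so the convention of the library
  that \<open>dim\<close> is \<open>0\<close> for infinite dimensional spaces does not intervene.\<close>

definition affine_character ::
  "(complex \<Rightarrow> 'v::ab_group_add \<Rightarrow> 'v) \<Rightarrow> ('g::ab_group_add affine \<Rightarrow> 'v \<Rightarrow> 'v) \<Rightarrow>
   ('i \<Rightarrow> 'g) \<Rightarrow> ('v \<Rightarrow> 'v) \<Rightarrow> 'i formal_sum" where
  "affine_character sV act \<omega> L0 = (\<lambda>(n, r).
     vector_space.dim sV {w. (\<forall>j. act (loop (\<omega> j) 0) w = sV (n j) w) \<and> L0 w = sV r w})"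

text \<open>Replace every monomial with exponent \<open>e\<close> by the one with exponent \<open>\<phi> e\<close>. It is only used
  with \<open>\<phi>\<close> injective, so that the sum has at most one term.\<close>

definition map_monomials ::
  "(('i \<Rightarrow> complex) \<times> complex \<Rightarrow> ('i \<Rightarrow> complex) \<times> complex) \<Rightarrow>
   'i formal_sum \<Rightarrow> 'i formal_sum" where
  "map_monomials \<phi> ch = (\<lambda>e. \<Sum>e'\<in>{e'. \<phi> e' = e}. ch e')"

text \<open>Multiplication by \<open>(x\<^sub>i q)\<^sup>K\<close>.\<close>

definition times_xq_power :: "'i \<Rightarrow> complex \<Rightarrow> 'i formal_sum \<Rightarrow> 'i formal_sum" where
  "times_xq_power i K = map_monomials (\<lambda>(n, r). (n(i := n i + K), r + K))"

text \<open>The substitution \<open>x\<^sub>j \<mapsto> x\<^sub>j q\<^bsup>b j\<^esup>\<close> for all \<open>j\<close>.\<close>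

definition subst_xq :: "('i::finite \<Rightarrow> complex) \<Rightarrow> 'i formal_sum \<Rightarrow> 'i formal_sum" where
  "subst_xq b = map_monomials (\<lambda>(n, r). (n, r + (\<Sum>j\<in>UNIV. n j * b j)))"

section \<open>Explicit forms\<close>

lemma vector_space_affine:
  assumes "vector_space s"
  shows "vector_space (affine_scale s)"
proof -
  interpret vector_space s by fact
  have lookup: "Poly_Mapping.lookup (Poly_Mapping.map (s c) f) n = s c (Poly_Mapping.lookup f n)" for c f n
    by (simp add: Poly_Mapping.map.rep_eq when_def)
  show ?thesis
    by unfold_locales
      (auto simp: affine_scale_def prod_eq_iff poly_mapping_eq_iff fun_eq_iff lookup lookup_add
        algebra_simps)
qed

lemma affine_bracket_loop:
  assumes "lie_algebra s br" and "\<And>x. B 0 x = 0" and "\<And>x. B x 0 = 0"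
  shows "affine_bracket br B (loop a m) (loop b n) =
    (Poly_Mapping.single (m + n) (br a b), if m + n = 0 then of_int m * B a b else 0)"
proof -
  interpret lie_algebra s br by fact
  interpret vector_space_pair s s ..
  have "br 0 x = 0" for x using linear_0[OF linear_left] .
  moreover have "br x 0 = 0" for x using linear_0[OF linear_right] .
  ultimately show ?thesis
    using assms by (cases "a = 0"; cases "b = 0") (auto simp: affine_bracket_def loop_def zero_prod_def)
qed

lemma times_xq_power_apply:
  "times_xq_power i K ch (n, r) = ch (n(i := n i - K), r - K)"
proof -
  have "{e'. (case e' of (n, r) \<Rightarrow> (n(i := n i + K), r + K)) = (n, r)} = {(n(i := n i - K), r - K)}"
    by (auto simp: fun_eq_iff split: if_splits)
  then show ?thesis by (simp add: times_xq_power_def map_monomials_def)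
qed

lemma subst_xq_apply:
  "subst_xq b ch (n, r) = ch (n, r - (\<Sum>j\<in>UNIV. n j * b j))"
proof -
  have "{e'. (case e' of (n, r) \<Rightarrow> (n, r + (\<Sum>j\<in>UNIV. n j * b j))) = (n, r)} =
      {(n, r - (\<Sum>j\<in>UNIV. n j * b j))}"
    by (auto simp: fun_eq_iff)
  then show ?thesis by (simp add: subst_xq_def map_monomials_def)
qed

end

theory Submission
  imports Defs
begin

text \<open>The identity compares dimensions of joint eigenspaces. Write \<open>z\<close> for the eigenvalue of \<open>H\<^sub>i(0)\<close> on the
  space with exponents \<open>(n, r)\<close> and \<open>K = 2k / \<langle>\<alpha>\<^sub>i, \<alpha>\<^sub>i\<rangle>\<close>. Reading off coefficients, the claim is that the
  space at \<open>(n, r)\<close> and the one at \<open>(n - K e\<^sub>i, r + K - z)\<close> have the same dimension. This is the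
  translation by the coroot \<open>H\<^sub>i\<close> in the affine Weyl group, and a translation is a product of two
  reflections. Each reflection belongs to a copy of \<open>sl\<^sub>2\<close>: the first to \<open>E\<^sub>i(0), F\<^sub>i(0), H\<^sub>i(0)\<close>, which
  moves \<open>(n, r)\<close> to \<open>(n - z e\<^sub>i, r)\<close>, the second to \<open>E\<^sub>i(1), F\<^sub>i(-1), H\<^sub>i(0) + k\<langle>E\<^sub>i, F\<^sub>i\<rangle>\<close>, which moves that
  weight to \<open>(n - K e\<^sub>i, r + K - z)\<close> because \<open>\<langle>E\<^sub>i, F\<^sub>i\<rangle> = 2 / \<langle>\<alpha>\<^sub>i, \<alpha>\<^sub>i\<rangle>\<close>. If \<open>e\<close> and \<open>f\<close> of a triple act locally
  nilpotently, then \<open>f\<^sup>p\<close> maps the part of weight \<open>p\<close> bijectively onto the part of weight \<open>-p\<close>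
  (\<open>f_pow_bij_betw\<close>, used through \<open>reflection_dim\<close>). So everything rests on local nilpotency.

  The operators \<open>E\<^sub>i(0)\<close> and \<open>E\<^sub>i(1)\<close> kill the highest weight vector, and a power of \<open>F\<^sub>i(0)\<close> does so because
  otherwise it would produce a second singular vector (\<open>lower_nilpotent\<close>); local nilpotency on a
  generator spreads to the whole module (\<open>nilpotent_on_module\<close>). The operator \<open>F\<^sub>i(-1)\<close> belongs to a root
  that is not simple. Here the proof uses a norm bound instead of the structure of the affine Weyl
  group: if the weights of a highest weight module lie below \<open>\<Lambda>\<close> and are stable under the simple
  reflections, then \<open>|\<Lambda> - \<beta>|\<^sup>2 \<le> |\<Lambda>|\<^sup>2\<close> for each weight \<open>\<Lambda> - \<beta>\<close> (\<open>reflection_norm_bound\<close>). Along the string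
  \<open>\<beta> = N\<gamma>\<close> with \<open>|\<gamma>|\<^sup>2 > 0\<close> this bounds \<open>N\<close>, so root vectors for \<open>-\<gamma>\<close> are nilpotent (\<open>power_vanishes\<close>).

  The bound is used three times: on the adjoint representation, where it shows that the highest root
  \<open>\<theta>\<close> is long and hence that the form is normalized by \<open>\<langle>\<theta>, \<theta>\<rangle> = 2\<close> (\<open>root_length_le\<close>, \<open>B_eq\<close>); on the module
  with the finite simple reflections, where it gives \<open>\<Lambda>(H\<^sub>\<theta>) \<in> \<nat>\<close> and so the nilpotency of the affine
  generator \<open>E\<^sub>\<theta>(-1)\<close> (\<open>lower_None_nilpotent\<close>); and on the module with all affine simple reflections, where it
  gives the nilpotency of \<open>F\<^sub>i(-1)\<close>. The facts about \<open>\<gg>\<close> that enter are derived from the definition of a simple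
  Lie algebra: the root grading, positivity of the Killing form on the real span of the coroots, and
  generation by the Chevalley generators.\<close>

section \<open>Joint eigenspaces and traces\<close>

lemma linD:
  assumes "Vector_Spaces.linear s s f"
  shows "f (x + y) = f x + f y" "f (s c x) = s c (f x)" "f 0 = 0" "f (x - y) = f x - f y"
    "f (- x) = - f x" "f (sum g A) = (\<Sum>a\<in>A. f (g a))"
proof -
  interpret f: module_hom s s f using assms unfolding Vector_Spaces.linear_def by auto
  show "f (x + y) = f x + f y" "f (s c x) = s c (f x)" "f 0 = 0" "f (x - y) = f x - f y"
    "f (- x) = - f x" "f (sum g A) = (\<Sum>a\<in>A. f (g a))"
    by (simp_all add: f.add f.scale f.diff f.neg f.sum)
qed

definition joint_eigenspace ::
  "(complex \<Rightarrow> 'v::ab_group_add \<Rightarrow> 'v) \<Rightarrow> ('a \<Rightarrow> 'v \<Rightarrow> 'v) \<Rightarrow> 'a set \<Rightarrow> ('a \<Rightarrow> complex) \<Rightarrow> 'v set" where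
  "joint_eigenspace s A J \<tau> = {w. \<forall>a\<in>J. A a w = s (\<tau> a) w}"

locale complex_vector_space = vector_space scale
  for scale :: "complex \<Rightarrow> 'v::ab_group_add \<Rightarrow> 'v"
begin

lemma linearI:
  "(\<And>x y. f (x + y) = f x + f y) \<Longrightarrow> (\<And>c x. f (scale c x) = scale c (f x)) \<Longrightarrow>
   Vector_Spaces.linear scale scale f"
  by unfold_locales auto

lemma linear_funpow:
  assumes "Vector_Spaces.linear scale scale f"
  shows "Vector_Spaces.linear scale scale (f ^^ n)"
  by (induction n) (auto intro!: linearI simp: linD[OF assms] linD)

lemma dim_bij_betw:
  assumes "Vector_Spaces.linear scale scale f" "subspace S" "bij_betw f S T"
  shows "dim S = dim T"
proof -
  interpret vector_space_pair scale scale ..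
  obtain B where B: "B \<subseteq> S" "independent B" "S \<subseteq> span B" "card B = dim S"
    using basis_exists .
  have sp: "span B = S"
    using B assms(2) by (metis span_minimal subset_antisym)
  have inj: "inj_on f (span B)" and im: "f ` S = T"
    using assms(3) sp by (auto simp: bij_betw_def)
  interpret f: module_hom scale scale f using assms unfolding Vector_Spaces.linear_def by auto
  have "independent (f ` B)"
    using B(2) inj by (rule f.independent_injective_image)
  moreover have "span (f ` B) = T"
    using f.span_image sp im by simp
  ultimately have "dim T = card (f ` B)"
    by (metis dim_span_eq_card_independent)
  also have "\<dots> = card B"
    using inj span_superset by (metis card_image inj_on_subset)
  finally show ?thesis using B by simp
qed

lemma subspace_joint_eigenspace:
  assumes "\<And>a. a \<in> J \<Longrightarrow> Vector_Spaces.linear scale scale (A a)"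
  shows "subspace (joint_eigenspace scale A J \<tau>)"
  unfolding subspace_def joint_eigenspace_def
  by (auto simp: linD[OF assms] algebra_simps)

lemma joint_eigenspaces_independent:
  assumes lin: "\<And>a. a \<in> J \<Longrightarrow> Vector_Spaces.linear scale scale (A a)"
    and "finite T" "\<And>\<tau>. \<tau> \<in> T \<Longrightarrow> x \<tau> \<in> joint_eigenspace scale A J \<tau>"
    and "\<And>\<tau> \<tau>'. \<tau> \<in> T \<Longrightarrow> \<tau>' \<in> T \<Longrightarrow> \<tau> \<noteq> \<tau>' \<Longrightarrow> \<exists>a\<in>J. \<tau> a \<noteq> \<tau>' a"
    and "(\<Sum>\<tau>\<in>T. x \<tau>) = 0" "\<tau> \<in> T"
  shows "x \<tau> = 0"
  using assms(2-)
proof (induction T arbitrary: x \<tau> rule: finite_induct)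
  case empty
  then show ?case by simp
next
  case (insert \<sigma> T)
  have zero: "x \<tau>' = 0" if mem: "\<tau>' \<in> T" for \<tau>'
  proof -
    obtain a where a: "a \<in> J" "\<tau>' a \<noteq> \<sigma> a"
      using insert.prems(2)[of \<tau>' \<sigma>] insert.hyps(2) mem by (metis insertI1 insertI2)
    define y where "y \<tau> = scale (\<tau> a - \<sigma> a) (x \<tau>)" for \<tau>
    have "A a (\<Sum>\<tau>\<in>insert \<sigma> T. x \<tau>) = 0"
      using insert.prems(3) a(1) by (simp only: linD[OF lin])
    then have "(\<Sum>\<tau>\<in>insert \<sigma> T. scale (\<tau> a) (x \<tau>)) = 0"
      using a(1) insert.prems(1) by (simp add: linD[OF lin] joint_eigenspace_def)
    moreover have "(\<Sum>\<tau>\<in>insert \<sigma> T. scale (\<sigma> a) (x \<tau>)) = 0"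
      using insert.prems(3) by (metis scale_sum_right scale_zero_right)
    ultimately have "(\<Sum>\<tau>\<in>insert \<sigma> T. y \<tau>) = 0"
      by (simp only: y_def scale_left_diff_distrib sum_subtractf diff_self)
    then have "(\<Sum>\<tau>\<in>T. y \<tau>) = 0"
      using insert.hyps by (simp add: y_def)
    moreover have "y \<tau> \<in> joint_eigenspace scale A J \<tau>" if "\<tau> \<in> T" for \<tau>
      using insert.prems(1) subspace_joint_eigenspace[OF lin] that
      by (auto simp: y_def intro!: subspace_scale)
    ultimately have "y \<tau>' = 0"
      using insert.IH[of y \<tau>'] insert.prems(2) that by blast
    then show ?thesis using a by (simp add: y_def)
  qed
  then have "x \<sigma> = 0"
    using insert.prems(3) insert.hyps by simp
  then show ?case using zero insert.prems(4) by auto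
qed

lemma span_joint_eigenspaces_decompose:
  assumes lin: "\<And>a. a \<in> J \<Longrightarrow> Vector_Spaces.linear scale scale (A a)"
    and "w \<in> span (\<Union>\<tau>\<in>C. joint_eigenspace scale A J \<tau>)"
  shows "\<exists>T x. finite T \<and> T \<subseteq> C \<and> (\<forall>\<tau>. x \<tau> \<in> joint_eigenspace scale A J \<tau>) \<and> w = (\<Sum>\<tau>\<in>T. x \<tau>)"
  using assms(2)
proof (induction rule: span_induct_alt)
  case base
  show ?case
    by (rule exI[of _ "{}"], rule exI[of _ "\<lambda>_. 0"])
      (use subspace_0[OF subspace_joint_eigenspace[OF lin]] in auto)
next
  case (step c b y)
  then obtain T x where T: "finite T" "T \<subseteq> C" "\<And>\<tau>. x \<tau> \<in> joint_eigenspace scale A J \<tau>"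
    "y = (\<Sum>\<tau>\<in>T. x \<tau>)" by blast
  from step obtain \<sigma> where \<sigma>: "\<sigma> \<in> C" "b \<in> joint_eigenspace scale A J \<sigma>" by blast
  define x' where "x' = x(\<sigma> := (if \<sigma> \<in> T then x \<sigma> else 0) + scale c b)"
  have "x' \<tau> \<in> joint_eigenspace scale A J \<tau>" for \<tau>
    using T(3) \<sigma>(2) subspace_joint_eigenspace[OF lin]
    by (auto simp: x'_def intro!: subspace_add subspace_scale)
  moreover have "(\<Sum>\<tau>\<in>insert \<sigma> T. x' \<tau>) = scale c b + y"
  proof -
    have "(\<Sum>\<tau>\<in>insert \<sigma> T. x' \<tau>) = x' \<sigma> + (\<Sum>\<tau>\<in>T - {\<sigma>}. x' \<tau>)"
      using T(1) by (simp add: sum.insert_remove)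
    also have "(\<Sum>\<tau>\<in>T - {\<sigma>}. x' \<tau>) = (\<Sum>\<tau>\<in>T - {\<sigma>}. x \<tau>)"
      by (rule sum.cong) (auto simp: x'_def)
    also have "x' \<sigma> + \<dots> = scale c b + y"
      using T(1,4) by (auto simp: x'_def sum.remove)
    finally show ?thesis .
  qed
  ultimately show ?case
    using T(1,2) \<sigma>(1) by (intro exI[of _ "insert \<sigma> T"] exI[of _ x']) auto
qed

text \<open>The components of \<open>w\<close> in the listed eigenspaces together with \<open>-w\<close> are eigenvectors to distinct weights
  with sum zero.\<close>

lemma joint_eigenvector_outside:
  assumes lin: "\<And>a. a \<in> J \<Longrightarrow> Vector_Spaces.linear scale scale (A a)"
    and w: "w \<in> span (\<Union>\<tau>\<in>C. joint_eigenspace scale A J \<tau>)" "w \<in> joint_eigenspace scale A J \<sigma>"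
    and out: "\<And>\<tau>. \<tau> \<in> C \<Longrightarrow> \<exists>a\<in>J. \<tau> a \<noteq> \<sigma> a"
    and sep: "\<And>\<tau> \<tau>'. \<tau> \<in> C \<Longrightarrow> \<tau>' \<in> C \<Longrightarrow> \<tau> \<noteq> \<tau>' \<Longrightarrow> \<exists>a\<in>J. \<tau> a \<noteq> \<tau>' a"
  shows "w = 0"
proof -
  obtain T x where T: "finite T" "T \<subseteq> C" "\<And>\<tau>. x \<tau> \<in> joint_eigenspace scale A J \<tau>"
    "w = (\<Sum>\<tau>\<in>T. x \<tau>)" using span_joint_eigenspaces_decompose[OF lin w(1)] by metis
  have nin: "\<sigma> \<notin> T" using out T(2) by blast
  define x' where "x' = x(\<sigma> := - w)"
  have "x' \<sigma> = 0"
  proof (rule joint_eigenspaces_independent[OF lin, where T = "insert \<sigma> T" and \<tau> = \<sigma>])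
    show "x' \<tau> \<in> joint_eigenspace scale A J \<tau>" for \<tau>
      using T(3) w(2) subspace_joint_eigenspace[OF lin] by (auto simp: x'_def intro!: subspace_neg)
    have "(\<Sum>\<tau>\<in>T. x' \<tau>) = w"
      unfolding T(4) by (rule sum.cong) (use nin in \<open>auto simp: x'_def\<close>)
    then show "(\<Sum>\<tau>\<in>insert \<sigma> T. x' \<tau>) = 0"
      using T(1) nin by (simp add: x'_def)
    show "\<exists>a\<in>J. \<tau> a \<noteq> \<tau>' a" if "\<tau> \<in> insert \<sigma> T" "\<tau>' \<in> insert \<sigma> T" "\<tau> \<noteq> \<tau>'" for \<tau> \<tau>'
      using that out sep T(2) by (metis insertE subsetD)
  qed (use T in auto)
  then show ?thesis by (simp add: x'_def)
qed

text \<open>Decompose a joint eigenvector of the earlier operators into eigenvectors of the next one. Since the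
  operators commute, the components are again eigenvectors of the earlier ones, by independence.\<close>

lemma simultaneously_diagonalizable:
  assumes "finite J"
    and lin: "\<And>a. a \<in> J \<Longrightarrow> Vector_Spaces.linear scale scale (A a)"
    and comm: "\<And>a b w. a \<in> J \<Longrightarrow> b \<in> J \<Longrightarrow> A a (A b w) = A b (A a w)"
    and diag: "\<And>a. a \<in> J \<Longrightarrow> diagonalizable scale (A a)"
  shows "span {w. \<forall>a\<in>J. \<exists>c. A a w = scale c w} = UNIV"
  using assms
proof (induction J rule: finite_induct)
  case empty
  then show ?case by (simp add: span_UNIV)
next
  case (insert j J)
  let ?X = "{w. \<forall>a\<in>insert j J. \<exists>c. A a w = scale c w}"
  have linj: "Vector_Spaces.linear scale scale (A j)" using insert.prems by simp
  have "{w. \<forall>a\<in>J. \<exists>c. A a w = scale c w} \<subseteq> span ?X"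
  proof
    fix w assume "w \<in> {w. \<forall>a\<in>J. \<exists>c. A a w = scale c w}"
    then obtain \<kappa> where \<kappa>: "\<And>a. a \<in> J \<Longrightarrow> A a w = scale (\<kappa> a) w" by (simp; metis)
    have "w \<in> span {x. \<exists>c. A j x = scale c x}"
      using insert.prems(3)[of j] by (simp add: diagonalizable_def)
    moreover have "{x. \<exists>c. A j x = scale c x} =
        (\<Union>\<tau>\<in>range (\<lambda>c _. c). joint_eigenspace scale (\<lambda>_::unit. A j) UNIV \<tau>)"
      by (auto simp: joint_eigenspace_def)
    ultimately obtain T x where T: "finite T" "T \<subseteq> range (\<lambda>c _. c)"
      "\<And>\<tau>. x \<tau> \<in> joint_eigenspace scale (\<lambda>_::unit. A j) UNIV \<tau>" "w = (\<Sum>\<tau>\<in>T. x \<tau>)"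
      using span_joint_eigenspaces_decompose[of UNIV "\<lambda>_. A j" w "range (\<lambda>c _. c)"] linj
      by metis
    have "x \<tau> \<in> ?X" if "\<tau> \<in> T" for \<tau>
    proof -
      have "A a (x \<tau>) = scale (\<kappa> a) (x \<tau>)" if a: "a \<in> J" for a
      proof -
        have lina: "Vector_Spaces.linear scale scale (A a)" using insert.prems a by simp
        have "A a (x \<tau>) - scale (\<kappa> a) (x \<tau>) = 0"
        proof (rule joint_eigenspaces_independent[where A = "\<lambda>_::unit. A j" and J = UNIV and T = T
              and x = "\<lambda>\<tau>. A a (x \<tau>) - scale (\<kappa> a) (x \<tau>)"])
          show "A a (x \<tau>) - scale (\<kappa> a) (x \<tau>) \<in> joint_eigenspace scale (\<lambda>_. A j) UNIV \<tau>"
            for \<tau>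
            using T(3)[of \<tau>] insert.prems(2)[of j a "x \<tau>"] a
            by (simp add: joint_eigenspace_def linD[OF linj] linD[OF lina] scale_right_diff_distrib
                mult.commute)
          show "(\<Sum>\<tau>\<in>T. A a (x \<tau>) - scale (\<kappa> a) (x \<tau>)) = 0"
            using \<kappa>[OF a] unfolding T(4)
            by (simp add: linD[OF lina] sum_subtractf scale_sum_right)
          show "\<exists>a\<in>UNIV. \<tau> a \<noteq> \<tau>' a" if "\<tau> \<noteq> \<tau>'" for \<tau> \<tau>' :: "unit \<Rightarrow> complex"
            using that by auto
        qed (use linj T(1) \<open>\<tau> \<in> T\<close> in auto)
        then show ?thesis by simp
      qed
      then show ?thesis using T(3)[of \<tau>] by (auto simp: joint_eigenspace_def)
    qed
    then show "w \<in> span ?X"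
      unfolding T(4) by (intro span_sum span_base) auto
  qed
  then have "span {w. \<forall>a\<in>J. \<exists>c. A a w = scale c w} \<subseteq> span ?X"
    by (simp add: span_minimal)
  then show ?case using insert by auto
qed

text \<open>Two different bases are allowed on the two sides, so that with \<open>g = id\<close> the lemma also gives the
  independence of the trace from the basis.\<close>

lemma trace_product_commute:
  assumes fd: "finite B0" "span B0 = UNIV"
    and f: "Vector_Spaces.linear scale scale f" and g: "Vector_Spaces.linear scale scale g"
    and B: "independent B" "span B = UNIV" and B': "independent B'" "span B' = UNIV"
  shows "(\<Sum>b\<in>B. representation B (f (g b)) b) = (\<Sum>b\<in>B'. representation B' (g (f b)) b)"
proof -
  have fin: "finite B" "finite B'"
    using independent_span_bound[OF fd(1)] B(1) B'(1) fd(2) by auto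
  have expand: "h x = (\<Sum>b\<in>C. scale (representation C x b) (h b))"
    if h: "Vector_Spaces.linear scale scale h" and C: "finite C" "independent C" "span C = UNIV" for h C x
  proof -
    have "(\<Sum>b\<in>C. scale (representation C x b) b) = x"
      by (rule sum_representation_eq) (use C in auto)
    then have "h x = h (\<Sum>b\<in>C. scale (representation C x b) b)" by simp
    then show ?thesis by (simp only: linD[OF h])
  qed
  have rep: "representation C (h y) b = (\<Sum>b'\<in>D. representation D y b' * representation C (h b') b)"
    if h: "Vector_Spaces.linear scale scale h" and C: "independent C" "span C = UNIV"
      and D: "finite D" "independent D" "span D = UNIV" for h C D y b
    by (subst expand[OF h D], subst representation_sum)
      (use C in \<open>auto simp: representation_scale\<close>)
  have "(\<Sum>b\<in>B. representation B (f (g b)) b) =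
      (\<Sum>b\<in>B. \<Sum>b'\<in>B'. representation B' (g b) b' * representation B (f b') b)"
    by (intro sum.cong refl rep f B B' fin)
  also have "\<dots> = (\<Sum>b'\<in>B'. \<Sum>b\<in>B. representation B' (g b) b' * representation B (f b') b)"
    by (rule sum.swap)
  also have "\<dots> = (\<Sum>b'\<in>B'. \<Sum>b\<in>B. representation B (f b') b * representation B' (g b) b')"
    by (simp add: mult.commute)
  also have "\<dots> = (\<Sum>b\<in>B'. representation B' (g (f b)) b)"
    by (intro sum.cong refl rep[symmetric] g B B' fin)
  finally show ?thesis .
qed

lemma trace_basis:
  assumes fd: "finite B0" "span B0 = UNIV" and f: "Vector_Spaces.linear scale scale f"
    and B: "independent B" "span B = UNIV"
  shows "trace scale f = (\<Sum>b\<in>B. representation B (f b) b)"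
proof -
  define C where "C = (SOME B. independent B \<and> span B = UNIV)"
  have C: "independent C \<and> span C = UNIV"
    unfolding C_def by (rule someI[of _ B]) (use B in auto)
  have "Vector_Spaces.linear scale scale (\<lambda>x. x)" by (rule linearI) auto
  from trace_product_commute[OF fd f this] show ?thesis
    using B C unfolding trace_def C_def[symmetric] Let_def by blast
qed

lemma exists_basis_within:
  assumes "span X = UNIV"
  obtains B where "B \<subseteq> X" "independent B" "span B = UNIV"
proof -
  obtain B where "B \<subseteq> X" "independent B" "X \<subseteq> span B"
    using maximal_independent_subset[of X] by auto
  moreover from this have "span B = UNIV"
    using assms by (metis span_mono span_span top.extremum_uniqueI)
  ultimately show ?thesis using that by blast
qed

lemma trace_compose_commute:
  assumes fd: "finite B0" "span B0 = UNIV"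
    and f: "Vector_Spaces.linear scale scale f" and g: "Vector_Spaces.linear scale scale g"
  shows "trace scale (\<lambda>x. f (g x)) = trace scale (\<lambda>x. g (f x))"
proof -
  obtain B where B: "independent B" "span B = UNIV"
    using exists_basis_within[of UNIV] span_UNIV by metis
  have "Vector_Spaces.linear scale scale (\<lambda>x. f (g x))" "Vector_Spaces.linear scale scale (\<lambda>x. g (f x))"
    by (auto intro!: linearI simp: linD[OF f] linD[OF g])
  then show ?thesis
    using trace_product_commute[OF fd f g B B] by (simp add: trace_basis[OF fd _ B])
qed

lemma trace_linear:
  assumes fd: "finite B0" "span B0 = UNIV"
    and f: "Vector_Spaces.linear scale scale f" and g: "Vector_Spaces.linear scale scale g"
  shows "trace scale (\<lambda>x. f x + g x) = trace scale f + trace scale g"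
    and "trace scale (\<lambda>x. scale c (f x)) = c * trace scale f"
proof -
  obtain B where B: "independent B" "span B = UNIV"
    using exists_basis_within[of UNIV] span_UNIV by metis
  have "Vector_Spaces.linear scale scale (\<lambda>x. f x + g x)"
    "Vector_Spaces.linear scale scale (\<lambda>x. scale c (f x))"
    by (auto intro!: linearI simp: linD[OF f] linD[OF g] algebra_simps)
  then show "trace scale (\<lambda>x. f x + g x) = trace scale f + trace scale g"
    "trace scale (\<lambda>x. scale c (f x)) = c * trace scale f"
    using f g B by (simp_all add: trace_basis[OF fd _ B] representation_add representation_scale
        sum.distrib sum_distrib_left)
qed

lemma trace_eigenbasis:
  assumes fd: "finite B0" "span B0 = UNIV" and f: "Vector_Spaces.linear scale scale f"
    and B: "independent B" "span B = UNIV" and ev: "\<And>b. b \<in> B \<Longrightarrow> f b = scale (\<kappa> b) b"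
  shows "trace scale f = (\<Sum>b\<in>B. \<kappa> b)"
  unfolding trace_basis[OF fd f B]
  by (rule sum.cong) (use B in \<open>auto simp: ev representation_scale representation_basis\<close>)

end

section \<open>Locally nilpotent actions of \<open>sl\<^sub>2\<close>\<close>

locale sl2_action = complex_vector_space s
  for s :: "complex \<Rightarrow> 'v::ab_group_add \<Rightarrow> 'v" +
  fixes e f h :: "'v \<Rightarrow> 'v"
  assumes lin_e: "Vector_Spaces.linear s s e"
    and lin_f: "Vector_Spaces.linear s s f"
    and lin_h: "Vector_Spaces.linear s s h"
    and ef: "e (f w) - f (e w) = h w"
    and he: "h (e w) - e (h w) = s 2 (e w)"
    and hf: "h (f w) - f (h w) = s (- 2) (f w)"
begin

lemmas lin_simps = linD[OF lin_e] linD[OF lin_f] linD[OF lin_h]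

lemma opposite: "sl2_action s f e (\<lambda>w. - h w)"
proof (intro sl2_action.intro sl2_action_axioms.intro)
  show "complex_vector_space s" ..
  show "Vector_Spaces.linear s s (\<lambda>w. - h w)"
    by (rule linearI) (simp_all add: lin_simps scale_minus_right)
qed (use ef he hf in \<open>simp_all add: lin_simps lin_e lin_f algebra_simps scale_minus_left eq_diff_eq\<close>)

lemma weight_e: "h w = s z w \<Longrightarrow> h (e w) = s (z + 2) (e w)"
  using he[of w] by (simp add: lin_simps algebra_simps)

lemma weight_f: "h w = s z w \<Longrightarrow> h (f w) = s (z - 2) (f w)"
  using hf[of w] by (simp add: lin_simps algebra_simps scale_minus_left)

lemma weight_e_pow: "h w = s z w \<Longrightarrow> h ((e ^^ n) w) = s (z + 2 * of_nat n) ((e ^^ n) w)"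
proof (induction n)
  case (Suc n)
  show ?case using weight_e[OF Suc.IH[OF Suc.prems]] by (simp add: algebra_simps)
qed simp

lemma weight_f_pow: "h w = s z w \<Longrightarrow> h ((f ^^ n) w) = s (z - 2 * of_nat n) ((f ^^ n) w)"
proof (induction n)
  case (Suc n)
  show ?case using weight_f[OF Suc.IH[OF Suc.prems]] by (simp add: algebra_simps)
qed simp

text \<open>The Casimir operator shifted by \<open>b\<close>. On a vector of weight \<open>z\<close>, both \<open>fe\<close> and \<open>ef\<close> are a
  quarter of such an operator, so \<open>f\<^sup>ne\<^sup>n\<close> and \<open>e\<^sup>nf\<^sup>n\<close> are polynomials in the Casimir operator.\<close>

definition cas :: "complex \<Rightarrow> 'v \<Rightarrow> 'v" where
  "cas b w = s 4 (f (e w)) + h (h w) + s 2 (h w) - s b w"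

lemma lin_cas: "Vector_Spaces.linear s s (cas b)"
  by (rule linearI) (simp_all add: cas_def lin_simps algebra_simps)

lemma cas_shift: "cas b w = cas c w + s (c - b) w"
  by (simp add: cas_def algebra_simps)

lemma cas_commute: "cas b (cas c w) = cas c (cas b w)"
  by (simp add: cas_shift[of b _ 0] cas_shift[of c _ 0] linD[OF lin_cas] algebra_simps)

lemma fe_cas: "h w = s z w \<Longrightarrow> f (e w) = s (1 / 4) (cas (z * (z + 2)) w)"
  by (simp add: cas_def lin_simps algebra_simps)

lemma ef_cas:
  assumes "h w = s z w"
  shows "e (f w) = s (1 / 4) (cas (z * (z - 2)) w)"
proof -
  have "e (f w) = f (e w) + s z w" using ef[of w] assms by (simp add: algebra_simps)
  also have "\<dots> = s (1 / 4) (cas (z * (z - 2)) w)"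
    using assms by (simp add: cas_def lin_simps algebra_simps flip: scale_left_distrib)
  finally show ?thesis .
qed

lemma e_cas: "e (cas b w) = cas b (e w)"
proof -
  have 1: "h (e w) = e (h w) + s 2 (e w)" for w using he[of w] by (simp add: algebra_simps)
  have 2: "e (f w) = f (e w) + h w" for w using ef[of w] by (simp add: algebra_simps)
  have "e (cas b w) = s 4 (e (f (e w))) + e (h (h w)) + s 2 (e (h w)) - s b (e w)"
    by (simp add: cas_def lin_simps)
  also have "e (f (e w)) = f (e (e w)) + h (e w)" by (rule 2)
  finally have "e (cas b w) = s 4 (f (e (e w))) + s 4 (h (e w)) + e (h (h w)) + s 2 (e (h w)) - s b (e w)"
    by (simp add: algebra_simps)
  moreover have "cas b (e w) = s 4 (f (e (e w))) + e (h (h w)) + s 2 (e (h w)) + s 4 (h (e w)) - s b (e w)"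
    unfolding cas_def by (simp add: 1 lin_simps algebra_simps flip: scale_left_distrib)
  ultimately show ?thesis by simp
qed

lemma f_cas: "f (cas b w) = cas b (f w)"
proof -
  have 1: "h (f w) = f (h w) - s 2 (f w)" for w
    using hf[of w] by (simp add: algebra_simps scale_minus_left)
  have 2: "e (f w) = f (e w) + h w" for w using ef[of w] by (simp add: algebra_simps)
  have "cas b (f w) = s 4 (f (f (e w) + h w)) + h (h (f w)) + s 2 (h (f w)) - s b (f w)"
    by (simp add: cas_def 2)
  also have "\<dots> = f (cas b w)"
    by (simp add: cas_def 1 lin_simps algebra_simps flip: scale_left_distrib)
  finally show ?thesis by simp
qed

lemma e_pow_cas: "(e ^^ n) (cas b w) = cas b ((e ^^ n) w)"
  by (induction n) (auto simp: e_cas)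

lemma f_pow_cas: "(f ^^ n) (cas b w) = cas b ((f ^^ n) w)"
  by (induction n) (auto simp: f_cas)

primrec cas_prod :: "(nat \<Rightarrow> complex) \<Rightarrow> nat \<Rightarrow> 'v \<Rightarrow> 'v" where
  "cas_prod b 0 w = w"
| "cas_prod b (Suc n) w = cas (b n) (cas_prod b n w)"

lemma cas_cas_prod: "cas c (cas_prod b n w) = cas_prod b n (cas c w)"
  by (induction n) (auto simp: cas_commute[of c])

lemma f_pow_e_pow:
  assumes "h w = s z w"
  shows "(f ^^ n) ((e ^^ n) w) =
    s ((1 / 4) ^ n) (cas_prod (\<lambda>i. (z + 2 * of_nat i) * (z + 2 * of_nat i + 2)) n w)"
proof (induction n)
  case (Suc n)
  have "(f ^^ Suc n) ((e ^^ Suc n) w) = (f ^^ n) (f (e ((e ^^ n) w)))"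
    by (simp add: funpow_swap1)
  also have "\<dots> = (f ^^ n) (s (1 / 4) (cas ((z + 2 * of_nat n) * (z + 2 * of_nat n + 2)) ((e ^^ n) w)))"
    by (simp add: fe_cas[OF weight_e_pow[OF assms]])
  finally show ?case
    by (simp add: linD[OF linear_funpow[OF lin_f]] f_pow_cas Suc.IH linD[OF lin_cas])
qed auto

lemma e_pow_f_pow:
  assumes "h w = s z w"
  shows "(e ^^ n) ((f ^^ n) w) =
    s ((1 / 4) ^ n) (cas_prod (\<lambda>i. (z - 2 * of_nat i) * (z - 2 * of_nat i - 2)) n w)"
proof (induction n)
  case (Suc n)
  have "(e ^^ Suc n) ((f ^^ Suc n) w) = (e ^^ n) (e (f ((f ^^ n) w)))"
    by (simp add: funpow_swap1)
  also have "\<dots> = (e ^^ n) (s (1 / 4) (cas ((z - 2 * of_nat n) * (z - 2 * of_nat n - 2)) ((f ^^ n) w)))"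
    by (simp add: ef_cas[OF weight_f_pow[OF assms]])
  finally show ?case
    by (simp add: linD[OF linear_funpow[OF lin_e]] e_pow_cas Suc.IH linD[OF lin_cas])
qed auto

text \<open>If \<open>e\<^sup>nw = 0\<close> then \<open>f\<^sup>ne\<^sup>nw = 0\<close> is a polynomial equation for the Casimir operator on \<open>w\<close> with
  explicit roots, so the shift by any other \<open>b\<close> is invertible.\<close>

lemma cas_bij_betw:
  assumes M: "subspace M" "\<And>w. w \<in> M \<Longrightarrow> h w = s z w" "\<And>c w. w \<in> M \<Longrightarrow> cas c w \<in> M"
    and nil: "\<And>w. \<exists>n. (e ^^ n) w = 0"
    and b: "\<And>i. b \<noteq> (z + 2 * of_nat i) * (z + 2 * of_nat i + 2)"
  shows "bij_betw (cas b) M M"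
proof -
  define r where "r = (\<lambda>i. (z + 2 * of_nat i) * (z + 2 * of_nat i + 2))"
  have ann: "\<exists>n. cas_prod r n w = 0" if "w \<in> M" for w
  proof -
    obtain n where "(e ^^ n) w = 0" using nil by blast
    then have "s ((1 / 4) ^ n) (cas_prod r n w) = 0"
      using f_pow_e_pow[OF M(2)[OF that], of n] linD(3)[OF linear_funpow[OF lin_f]] by (simp add: r_def)
    then show ?thesis by auto
  qed
  have "w = 0" if "w \<in> M" "cas b w = 0" for w
  proof -
    have "cas_prod r n w = s (\<Prod>i<n. b - r i) w" for n
    proof (induction n)
      case (Suc n)
      have "cas (r n) w = s (b - r n) w" using cas_shift[of "r n" w b] that by simp
      then show ?case using Suc by (simp add: linD[OF lin_cas])
    qed simp
    then have "\<exists>n. (\<Prod>i<n. b - r i) = 0 \<or> w = 0" using ann[OF that(1)] by force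
    moreover have "(\<Prod>i<n. b - r i) \<noteq> 0" for n using b by (auto simp: r_def)
    ultimately show ?thesis by blast
  qed
  then have "inj_on (cas b) M"
    using M(1) by (auto intro!: inj_onI dest!: subspace_diff simp: linD[OF lin_cas])
      (metis eq_iff_diff_eq_0 linD(4) lin_cas subspace_diff M(1))
  moreover have "\<exists>u\<in>M. cas b u = w" if "w \<in> M" "cas_prod r n w = 0" for n w
    using that
  proof (induction n arbitrary: w)
    case 0
    then show ?case by (auto intro!: bexI[of _ 0] simp: linD[OF lin_cas] subspace_0[OF M(1)])
  next
    case (Suc n)
    then obtain u where u: "u \<in> M" "cas b u = cas (r n) w"
      using M(3) cas_cas_prod by (metis cas_prod.simps(2))
    have ne: "b - r n \<noteq> 0" using b[of n] by (auto simp: r_def)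
    have "cas b (s (1 / (b - r n)) (u - w)) = s (1 / (b - r n)) (cas (r n) w - cas b w)"
      by (simp add: linD[OF lin_cas] u)
    also have "cas (r n) w - cas b w = s (b - r n) w" using cas_shift[of "r n" w b] by simp
    finally have "cas b (s (1 / (b - r n)) (u - w)) = w" using ne by simp
    then show ?case using u Suc.prems M(1) by (meson subspace_diff subspace_scale)
  qed
  ultimately show ?thesis
    using ann M(3) by (auto simp: bij_betw_def image_iff) metis
qed

lemma cas_prod_bij_betw:
  assumes "\<And>i. i < n \<Longrightarrow> bij_betw (cas (b i)) M M"
  shows "bij_betw (cas_prod b n) M M"
  using assms
proof (induction n)
  case 0
  show ?case by (simp add: bij_betw_def inj_on_def)
next
  case (Suc n)
  have "cas_prod b (Suc n) = cas (b n) \<circ> cas_prod b n" by auto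
  then show ?case using Suc by (metis bij_betw_trans lessI less_SucI)
qed

lemma e_pow_f_pow_bij_betw:
  assumes M: "subspace M" "\<And>w. w \<in> M \<Longrightarrow> h w = s (of_nat p) w" "\<And>c w. w \<in> M \<Longrightarrow> cas c w \<in> M"
    and nil: "\<And>w. \<exists>n. (e ^^ n) w = 0"
  shows "bij_betw (\<lambda>w. (e ^^ p) ((f ^^ p) w)) M M"
proof -
  define b where "b = (\<lambda>i. (of_nat p - 2 * of_nat i :: complex) * (of_nat p - 2 * of_nat i - 2))"
  have "bij_betw (cas (b i)) M M" if "i < p" for i
  proof (rule cas_bij_betw[OF M nil])
    fix j
    \<comment> \<open>Both sides are of the form \<open>y\<^sup>2 - 1\<close>, with \<open>|y| < p\<close> on the left and \<open>y > p\<close> on the right.\<close>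
    have "(int p - 2 * int i) * (int p - 2 * int i - 2) < (int p + 2 * int j) * (int p + 2 * int j + 2)"
    proof -
      have "\<bar>int p - 2 * int i - 1\<bar> < int p + 2 * int j + 1" using that by linarith
      then have "(int p - 2 * int i - 1)\<^sup>2 < (int p + 2 * int j + 1)\<^sup>2"
        by (metis abs_ge_zero power2_abs power_strict_mono zero_less_numeral)
      then show ?thesis by (simp add: power2_eq_square algebra_simps)
    qed
    then have "of_int ((int p - 2 * int i) * (int p - 2 * int i - 2)) \<noteq>
      (of_int ((int p + 2 * int j) * (int p + 2 * int j + 2)) :: complex)"
      unfolding of_int_eq_iff by simp
    then show "b i \<noteq> (of_nat p + 2 * of_nat j) * (of_nat p + 2 * of_nat j + 2)"
      by (simp add: b_def)
  qed
  then have "bij_betw (cas_prod b p) M M" by (rule cas_prod_bij_betw)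
  moreover have "bij_betw (s ((1 / 4) ^ p)) M M"
    by (rule bij_betw_byWitness[where f' = "s (4 ^ p)"])
      (use M(1) in \<open>auto simp: subspace_scale power_one_over\<close>)
  ultimately have "bij_betw (s ((1 / 4) ^ p) \<circ> cas_prod b p) M M" by (rule bij_betw_trans)
  moreover have "(s ((1 / 4) ^ p) \<circ> cas_prod b p) w = (e ^^ p) ((f ^^ p) w)" if "w \<in> M" for w
    using e_pow_f_pow[OF M(2)[OF that], of p] by (simp add: b_def)
  ultimately show ?thesis by (simp cong: bij_betw_cong)
qed

text \<open>The reflection principle for \<open>sl\<^sub>2\<close>. It is stated for Casimir stable subspaces \<open>M\<close>, \<open>M'\<close> of weight spaces, since in
  the applications these are joint eigenspaces for further operators. Finite dimensionality is
  replaced by local nilpotency: \<open>e\<^sup>pf\<^sup>p\<close> is a product of invertible shifts of the Casimir operator.\<close>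

lemma f_pow_bij_betw:
  assumes M: "subspace M" "\<And>w. w \<in> M \<Longrightarrow> h w = s (of_nat p) w" "\<And>c w. w \<in> M \<Longrightarrow> cas c w \<in> M"
    and M': "subspace M'" "\<And>w. w \<in> M' \<Longrightarrow> h w = s (- of_nat p) w" "\<And>c w. w \<in> M' \<Longrightarrow> cas c w \<in> M'"
    and maps: "\<And>w. w \<in> M \<Longrightarrow> (f ^^ p) w \<in> M'" "\<And>w. w \<in> M' \<Longrightarrow> (e ^^ p) w \<in> M"
    and nil: "\<And>w. \<exists>n. (e ^^ n) w = 0" "\<And>w. \<exists>n. (f ^^ n) w = 0"
  shows "bij_betw (f ^^ p) M M'"
proof -
  interpret op: sl2_action s f e "\<lambda>w. - h w" by (rule opposite)
  have opcas: "op.cas c w = cas c w" for c w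
  proof -
    have "e (f w) = f (e w) + h w" using ef[of w] by (simp add: algebra_simps)
    moreover have "s 4 (h w) = s 2 (h w) + s 2 (h w)" by (simp flip: scale_left_distrib)
    ultimately show ?thesis
      by (simp add: op.cas_def cas_def lin_simps scale_right_distrib scale_minus_right)
  qed
  have 1: "bij_betw (\<lambda>w. (e ^^ p) ((f ^^ p) w)) M M"
    by (rule e_pow_f_pow_bij_betw[OF M nil(1)])
  have 2: "bij_betw (\<lambda>w. (f ^^ p) ((e ^^ p) w)) M' M'"
    by (rule op.e_pow_f_pow_bij_betw[OF M'(1) _ _ nil(2)])
      (use M' in \<open>auto simp: opcas scale_minus_left\<close>)
  have inj: "inj_on (f ^^ p) M" using 1 by (auto simp: bij_betw_def inj_on_def)
  have inj': "inj_on (e ^^ p) M'" using 2 by (auto simp: bij_betw_def inj_on_def)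
  have "\<exists>w\<in>M. (f ^^ p) w = u" if u: "u \<in> M'" for u
  proof -
    have "(e ^^ p) u \<in> (\<lambda>w. (e ^^ p) ((f ^^ p) w)) ` M"
      using 1 maps(2)[OF u] by (simp add: bij_betw_def)
    then obtain w where w: "w \<in> M" "(e ^^ p) ((f ^^ p) w) = (e ^^ p) u" by auto
    then have "(f ^^ p) w = u" using inj' maps(1) u by (auto dest: inj_onD)
    then show ?thesis using w by blast
  qed
  then show ?thesis using inj maps by (auto simp: bij_betw_def)
qed

lemma e_f_pow:
  assumes "h u = s N u" "e u = 0"
  shows "e ((f ^^ Suc j) u) = s (of_nat (Suc j) * (N - of_nat j)) ((f ^^ j) u)"
proof (induction j)
  case 0
  then show ?case using ef[of u] assms by (simp add: lin_simps)
next
  case (Suc j)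
  have "e ((f ^^ Suc (Suc j)) u) = f (e ((f ^^ Suc j) u)) + h ((f ^^ Suc j) u)"
    using ef[of "(f ^^ Suc j) u"] by (simp add: algebra_simps)
  also have "\<dots> = s (of_nat (Suc j) * (N - of_nat j) + (N - 2 * of_nat (Suc j))) ((f ^^ Suc j) u)"
    unfolding Suc.IH weight_f_pow[OF assms(1)] by (simp only: lin_simps funpow.simps o_def scale_left_distrib)
  also have "of_nat (Suc j) * (N - of_nat j) + (N - 2 * of_nat (Suc j)) = of_nat (Suc (Suc j)) * (N - of_nat (Suc j))"
    by (simp add: algebra_simps)
  finally show ?case .
qed

lemma highest_weight_nat:
  assumes "h u = s N u" "e u = 0" "u \<noteq> 0" "(f ^^ n) u = 0"
  shows "N \<in> \<nat>"
  using assms(4)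
proof (induction n)
  case (Suc n)
  then have "s (of_nat (Suc n) * (N - of_nat n)) ((f ^^ n) u) = 0"
    using e_f_pow[OF assms(1,2), of n] by (simp only: lin_simps)
  then have "N = of_nat n \<or> (f ^^ n) u = 0" by (auto simp del: of_nat_Suc)
  then show ?case using Suc.IH by auto
qed (use assms in simp)

text \<open>Apply \<open>e\<close> as long as possible: this raises the weight by an even integer and ends at a highest weight
  vector.\<close>

lemma eigenvalue_Ints:
  assumes "h w = s z w" "w \<noteq> 0"
    and nil: "\<And>w. \<exists>n. (e ^^ n) w = 0" "\<And>w. \<exists>n. (f ^^ n) w = 0"
  shows "z \<in> \<int>"
proof -
  obtain m where m: "(e ^^ m) w \<noteq> 0" "(e ^^ Suc m) w = 0"
  proof -
    define l where "l = (LEAST n. (e ^^ n) w = 0)"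
    have l: "(e ^^ l) w = 0" unfolding l_def by (rule LeastI_ex[OF nil(1)])
    then obtain m where m: "l = Suc m" using assms(2) by (cases l) auto
    then have "(e ^^ m) w \<noteq> 0" using not_less_Least[of m "\<lambda>n. (e ^^ n) w = 0"] by (simp add: l_def)
    with l m that show thesis by blast
  qed
  obtain n where "(f ^^ n) ((e ^^ m) w) = 0" using nil(2) by blast
  from highest_weight_nat[OF weight_e_pow[OF assms(1)] _ m(1) this] m(2)
  have "z + 2 * of_nat m \<in> \<nat>" by simp
  then have "z + of_nat (2 * m) \<in> \<int>" by (metis Nats_subset_Ints of_nat_mult of_nat_numeral subsetD)
  then show ?thesis by (metis Ints_diff Ints_of_nat add_diff_cancel_right')
qed

text \<open>For weight \<open>x > 0\<close> the operator \<open>ef\<close> is a shift of the Casimir operator that avoids all its possible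
  eigenvalues.\<close>

lemma e_f_surj:
  assumes M: "subspace M" "\<And>w. w \<in> M \<Longrightarrow> h w = s (of_real x) w" "\<And>c w. w \<in> M \<Longrightarrow> cas c w \<in> M"
    and nil: "\<And>w. \<exists>n. (e ^^ n) w = 0" and "x > 0" "w \<in> M"
  shows "\<exists>u\<in>M. w = e (f u)"
proof -
  have "bij_betw (cas (of_real x * (of_real x - 2))) M M"
  proof (rule cas_bij_betw[OF M nil])
    fix i
    have "\<bar>x - 1\<bar> < x + 2 * real i + 1" using \<open>x > 0\<close> by linarith
    then have "(x - 1)\<^sup>2 < (x + 2 * real i + 1)\<^sup>2"
      by (metis abs_ge_zero power2_abs power_strict_mono zero_less_numeral)
    then have "x * (x - 2) \<noteq> (x + 2 * real i) * (x + 2 * real i + 2)"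
      by (simp add: power2_eq_square algebra_simps)
    then have "complex_of_real (x * (x - 2)) \<noteq> complex_of_real ((x + 2 * real i) * (x + 2 * real i + 2))"
      unfolding of_real_eq_iff .
    then show "complex_of_real x * (complex_of_real x - 2) \<noteq>
        (complex_of_real x + 2 * of_nat i) * (complex_of_real x + 2 * of_nat i + 2)"
      by simp
  qed
  moreover have "s 4 w \<in> M" using assms by (simp add: subspace_scale)
  ultimately obtain u where u: "u \<in> M" "cas (of_real x * (of_real x - 2)) u = s 4 w"
    by (metis bij_betw_imp_surj_on imageE)
  then have "e (f u) = w" by (simp add: ef_cas[OF M(2)])
  then show ?thesis using u by blast
qed

end

section \<open>A norm bound from simple reflections\<close>

lemma quadratic_form_shift:
  fixes G :: "'j \<Rightarrow> 'j \<Rightarrow> real" and x L :: "'j \<Rightarrow> real"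
  assumes "finite J" "\<And>i j. G i j = G j i" "j \<in> J"
  defines "Q \<equiv> \<lambda>x. (\<Sum>i\<in>J. \<Sum>k\<in>J. x i * x k * G i k) - 2 * (\<Sum>i\<in>J. x i * L i)"
  shows "Q (x(j := x j + d)) = Q x + d * (d * G j j - 2 * (L j - (\<Sum>i\<in>J. x i * G i j)))"
proof -
  define \<delta> where "\<delta> i = (if i = j then d else 0)" for i
  have upd: "x(j := x j + d) = (\<lambda>i. x i + \<delta> i)" by (auto simp: \<delta>_def)
  have one: "(\<Sum>i\<in>J. \<delta> i * g i) = d * g j" for g
    using assms(1,3) by (simp add: \<delta>_def if_distrib[of "\<lambda>z. z * _"] cong: if_cong)
  have 1: "(\<Sum>i\<in>J. \<Sum>k\<in>J. \<delta> i * x k * G i k) = d * (\<Sum>i\<in>J. x i * G i j)"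
    using one[of "\<lambda>i. \<Sum>k\<in>J. x k * G i k"] assms(2)[of j]
    by (simp add: sum_distrib_left mult.assoc)
  have 2: "(\<Sum>i\<in>J. \<Sum>k\<in>J. x i * \<delta> k * G i k) = d * (\<Sum>i\<in>J. x i * G i j)"
  proof -
    have "(\<Sum>k\<in>J. x i * \<delta> k * G i k) = d * (x i * G i j)" for i
      using one[of "\<lambda>k. x i * G i k"] by (simp add: mult.left_commute mult.assoc)
    then show ?thesis by (simp add: sum_distrib_left)
  qed
  have 3: "(\<Sum>i\<in>J. \<Sum>k\<in>J. \<delta> i * \<delta> k * G i k) = d * d * G j j"
  proof -
    have "(\<Sum>k\<in>J. \<delta> i * \<delta> k * G i k) = \<delta> i * (d * G i j)" for i
      using one[of "\<lambda>k. \<delta> i * G i k"] by (simp add: mult.left_commute mult.assoc)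
    then show ?thesis using one[of "\<lambda>i. d * G i j"] by simp
  qed
  have "(\<Sum>i\<in>J. \<Sum>k\<in>J. (x i + \<delta> i) * (x k + \<delta> k) * G i k) =
      (\<Sum>i\<in>J. \<Sum>k\<in>J. x i * x k * G i k) + (\<Sum>i\<in>J. \<Sum>k\<in>J. x i * \<delta> k * G i k) +
      (\<Sum>i\<in>J. \<Sum>k\<in>J. \<delta> i * x k * G i k) + (\<Sum>i\<in>J. \<Sum>k\<in>J. \<delta> i * \<delta> k * G i k)"
    by (simp add: algebra_simps sum.distrib)
  moreover have "(\<Sum>i\<in>J. (x i + \<delta> i) * L i) = (\<Sum>i\<in>J. x i * L i) + d * L j"
    using one[of L] by (simp add: algebra_simps sum.distrib)
  ultimately show ?thesis
    unfolding Q_def upd 1 2 3 by (simp add: algebra_simps)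
qed

text \<open>Think of \<open>n\<close> as the weight \<open>\<Lambda> - \<Sum>n\<^sub>j\<alpha>\<^sub>j\<close>, of \<open>G\<close> as the form on the simple roots and of \<open>L\<^sub>j\<close> as
  \<open>\<langle>\<Lambda>, \<alpha>\<^sub>j\<rangle>\<close>. The claim is \<open>|\<Lambda> - \<Sum>n\<^sub>j\<alpha>\<^sub>j|\<^sup>2 \<le> |\<Lambda>|\<^sup>2\<close>. A reflection in \<open>\<alpha>\<^sub>j\<close> keeps the norm, and it
  decreases \<open>\<Sum>n\<^sub>j\<close> as long as the weight pairs negatively with \<open>\<alpha>\<^sub>j\<close>. So the weight may be taken
  dominant, and a dominant weight below the dominant \<open>\<Lambda>\<close> is not longer than \<open>\<Lambda>\<close>.\<close>

lemma reflection_norm_bound: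
  fixes G :: "'j \<Rightarrow> 'j \<Rightarrow> real" and L :: "'j \<Rightarrow> real" and P :: "('j \<Rightarrow> nat) set"
  assumes J: "finite J" and sym: "\<And>i j. G i j = G j i"
    and pos: "\<And>j. j \<in> J \<Longrightarrow> G j j > 0" "\<And>j. j \<in> J \<Longrightarrow> L j \<ge> 0"
    and refl: "\<And>n j. n \<in> P \<Longrightarrow> j \<in> J \<Longrightarrow> L j - (\<Sum>i\<in>J. real (n i) * G i j) < 0 \<Longrightarrow>
      \<exists>m. n(j := m) \<in> P \<and> real m = real (n j) + 2 * (L j - (\<Sum>i\<in>J. real (n i) * G i j)) / G j j"
    and n: "n \<in> P"
  shows "(\<Sum>i\<in>J. \<Sum>j\<in>J. real (n i) * real (n j) * G i j) \<le> 2 * (\<Sum>j\<in>J. real (n j) * L j)"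
  using n
proof (induction "\<Sum>j\<in>J. n j" arbitrary: n rule: less_induct)
  case less
  define Q where "Q = (\<lambda>x. (\<Sum>i\<in>J. \<Sum>k\<in>J. x i * x k * G i k) - 2 * (\<Sum>i\<in>J. x i * L i))"
  have "Q (\<lambda>i. real (n i)) \<le> 0"
  proof (cases "\<exists>j\<in>J. L j - (\<Sum>i\<in>J. real (n i) * G i j) < 0")
    case True
    then obtain j where j: "j \<in> J" "L j - (\<Sum>i\<in>J. real (n i) * G i j) < 0" by blast
    obtain m where m: "n(j := m) \<in> P"
      "real m = real (n j) + 2 * (L j - (\<Sum>i\<in>J. real (n i) * G i j)) / G j j"
      using refl[OF less.prems j] by blast
    define d where "d = 2 * (L j - (\<Sum>i\<in>J. real (n i) * G i j)) / G j j"
    have "d < 0" using j pos(1)[OF j(1)] by (simp add: d_def divide_neg_pos)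
    then have mn: "m < n j" using m(2) by (simp add: d_def)
    have "(\<Sum>i\<in>J. (n(j := m)) i) < (\<Sum>i\<in>J. n i)"
      using J j(1) mn by (intro sum_strict_mono_ex1) auto
    from less.hyps[OF this m(1)] have "Q (\<lambda>i. real ((n(j := m)) i)) \<le> 0"
      by (simp add: Q_def)
    also have "(\<lambda>i. real ((n(j := m)) i)) = (\<lambda>i. real (n i))(j := real (n j) + d)"
      using m(2) by (auto simp: d_def)
    also have "Q \<dots> = Q (\<lambda>i. real (n i)) +
        d * (d * G j j - 2 * (L j - (\<Sum>i\<in>J. real (n i) * G i j)))"
      unfolding Q_def by (rule quadratic_form_shift[OF J sym j(1)])
    also have "d * G j j = 2 * (L j - (\<Sum>i\<in>J. real (n i) * G i j))"
      using pos(1)[OF j(1)] by (simp add: d_def)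
    finally show ?thesis by simp
  next
    case False
    have "(\<Sum>i\<in>J. \<Sum>k\<in>J. real (n i) * real (n k) * G i k) =
        (\<Sum>k\<in>J. real (n k) * (\<Sum>i\<in>J. real (n i) * G i k))"
      by (subst sum.swap) (simp add: sum_distrib_left algebra_simps)
    also have "\<dots> \<le> (\<Sum>k\<in>J. real (n k) * (2 * L k))"
    proof (intro sum_mono mult_left_mono)
      fix k assume "k \<in> J"
      then show "(\<Sum>i\<in>J. real (n i) * G i k) \<le> 2 * L k"
        using False pos(2)[of k] by fastforce
    qed simp
    also have "\<dots> = 2 * (\<Sum>k\<in>J. real (n k) * L k)"
      by (simp add: sum_distrib_left algebra_simps)
    finally show ?thesis by (simp add: Q_def)
  qed
  then show ?case by (simp add: Q_def)
qed

section \<open>The root grading of a simple Lie algebra\<close>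

locale chevalley_setting = lie_algebra s br
  for s :: "complex \<Rightarrow> 'g::ab_group_add \<Rightarrow> 'g" and br :: "'g \<Rightarrow> 'g \<Rightarrow> 'g" +
  fixes \<hh> :: "'g set" and \<alpha> :: "'i::finite \<Rightarrow> 'g \<Rightarrow> complex" and E F H :: "'i \<Rightarrow> 'g"
  assumes simple: "fd_simple_lie_algebra s br"
    and cartan: "cartan_subalgebra s br \<hh>"
    and simple_roots: "simple_roots s br \<hh> \<alpha>"
    and chevalley: "chevalley_generators s br \<hh> \<alpha> E F H"
begin

sublocale complex_vector_space s ..

lemmas br_simps = linD[OF linear_left] linD[OF linear_right]

lemma span_UNIV_mono: "span X = UNIV \<Longrightarrow> X \<subseteq> Y \<Longrightarrow> span Y = UNIV"
  using span_mono[of X Y] by auto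

lemma br_anti: "br x y = - br y x"
proof -
  have "br x y + br y x = br (x + y) (x + y)"
    by (simp only: linD(1)[OF linear_left] linD(1)[OF linear_right]) (simp add: br_self add.commute)
  then have "br x y + br y x = 0" by (simp only: br_self)
  then show ?thesis by (rule eq_neg_iff_add_eq_0[THEN iffD2])
qed

lemma br_derivation: "br x (br y z) = br (br x y) z + br y (br x z)"
proof -
  have "br y (br z x) = - br y (br x z)" "br z (br x y) = - br (br x y) z"
    using br_anti[of z x] br_anti[of z "br x y"] by (simp_all add: br_simps)
  then show ?thesis using jacobi[of x y z] by (simp add: algebra_simps)
qed

lemma subspace_hh: "subspace \<hh>"
  and br_hh: "x \<in> \<hh> \<Longrightarrow> y \<in> \<hh> \<Longrightarrow> br x y = 0"
  and hh_maximal: "abelian_subalgebra s br A \<Longrightarrow> \<hh> \<subseteq> A \<Longrightarrow> A = \<hh>"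
  and hh_diagonalizable: "h \<in> \<hh> \<Longrightarrow> diagonalizable s (br h)"
  using cartan by (auto simp: cartan_subalgebra_def abelian_subalgebra_def)

lemma finite_dimensional: obtains B0 where "finite B0" "span B0 = UNIV"
  using simple unfolding fd_simple_lie_algebra_def by blast

lemma ideal_cases: "lie_ideal s br I \<Longrightarrow> I = {0} \<or> I = UNIV"
  using simple unfolding fd_simple_lie_algebra_def by blast

lemma center_trivial: "(\<And>y. br x y = 0) \<Longrightarrow> x = 0"
proof -
  assume x: "\<And>y. br x y = 0"
  define Z where "Z = {x. \<forall>y. br x y = 0}"
  have "lie_ideal s br Z"
    unfolding lie_ideal_def
  proof (intro conjI allI ballI)
    show "subspace Z" by (auto simp: subspace_def Z_def br_simps)
    fix x y assume "y \<in> Z"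
    then have "br x y = 0" using br_anti[of x y] by (simp add: Z_def)
    then show "br x y \<in> Z" by (simp add: Z_def br_simps)
  qed
  moreover have "Z \<noteq> UNIV"
    using simple unfolding fd_simple_lie_algebra_def Z_def by blast
  ultimately show "x = 0" using ideal_cases[of Z] x by (auto simp: Z_def)
qed

text \<open>The root lattice is identified with integer vectors \<open>n\<close> indexed by the simple roots, and \<open>\<gg>\<close> is graded
  by it. The degree \<open>0\<close> part is \<open>\<hh>\<close>; the other nonzero parts are the root spaces.\<close>

definition rf :: "('i \<Rightarrow> int) \<Rightarrow> 'g \<Rightarrow> complex" where
  "rf n h = (\<Sum>i\<in>UNIV. of_int (n i) * \<alpha> i h)"

definition grade :: "('i \<Rightarrow> int) \<Rightarrow> 'g set" where
  "grade n = root_space s br \<hh> (rf n)"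

definition unit :: "'i \<Rightarrow> 'i \<Rightarrow> int" where
  "unit i = (\<lambda>j. if j = i then 1 else 0)"

lemma grade_joint_eigenspace: "grade n = joint_eigenspace s br \<hh> (rf n)"
  by (simp add: grade_def root_space_def joint_eigenspace_def)

lemma gradeD: "x \<in> grade n \<Longrightarrow> h \<in> \<hh> \<Longrightarrow> br h x = s (rf n h) x"
  by (simp add: grade_def root_space_def)

lemma subspace_grade: "subspace (grade n)"
  unfolding grade_joint_eigenspace by (rule subspace_joint_eigenspace) (rule linear_right)

lemma rf_simps:
  "rf (\<lambda>i. n i + m i) h = rf n h + rf m h" "rf (\<lambda>i. - n i) h = - rf n h"
  "rf (\<lambda>i. n i - m i) h = rf n h - rf m h"
  "rf (\<lambda>i. k * n i) h = of_int k * rf n h"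
  "rf (\<lambda>i. 0) h = 0" "rf (unit i) h = \<alpha> i h"
proof -
  have "rf (unit i) h = (\<Sum>j\<in>UNIV. if j = i then \<alpha> j h else 0)"
    unfolding rf_def unit_def by (rule sum.cong) auto
  then show "rf (unit i) h = \<alpha> i h" by simp
qed (auto simp: rf_def sum.distrib sum_negf sum_subtractf sum_distrib_left algebra_simps)

lemma br_grade: "x \<in> grade n \<Longrightarrow> y \<in> grade m \<Longrightarrow> br x y \<in> grade (\<lambda>i. n i + m i)"
  by (auto simp: grade_def root_space_def br_derivation[of _ x y] br_simps rf_simps algebra_simps)

lemma \<alpha>_dual: "\<alpha> i \<in> dual_space s \<hh>"
  using simple_roots by (auto simp: simple_roots_def roots_def)

lemma \<alpha>_linear:
  "x \<in> \<hh> \<Longrightarrow> y \<in> \<hh> \<Longrightarrow> \<alpha> i (x + y) = \<alpha> i x + \<alpha> i y" "x \<in> \<hh> \<Longrightarrow> \<alpha> i (s c x) = c * \<alpha> i x"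
  "x \<notin> \<hh> \<Longrightarrow> \<alpha> i x = 0"
  using \<alpha>_dual by (auto simp: dual_space_def)

lemma rf_linear:
  "x \<in> \<hh> \<Longrightarrow> y \<in> \<hh> \<Longrightarrow> rf n (x + y) = rf n x + rf n y" "x \<in> \<hh> \<Longrightarrow> rf n (s c x) = c * rf n x"
  "x \<notin> \<hh> \<Longrightarrow> rf n x = 0"
  by (auto simp: rf_def \<alpha>_linear algebra_simps sum.distrib sum_distrib_left)

lemma rf_dual: "rf n \<in> dual_space s \<hh>"
  by (auto simp: dual_space_def rf_linear)

lemma rf_inject: "(\<And>h. h \<in> \<hh> \<Longrightarrow> rf n h = rf m h) \<Longrightarrow> n = m"
proof -
  assume "\<And>h. h \<in> \<hh> \<Longrightarrow> rf n h = rf m h"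
  then have zero: "\<forall>h\<in>\<hh>. (\<Sum>i\<in>UNIV. of_int (n i - m i) * \<alpha> i h) = 0"
    by (auto simp: rf_def algebra_simps sum_subtractf)
  have "(\<forall>h\<in>\<hh>. (\<Sum>i\<in>UNIV. c i * \<alpha> i h) = 0) \<Longrightarrow> \<forall>i. c i = 0" for c
    using simple_roots by (simp add: simple_roots_def)
  from this[OF zero] have "\<forall>i. of_int (n i - m i) = (0::complex)" .
  then show "n = m" by (simp add: fun_eq_iff)
qed

lemma rf_separated: "n \<noteq> m \<Longrightarrow> \<exists>h\<in>\<hh>. rf n h \<noteq> rf m h"
  using rf_inject[of n m] by blast

text \<open>The span of \<open>\<hh>\<close> and one element commuting with \<open>\<hh>\<close> is abelian, and \<open>\<hh>\<close> is maximal abelian.\<close>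

lemma grade_zero: "grade (\<lambda>i. 0) = \<hh>"
proof
  show "\<hh> \<subseteq> grade (\<lambda>i. 0)" by (auto simp: grade_def root_space_def rf_simps br_hh)
  show "grade (\<lambda>i. 0) \<subseteq> \<hh>"
  proof
    fix x assume x: "x \<in> grade (\<lambda>i. 0)"
    have hx: "br h x = 0" if "h \<in> \<hh>" for h using gradeD[OF x that] by (simp add: rf_simps)
    define A where "A = {h + s c x | h c. h \<in> \<hh>}"
    have "abelian_subalgebra s br A"
      unfolding abelian_subalgebra_def
    proof
      show "subspace A"
        unfolding subspace_def
      proof (intro conjI ballI allI)
        show "0 \<in> A" using subspace_0[OF subspace_hh] by (force simp: A_def)
        fix y z assume "y \<in> A" "z \<in> A"
        then obtain h c h' c' where "y = h + s c x" "z = h' + s c' x" "h \<in> \<hh>" "h' \<in> \<hh>"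
          by (auto simp: A_def)
        then show "y + z \<in> A"
          unfolding A_def using subspace_add[OF subspace_hh]
          by (auto intro!: exI[of _ "h + h'"] exI[of _ "c + c'"] simp: algebra_simps)
      next
        fix c y assume "y \<in> A"
        then obtain h d where "y = h + s d x" "h \<in> \<hh>" by (auto simp: A_def)
        then show "s c y \<in> A"
          unfolding A_def using subspace_scale[OF subspace_hh]
          by (auto intro!: exI[of _ "s c h"] exI[of _ "c * d"] simp: algebra_simps)
      qed
      have xh: "br x h = 0" if "h \<in> \<hh>" for h using hx[OF that] br_anti[of x h] by simp
      show "\<forall>y\<in>A. \<forall>z\<in>A. br y z = 0"
        by (auto simp: A_def br_simps hx xh br_hh br_self)
    qed
    moreover have "\<hh> \<subseteq> A" by (force simp: A_def)
    ultimately have "A = \<hh>" by (rule hh_maximal)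
    moreover have "0 + s 1 x \<in> A" unfolding A_def using subspace_0[OF subspace_hh] by blast
    ultimately show "x \<in> \<hh>" by simp
  qed
qed

text \<open>Every joint eigenvector of \<open>\<hh>\<close> has as its weight either \<open>0\<close> or a root, and roots are integral
  combinations of the simple roots.\<close>

lemma joint_eigenvector_in_grade:
  assumes ev: "\<And>h. h \<in> \<hh> \<Longrightarrow> \<exists>c. br h x = s c x"
  shows "\<exists>n. x \<in> grade n"
proof (cases "x = 0")
  case True
  then show ?thesis using subspace_0[OF subspace_grade] by blast
next
  case False
  define \<beta> where "\<beta> h = (if h \<in> \<hh> then (SOME c. br h x = s c x) else 0)" for h
  have \<beta>: "br h x = s (\<beta> h) x" if "h \<in> \<hh>" for h
    using someI_ex[OF ev[OF that]] that by (simp add: \<beta>_def)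
  have "\<beta> \<in> dual_space s \<hh>"
    unfolding dual_space_def
  proof (safe)
    fix h h' assume hs: "h \<in> \<hh>" "h' \<in> \<hh>"
    then have "h + h' \<in> \<hh>" using subspace_add[OF subspace_hh] by blast
    from \<beta>[OF this] hs have "s (\<beta> (h + h')) x = s (\<beta> h + \<beta> h') x"
      by (simp add: br_simps \<beta> scale_left_distrib)
    then show "\<beta> (h + h') = \<beta> h + \<beta> h'" using False by simp
  next
    fix c h assume hs: "h \<in> \<hh>"
    then have "s c h \<in> \<hh>" using subspace_scale[OF subspace_hh] by blast
    then have "s (\<beta> (s c h)) x = br (s c h) x" by (rule \<beta>[symmetric])
    also have "\<dots> = s (c * \<beta> h) x" using hs by (simp add: br_simps \<beta>)
    finally show "\<beta> (s c h) = c * \<beta> h" using False by (metis scale_cancel_right)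
  qed (simp add: \<beta>_def)
  moreover have x: "x \<in> root_space s br \<hh> \<beta>" using \<beta> by (auto simp: root_space_def)
  ultimately have "\<beta> = (\<lambda>_. 0) \<or> \<beta> \<in> roots s br \<hh>"
    using False by (auto simp: roots_def)
  then consider "\<beta> = (\<lambda>_. 0)" | "\<beta> \<in> nonneg_comb \<alpha>" | "(\<lambda>h. - \<beta> h) \<in> nonneg_comb \<alpha>"
    using simple_roots by (auto simp: simple_roots_def)
  then have "\<exists>n. \<beta> = rf n"
  proof cases
    case 1
    then show ?thesis by (intro exI[of _ "\<lambda>i. 0"]) (auto simp: rf_simps)
  next
    case 2
    then obtain n :: "'i \<Rightarrow> nat" where n: "\<beta> = (\<lambda>h. \<Sum>i\<in>UNIV. of_nat (n i) * \<alpha> i h)"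
      by (auto simp: nonneg_comb_def)
    show ?thesis by (rule exI[of _ "\<lambda>i. int (n i)"]) (simp add: n rf_def fun_eq_iff)
  next
    case 3
    then obtain n :: "'i \<Rightarrow> nat" where n: "(\<lambda>h. - \<beta> h) = (\<lambda>h. \<Sum>i\<in>UNIV. of_nat (n i) * \<alpha> i h)"
      by (auto simp: nonneg_comb_def)
    then have "\<beta> h = - (\<Sum>i\<in>UNIV. of_nat (n i) * \<alpha> i h)" for h
      by (metis add.inverse_inverse)
    then show ?thesis
      by (intro exI[of _ "\<lambda>i. - int (n i)"]) (simp add: rf_def fun_eq_iff sum_negf)
  qed
  then show ?thesis using x by (auto simp: grade_def)
qed

lemma root_decomposition: "span (\<Union>n. grade n) = UNIV"
proof -
  obtain B0 where B0: "finite B0" "span B0 = UNIV" by (rule finite_dimensional)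
  obtain Bh where Bh: "Bh \<subseteq> \<hh>" "independent Bh" "\<hh> \<subseteq> span Bh"
    using maximal_independent_subset[of \<hh>] by auto
  have fin: "finite Bh" using independent_span_bound[OF B0(1) Bh(2)] B0 by auto
  have comm: "br a (br b w) = br b (br a w)" if "a \<in> Bh" "b \<in> Bh" for a b w
  proof -
    have "br a b = 0" using that Bh(1) by (intro br_hh) auto
    then show ?thesis using br_derivation[of a b w] by (simp add: br_simps)
  qed
  have "span {w. \<forall>a\<in>Bh. \<exists>c. br a w = s c w} = UNIV"
    by (rule simultaneously_diagonalizable[OF fin linear_right comm])
      (use hh_diagonalizable Bh(1) in auto)
  moreover have "{w. \<forall>a\<in>Bh. \<exists>c. br a w = s c w} \<subseteq> (\<Union>n. grade n)"
  proof
    fix w assume "w \<in> {w. \<forall>a\<in>Bh. \<exists>c. br a w = s c w}"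
    then have w: "\<forall>a\<in>Bh. \<exists>c. br a w = s c w" by simp
    have "\<exists>c. br h w = s c w" if "h \<in> span Bh" for h
      using that
    proof (induction rule: span_induct_alt)
      case base
      then show ?case by (intro exI[of _ 0]) (simp add: br_simps)
    next
      case (step c x y)
      then obtain d d' where "br x w = s d w" "br y w = s d' w" using w by blast
      then show ?case by (intro exI[of _ "c * d + d'"]) (simp add: br_simps algebra_simps)
    qed
    then show "w \<in> (\<Union>n. grade n)" using joint_eigenvector_in_grade[of w] Bh(3) by blast
  qed
  ultimately show ?thesis by (rule span_UNIV_mono)
qed

lemma homogeneous_basis:
  obtains B where "finite B" "B \<subseteq> (\<Union>n. grade n)" "independent B" "span B = UNIV"
proof -
  obtain B0 where B0: "finite B0" "span B0 = UNIV" by (rule finite_dimensional)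
  obtain B where "B \<subseteq> (\<Union>n. grade n)" "independent B" "span B = UNIV"
    using exists_basis_within[OF root_decomposition] .
  moreover from this have "finite B" using independent_span_bound[OF B0(1)] B0 by auto
  ultimately show ?thesis using that by blast
qed

lemma finite_support: "finite {n. grade n \<noteq> {0}}"
proof -
  obtain B where B: "finite B" "B \<subseteq> (\<Union>n. grade n)" "span B = UNIV"
    using homogeneous_basis by metis
  then obtain \<nu> where \<nu>: "\<And>b. b \<in> B \<Longrightarrow> b \<in> grade (\<nu> b)" by (metis UN_E subsetD)
  have sp: "span (\<Union>\<tau>\<in>rf ` \<nu> ` B. joint_eigenspace s br \<hh> \<tau>) = UNIV"
  proof -
    have "B \<subseteq> (\<Union>\<tau>\<in>rf ` \<nu> ` B. joint_eigenspace s br \<hh> \<tau>)"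
      using \<nu> by (auto simp: grade_joint_eigenspace)
    then show ?thesis by (rule span_UNIV_mono[OF B(3)])
  qed
  have "grade n = {0}" if n: "n \<notin> \<nu> ` B" for n
  proof -
    have "x = 0" if x: "x \<in> grade n" for x
    proof (rule joint_eigenvector_outside[where A = br and J = \<hh> and C = "rf ` \<nu> ` B" and \<sigma> = "rf n"])
      show "x \<in> joint_eigenspace s br \<hh> (rf n)" using x by (simp add: grade_joint_eigenspace)
      show "\<exists>a\<in>\<hh>. \<tau> a \<noteq> rf n a" if "\<tau> \<in> rf ` \<nu> ` B" for \<tau>
        using that n rf_separated by fastforce
      show "\<exists>a\<in>\<hh>. \<tau> a \<noteq> \<tau>' a" if "\<tau> \<in> rf ` \<nu> ` B" "\<tau>' \<in> rf ` \<nu> ` B" "\<tau> \<noteq> \<tau>'" for \<tau> \<tau>'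
      proof -
        from that(1,2) obtain m m' where m: "\<tau> = rf m" "\<tau>' = rf m'" by blast
        with that(3) have "m \<noteq> m'" by auto
        then show ?thesis using m rf_separated by simp
      qed
      show "x \<in> span (\<Union>\<tau>\<in>rf ` \<nu> ` B. joint_eigenspace s br \<hh> \<tau>)" by (simp only: sp UNIV_I)
    qed (rule linear_right)
    then show ?thesis using subspace_0[OF subspace_grade] by blast
  qed
  then have "{n. grade n \<noteq> {0}} \<subseteq> \<nu> ` B" by blast
  then show ?thesis using B(1) finite_subset by blast
qed

lemma grade_components: obtains T y where "finite T" "\<And>n. y n \<in> grade n" "x = (\<Sum>n\<in>T. y n)"
proof -
  have "x \<in> span (\<Union>\<tau>\<in>range rf. joint_eigenspace s br \<hh> \<tau>)"
    using root_decomposition by (simp add: grade_joint_eigenspace)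
  then obtain T z where T: "finite T" "T \<subseteq> range rf" "\<And>\<tau>. z \<tau> \<in> joint_eigenspace s br \<hh> \<tau>"
    "x = (\<Sum>\<tau>\<in>T. z \<tau>)"
    using span_joint_eigenspaces_decompose[of \<hh> br, OF linear_right] by blast
  have inj: "inj rf" by (rule injI) (rule rf_inject, simp)
  obtain T' where T': "T = rf ` T'" using T(2) by (metis subset_imageE)
  have "finite T'" using T(1) T' inj by (metis finite_imageD inj_on_subset subset_UNIV)
  moreover have "x = (\<Sum>n\<in>T'. z (rf n))"
    using T(4) T' inj by (simp add: sum.reindex inj_on_subset[OF inj])
  ultimately show ?thesis
    using that[of T' "\<lambda>n. z (rf n)"] T(3) by (auto simp: grade_joint_eigenspace)
qed

lemma roots_cases:
  assumes "\<beta> \<in> roots s br \<hh>"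
  obtains n where "\<beta> = rf n" "n \<noteq> (\<lambda>i. 0)" "grade n \<noteq> {0}"
proof -
  have ne: "\<beta> \<noteq> (\<lambda>_. 0)" "root_space s br \<hh> \<beta> \<noteq> {0}" "\<beta> \<in> dual_space s \<hh>"
    using assms by (auto simp: roots_def)
  have "0 \<in> root_space s br \<hh> \<beta>" by (simp add: root_space_def br_simps)
  then obtain x where x: "x \<in> root_space s br \<hh> \<beta>" "x \<noteq> 0" using ne(2) by blast
  then obtain n where n: "x \<in> grade n" using joint_eigenvector_in_grade[of x] by (auto simp: root_space_def)
  have "\<beta> h = rf n h" for h
  proof (cases "h \<in> \<hh>")
    case True
    then have "s (\<beta> h) x = s (rf n h) x" using x gradeD[OF n] by (simp add: root_space_def)
    then show ?thesis using x by simp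
  next
    case False
    then show ?thesis using ne(3) by (simp add: dual_space_def rf_linear)
  qed
  then have eq: "\<beta> = rf n" by auto
  moreover have "n \<noteq> (\<lambda>i. 0)"
  proof
    assume n: "n = (\<lambda>i. 0)"
    have "\<beta> h = 0" for h unfolding eq n by (rule rf_simps)
    then show False using ne(1) by auto
  qed
  moreover have "grade n \<noteq> {0}" using x n by blast
  ultimately show ?thesis using that by blast
qed

lemma rf_in_roots: "n \<noteq> (\<lambda>i. 0) \<Longrightarrow> grade n \<noteq> {0} \<Longrightarrow> rf n \<in> roots s br \<hh>"
  using rf_inject[of n "\<lambda>i. 0"] rf_dual by (auto simp: roots_def grade_def rf_simps fun_eq_iff)

lemma nonneg_comb_rf: "rf n \<in> nonneg_comb \<alpha> \<Longrightarrow> n i \<ge> 0"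
proof -
  assume "rf n \<in> nonneg_comb \<alpha>"
  then obtain m :: "'i \<Rightarrow> nat" where "rf n = (\<lambda>h. \<Sum>i\<in>UNIV. of_nat (m i) * \<alpha> i h)"
    by (auto simp: nonneg_comb_def)
  then have "rf n = rf (\<lambda>i. int (m i))" by (simp add: rf_def fun_eq_iff)
  then have "n = (\<lambda>i. int (m i))" using rf_inject by metis
  then show ?thesis by simp
qed

lemma grade_sign: "grade n \<noteq> {0} \<Longrightarrow> (\<forall>i. n i \<ge> 0) \<or> (\<forall>i. n i \<le> 0)"
proof -
  assume grade: "grade n \<noteq> {0}"
  show ?thesis
  proof (cases "n = (\<lambda>i. 0)")
    case False
    then have "rf n \<in> nonneg_comb \<alpha> \<or> (\<lambda>h. - rf n h) \<in> nonneg_comb \<alpha>"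
      using rf_in_roots[OF False grade] simple_roots by (auto simp: simple_roots_def)
    moreover have "(\<lambda>h. - rf n h) = rf (\<lambda>i. - n i)" by (simp add: rf_simps fun_eq_iff)
    ultimately have "(\<forall>i. 0 \<le> n i) \<or> (\<forall>i. 0 \<le> - n i)"
      using nonneg_comb_rf[of n] nonneg_comb_rf[of "\<lambda>i. - n i"] by metis
    then show ?thesis by simp
  qed auto
qed

text \<open>Repeated brackets with \<open>x\<close> run through infinitely many degrees, and only finitely many are occupied.\<close>

lemma ad_nilpotent:
  assumes x: "x \<in> grade n" and n: "n \<noteq> (\<lambda>i. 0)"
  shows "\<exists>N. (br x ^^ N) y = 0"
proof -
  have lin: "Vector_Spaces.linear s s (br x ^^ N)" for N by (rule linear_funpow[OF linear_right])
  define Z where "Z = {y. \<exists>N. (br x ^^ N) y = 0}"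
  have mono: "(br x ^^ (N + M)) y = 0" if "(br x ^^ N) y = 0" for N M y
    using that by (subst add.commute) (simp add: funpow_add linD[OF lin])
  have "subspace Z"
    unfolding subspace_def
  proof (intro conjI ballI allI)
    show "0 \<in> Z" by (auto simp: Z_def intro: exI[of _ 0])
    fix y z assume "y \<in> Z" "z \<in> Z"
    then obtain N M where "(br x ^^ N) y = 0" "(br x ^^ M) z = 0" by (auto simp: Z_def)
    then have "(br x ^^ (N + M)) (y + z) = 0"
      using mono[of N y M] mono[of M z N] by (simp add: linD[OF lin] add.commute)
    then show "y + z \<in> Z" by (auto simp: Z_def)
  next
    fix c y assume "y \<in> Z"
    then obtain N where "(br x ^^ N) y = 0" by (auto simp: Z_def)
    then have "(br x ^^ N) (s c y) = 0" by (simp add: linD[OF lin])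
    then show "s c y \<in> Z" by (auto simp: Z_def)
  qed
  moreover have "grade m \<subseteq> Z" for m
  proof
    fix y assume y: "y \<in> grade m"
    obtain i where i: "n i \<noteq> 0" using n by auto
    have pow: "(br x ^^ N) y \<in> grade (\<lambda>j. m j + int N * n j)" for N
    proof (induction N)
      case (Suc N)
      show ?case using br_grade[OF x Suc] by (simp add: algebra_simps)
    qed (simp add: y)
    have "inj (\<lambda>N j. m j + int N * n j)"
    proof (rule injI)
      fix N M assume "(\<lambda>j. m j + int N * n j) = (\<lambda>j. m j + int M * n j)"
      then have "m i + int N * n i = m i + int M * n i" by (rule fun_cong)
      then show "N = M" using i by simp
    qed
    then have "infinite (range (\<lambda>N j. m j + int N * n j))" by (simp add: finite_image_iff)
    then have "\<not> range (\<lambda>N j. m j + int N * n j) \<subseteq> {n. grade n \<noteq> {0}}"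
      using finite_support finite_subset by blast
    then obtain N where "grade (\<lambda>j. m j + int N * n j) = {0}" by blast
    then have "(br x ^^ N) y = 0" using pow[of N] by simp
    then show "y \<in> Z" by (auto simp: Z_def)
  qed
  ultimately have "span (\<Union>n. grade n) \<subseteq> Z" by (intro span_minimal) auto
  then show ?thesis unfolding root_decomposition by (auto simp: Z_def)
qed

lemma ad_sl2:
  assumes "br e f = h" "br h e = s 2 e" "br h f = s (- 2) f"
  shows "sl2_action s (br e) (br f) (br h)"
proof (intro sl2_action.intro sl2_action_axioms.intro linear_right)
  show "complex_vector_space s" ..
  show "br e (br f w) - br f (br e w) = br h w" for w
    using br_derivation[of e f w] assms by simp
  show "br h (br e w) - br e (br h w) = s 2 (br e w)" for w
    using br_derivation[of h e w] assms by (simp add: br_simps)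
  show "br h (br f w) - br f (br h w) = s (- 2) (br f w)" for w
    using br_derivation[of h f w] assms by (simp add: br_simps)
qed

lemma H_in_hh: "H i \<in> \<hh>" and EF: "br (E i) (F i) = H i" and \<alpha>_H: "\<alpha> i (H i) = 2"
  and E_grade: "E i \<in> grade (unit i)" and F_grade: "F i \<in> grade (\<lambda>j. - unit i j)"
proof -
  have c: "E i \<in> root_space s br \<hh> (\<alpha> i)" "F i \<in> root_space s br \<hh> (\<lambda>h. - \<alpha> i h)"
    "br (E i) (F i) = H i" "\<alpha> i (H i) = 2"
    using chevalley by (auto simp: chevalley_generators_def is_coroot_def)
  then show E: "E i \<in> grade (unit i)" and F: "F i \<in> grade (\<lambda>j. - unit i j)"
    by (simp_all add: grade_def root_space_def rf_simps)
  show "br (E i) (F i) = H i" "\<alpha> i (H i) = 2" using c by auto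
  show "H i \<in> \<hh>" using br_grade[OF E F] c(3) by (simp add: grade_zero)
qed

lemma unit_ne_0: "unit i \<noteq> (\<lambda>j. 0)"
  by (simp add: unit_def fun_eq_iff)

lemma H_ne_0: "H i \<noteq> 0"
  using \<alpha>_H[of i] \<alpha>_linear(2)[of "H i" i 0] H_in_hh[of i] by auto

lemma sl2_simple: "sl2_action s (br (E i)) (br (F i)) (br (H i))"
  by (rule ad_sl2)
    (use EF gradeD[OF E_grade[of i] H_in_hh[of i]] gradeD[OF F_grade[of i] H_in_hh[of i]] \<alpha>_H in \<open>auto simp: rf_simps\<close>)

lemma E_ne_0: "E i \<noteq> 0" and F_ne_0: "F i \<noteq> 0"
proof -
  have "br 0 (F i) = 0" "br (E i) 0 = 0" by (simp_all add: br_simps)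
  then show "E i \<noteq> 0" "F i \<noteq> 0" using EF[of i] H_ne_0[of i] by metis+
qed

lemma grade_unit: "grade (unit i) \<noteq> {0}" and grade_minus_unit: "grade (\<lambda>j. - unit i j) \<noteq> {0}"
  using E_grade[of i] E_ne_0[of i] F_grade[of i] F_ne_0[of i] by blast+

lemma minus_unit_ne_0: "(\<lambda>j. - unit i j) \<noteq> (\<lambda>j. 0)"
  by (simp add: unit_def fun_eq_iff)

lemma ad_E_nilpotent: "\<exists>N. (br (E i) ^^ N) y = 0"
  by (rule ad_nilpotent[OF E_grade unit_ne_0])

lemma ad_F_nilpotent: "\<exists>N. (br (F i) ^^ N) y = 0"
  by (rule ad_nilpotent[OF F_grade minus_unit_ne_0])

lemma rf_H_Ints: "grade n \<noteq> {0} \<Longrightarrow> rf n (H i) \<in> \<int>"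
proof -
  assume "grade n \<noteq> {0}"
  then obtain x where x: "x \<in> grade n" "x \<noteq> 0" using subspace_0[OF subspace_grade] by blast
  interpret sl2: sl2_action s "br (E i)" "br (F i)" "br (H i)" by (rule sl2_simple)
  show ?thesis
    by (rule sl2.eigenvalue_Ints[OF gradeD[OF x(1) H_in_hh] x(2) ad_E_nilpotent ad_F_nilpotent])
qed

text \<open>The Chevalley involution on the level of the data: it exchanges positive and negative roots, so that
  facts about positive roots transfer.\<close>

lemma opposite: "chevalley_setting s br \<hh> (\<lambda>i h. - \<alpha> i h) F E (\<lambda>i. - H i)"
proof (unfold_locales)
  have n1: "(\<lambda>h. - \<beta> h) \<in> nonneg_comb (\<lambda>i h. - \<alpha> i h)" if \<beta>: "\<beta> \<in> nonneg_comb \<alpha>" for \<beta>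
    using \<beta> unfolding nonneg_comb_def by (auto simp: sum_negf)
  have n2: "\<beta> \<in> nonneg_comb (\<lambda>i h. - \<alpha> i h)" if \<beta>: "(\<lambda>h. - \<beta> h) \<in> nonneg_comb \<alpha>" for \<beta>
    using n1[OF \<beta>] by simp
  have neg: "(\<lambda>h. - \<alpha> i h) \<in> roots s br \<hh>" for i
  proof -
    have "rf (\<lambda>j. - unit i j) \<in> roots s br \<hh>"
      by (rule rf_in_roots[OF minus_unit_ne_0 grade_minus_unit])
    moreover have "rf (\<lambda>j. - unit i j) = (\<lambda>h. - \<alpha> i h)" by (simp add: rf_simps fun_eq_iff)
    ultimately show ?thesis by simp
  qed
  show "simple_roots s br \<hh> (\<lambda>i h. - \<alpha> i h)"
    unfolding simple_roots_def
  proof (intro conjI allI ballI impI)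
    fix c i assume "\<forall>h\<in>\<hh>. (\<Sum>i\<in>UNIV. c i * - \<alpha> i h) = 0"
    then have "\<forall>h\<in>\<hh>. (\<Sum>i\<in>UNIV. c i * \<alpha> i h) = 0" by (simp add: sum_negf)
    then show "c i = 0" using simple_roots by (simp add: simple_roots_def)
  qed (use neg n1 n2 simple_roots in \<open>auto simp: simple_roots_def\<close>)
  have coroot: "is_coroot s br \<hh> (\<lambda>h. - \<alpha> i h) (- H i)" for i
  proof -
    have F: "F i \<in> root_space s br \<hh> (\<lambda>h. - \<alpha> i h)" and E: "E i \<in> root_space s br \<hh> (\<alpha> i)"
      using chevalley by (auto simp: chevalley_generators_def)
    have "br (F i) (E i) \<in> span {br e f |e f. e \<in> root_space s br \<hh> (\<lambda>h. - \<alpha> i h) \<and>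
        f \<in> root_space s br \<hh> (\<lambda>h. - (- \<alpha> i h))}"
      by (rule span_base) (use E F in auto)
    moreover have "- H i = s (- 1) (H i)" by (simp add: scale_minus_left)
    then have "\<alpha> i (- H i) = - 2" using \<alpha>_linear(2)[OF H_in_hh, of i "- 1" i] \<alpha>_H by simp
    ultimately show ?thesis
      using br_anti[of "F i" "E i"] EF by (simp add: is_coroot_def)
  qed
  show "chevalley_generators s br \<hh> (\<lambda>i h. - \<alpha> i h) F E (\<lambda>i. - H i)"
    unfolding chevalley_generators_def
    using chevalley coroot br_anti[of "F _" "E _"] by (auto simp: chevalley_generators_def)
qed (use simple cartan in auto)

end

section \<open>The Killing form and the root lengths\<close>

context chevalley_setting
begin

abbreviation K :: "'g \<Rightarrow> 'g \<Rightarrow> complex" where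
  "K \<equiv> killing_form s br"

lemma linear_br_br: "Vector_Spaces.linear s s (\<lambda>z. br x (br y z))"
  by (rule linearI) (simp_all add: br_simps)

lemma K_sym: "K x y = K y x"
proof -
  obtain B0 where B0: "finite B0" "span B0 = UNIV" by (rule finite_dimensional)
  show ?thesis
    unfolding killing_form_def by (rule trace_compose_commute[OF B0 linear_right linear_right])
qed

lemma K_left: "K (x + y) z = K x z + K y z" "K (s c x) z = c * K x z"
proof -
  obtain B0 where B0: "finite B0" "span B0 = UNIV" by (rule finite_dimensional)
  show "K (x + y) z = K x z + K y z" "K (s c x) z = c * K x z"
    using trace_linear[OF B0 linear_br_br[of x z] linear_br_br[of y z]]
      trace_linear(2)[OF B0 linear_br_br[of x z] linear_br_br[of x z], of c]
    by (simp_all add: killing_form_def br_simps)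
qed

lemma K_right: "K z (x + y) = K z x + K z y" "K z (s c x) = c * K z x"
  using K_left(1)[of x y z] K_left(2)[of c x z] K_sym by metis+

lemma K_sum_left: "K (\<Sum>j\<in>A. f j) z = (\<Sum>j\<in>A. K (f j) z)"
proof (induction A rule: infinite_finite_induct)
  case (insert x A)
  then show ?case by (simp add: K_left)
qed (use K_left(2)[of 0 0 z] in simp_all)

lemma K_minus: "K (- x) z = - K x z" "K z (- x) = - K z x"
  using K_left(2)[of "- 1" x z] K_right(2)[of z "- 1" x] by (simp_all add: scale_minus_left)

lemma K_diff: "K (x - y) z = K x z - K y z"
  using K_left(1)[of x "- y" z] by (simp add: K_minus)

lemma K_invariant: "K (br x y) z = K x (br y z)"
proof -
  obtain B0 where B0: "finite B0" "span B0 = UNIV" by (rule finite_dimensional)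
  have lin3: "Vector_Spaces.linear s s (\<lambda>w. br a (br b (br c w)))" for a b c
    by (rule linearI) (simp_all add: br_simps)
  have br: "br (br a b) u = br a (br b u) - br b (br a u)" for a b u
    using br_derivation[of a b u] by simp
  have diff: "trace s (\<lambda>w. f w - g w) = trace s f - trace s g"
    if fg: "Vector_Spaces.linear s s f" "Vector_Spaces.linear s s g" for f g
  proof -
    have "Vector_Spaces.linear s s (\<lambda>w. s (- 1) (g w))"
      using fg by (intro linearI) (simp_all add: linD scale_right_distrib scale_left_commute)
    then show ?thesis
      using trace_linear(1)[OF B0 fg(1), of "\<lambda>w. s (- 1) (g w)"]
        trace_linear(2)[OF B0 fg(2) fg(2), of "- 1"] by (simp add: scale_minus_left)
  qed
  have "K (br x y) z = trace s (\<lambda>w. br x (br y (br z w))) - trace s (\<lambda>w. br y (br x (br z w)))"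
    unfolding killing_form_def br[of x y] by (rule diff[OF lin3 lin3])
  also have "trace s (\<lambda>w. br y (br x (br z w))) = trace s (\<lambda>w. br x (br z (br y w)))"
    by (rule trace_compose_commute[OF B0 linear_right linear_br_br])
  also have "trace s (\<lambda>w. br x (br y (br z w))) - \<dots> = K x (br y z)"
    unfolding killing_form_def br[of y z] linD(4)[OF linear_right] by (rule diff[OF lin3 lin3, symmetric])
  finally show ?thesis .
qed

text \<open>In a homogeneous basis \<open>K h h\<close> is the sum of the squares of the eigenvalues of \<open>ad h\<close>.\<close>

lemma K_real_eigenvalues_pos:
  assumes h: "h \<in> \<hh>" "h \<noteq> 0" and real: "\<And>n. grade n \<noteq> {0} \<Longrightarrow> rf n h \<in> \<real>"
  shows "\<exists>r>0. K h h = complex_of_real r"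
proof -
  obtain B0 where B0: "finite B0" "span B0 = UNIV" by (rule finite_dimensional)
  obtain B where B: "finite B" "B \<subseteq> (\<Union>n. grade n)" "independent B" "span B = UNIV"
    by (rule homogeneous_basis)
  have "\<forall>b\<in>B. \<exists>n. b \<in> grade n" using B(2) by auto
  then obtain \<nu> where \<nu>: "\<And>b. b \<in> B \<Longrightarrow> b \<in> grade (\<nu> b)" by metis
  define q where "q b = Re (rf (\<nu> b) h)" for b
  have q: "br h b = s (of_real (q b)) b" if "b \<in> B" for b
  proof -
    have "b \<noteq> 0" using that B(3) dependent_zero by blast
    then have "grade (\<nu> b) \<noteq> {0}" using \<nu>[OF that] by blast
    then have "rf (\<nu> b) h = of_real (q b)" using real by (simp add: q_def)
    then show ?thesis using gradeD[OF \<nu>[OF that] h(1)] by simp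
  qed
  have "K h h = (\<Sum>b\<in>B. complex_of_real (q b * q b))"
    unfolding killing_form_def
    by (rule trace_eigenbasis[OF B0 linear_br_br B(3,4)]) (simp add: q br_simps)
  moreover have "(\<Sum>b\<in>B. q b * q b) > 0"
  proof (rule ccontr)
    assume "\<not> ?thesis"
    then have "(\<Sum>b\<in>B. q b * q b) = 0" by (meson not_less order_antisym sum_nonneg zero_le_square)
    then have "\<forall>b\<in>B. q b = 0" using B(1) by (simp add: sum_nonneg_eq_0_iff)
    then have "B \<subseteq> {x. br h x = 0}" using q by auto
    moreover have "subspace {x. br h x = 0}" by (simp add: subspace_def br_simps)
    ultimately have "span B \<subseteq> {x. br h x = 0}" by (rule span_minimal)
    then have "br h x = 0" for x using B(4) by auto
    then have "h = 0" by (rule center_trivial)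
    then show False using h by simp
  qed
  ultimately show ?thesis by (metis of_real_sum)
qed

lemma hh_separated:
  assumes h: "h \<in> \<hh>" and "\<And>i. \<alpha> i h = 0"
  shows "h = 0"
proof (rule center_trivial)
  fix y
  have "(\<Union>n. grade n) \<subseteq> {x. br h x = 0}" using assms gradeD[OF _ h] by (auto simp: rf_def)
  moreover have "subspace {x. br h x = 0}" by (simp add: subspace_def br_simps)
  ultimately have "span (\<Union>n. grade n) \<subseteq> {x. br h x = 0}" by (rule span_minimal)
  then show "br h y = 0" using root_decomposition by auto
qed

text \<open>By invariance \<open>K (H i) h = ef_form i * \<alpha> i h\<close>, so \<open>H i / ef_form i\<close> represents \<open>\<alpha> i\<close> with respect to the Killing form.
  Accordingly \<open>G\<close> is the Gram matrix of the simple roots for the dual form, \<open>gram\<close> its extension to the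
  root lattice, and \<open>t n\<close> represents the lattice element \<open>n\<close>.\<close>

definition ef_form :: "'i \<Rightarrow> real" where
  "ef_form i = Re (K (E i) (F i))"

definition G :: "'i \<Rightarrow> 'i \<Rightarrow> real" where
  "G i j = Re (\<alpha> i (H j)) / ef_form j"

definition t :: "('i \<Rightarrow> int) \<Rightarrow> 'g" where
  "t n = (\<Sum>j\<in>UNIV. s (of_real (of_int (n j) / ef_form j)) (H j))"

definition gram :: "('i \<Rightarrow> int) \<Rightarrow> ('i \<Rightarrow> int) \<Rightarrow> real" where
  "gram m n = (\<Sum>i\<in>UNIV. \<Sum>j\<in>UNIV. of_int (m i) * of_int (n j) * G i j)"

lemma K_H_EF: "h \<in> \<hh> \<Longrightarrow> K (H i) h = K (E i) (F i) * \<alpha> i h"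
proof -
  assume h: "h \<in> \<hh>"
  have "br (F i) h = s (\<alpha> i h) (F i)"
    using br_anti[of "F i" h] gradeD[OF F_grade h, of i] by (simp add: rf_simps scale_minus_left)
  then show ?thesis
    using K_invariant[of "E i" "F i" h] by (simp add: EF K_right)
qed

lemma K_EF: "K (E i) (F i) = of_real (ef_form i)" and ef_form_pos: "ef_form i > 0"
proof -
  have "rf n (H i) \<in> \<real>" if gn: "grade n \<noteq> {0}" for n
  proof -
    obtain k where "rf n (H i) = of_int k" using rf_H_Ints[OF gn, of i] by (auto elim: Ints_cases)
    then show ?thesis by simp
  qed
  then obtain r where r: "r > 0" "K (H i) (H i) = complex_of_real r"
    using K_real_eigenvalues_pos[OF H_in_hh H_ne_0] by blast
  then have eq: "K (E i) (F i) = of_real (r / 2)"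
    using K_H_EF[OF H_in_hh, of i i] by (simp add: \<alpha>_H field_simps)
  show "K (E i) (F i) = of_real (ef_form i)" "ef_form i > 0" unfolding ef_form_def eq using r by simp_all
qed

lemma K_H: "h \<in> \<hh> \<Longrightarrow> K (H i) h = of_real (ef_form i) * \<alpha> i h"
  by (simp add: K_H_EF K_EF)

lemma \<alpha>_H_real: "\<alpha> i (H j) = of_real (ef_form j * G i j)"
proof -
  have "\<alpha> i (H j) \<in> \<int>" using rf_H_Ints[OF grade_unit, of i j] by (simp add: rf_simps)
  then show ?thesis using ef_form_pos[of j] by (auto elim!: Ints_cases simp: G_def)
qed

lemma G_sym: "G i j = G j i"
proof -
  have "of_real (ef_form i) * \<alpha> i (H j) = of_real (ef_form j) * \<alpha> j (H i)"
    using K_H[OF H_in_hh, of i j] K_H[OF H_in_hh, of j i] K_sym by simp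
  then have "complex_of_real (ef_form i * (ef_form j * G i j)) = of_real (ef_form j * (ef_form i * G j i))"
    by (simp add: \<alpha>_H_real)
  then have "ef_form i * (ef_form j * G i j) = ef_form j * (ef_form i * G j i)" by (simp only: of_real_eq_iff)
  then show ?thesis using ef_form_pos[of i] ef_form_pos[of j] by simp
qed

lemma G_diag: "G j j = 2 / ef_form j"
  using \<alpha>_H[of j] by (simp add: G_def)

lemma rf_H: "rf n (H j) = of_real (ef_form j * (\<Sum>i\<in>UNIV. of_int (n i) * G i j))"
  by (simp add: rf_def \<alpha>_H_real sum_distrib_left mult.left_commute)

lemma t_in_hh: "t n \<in> \<hh>"
  unfolding t_def by (intro subspace_sum[OF subspace_hh] subspace_scale[OF subspace_hh] H_in_hh)

lemma K_t: "h \<in> \<hh> \<Longrightarrow> K (t n) h = rf n h"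
  unfolding t_def rf_def K_sum_left
  by (rule sum.cong) (use ef_form_pos in \<open>simp_all add: K_left K_H less_imp_neq[symmetric]\<close>)

lemma rf_t: "rf m (t n) = of_real (gram m n)"
proof -
  have "rf m (t n) = K (t n) (t m)" using K_t[OF t_in_hh, of m n] K_sym by metis
  also have "\<dots> = (\<Sum>j\<in>UNIV. of_real (of_int (n j) / ef_form j) * rf m (H j))"
    unfolding t_def[of n] K_sum_left K_left using K_t[OF H_in_hh, of m] K_sym by metis
  also have "\<dots> = of_real (\<Sum>j\<in>UNIV. of_int (n j) * (\<Sum>i\<in>UNIV. of_int (m i) * G i j))"
    using ef_form_pos by (simp add: rf_H less_imp_neq[symmetric])
  also have "(\<Sum>j\<in>UNIV. of_int (n j) * (\<Sum>i\<in>UNIV. of_int (m i) * G i j)) = gram m n"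
    unfolding gram_def by (subst sum.swap) (simp add: sum_distrib_left ac_simps)
  finally show ?thesis .
qed

text \<open>The eigenvalues of \<open>t n\<close> on \<open>\<gg>\<close> are the real numbers \<open>gram m n\<close>, and \<open>K (t n) (t n) = gram n n\<close>.\<close>

lemma gram_pos: "n \<noteq> (\<lambda>i. 0) \<Longrightarrow> gram n n > 0"
proof -
  assume n: "n \<noteq> (\<lambda>i. 0)"
  have "t n \<noteq> 0"
  proof
    assume "t n = 0"
    then have "rf n h = 0" if "h \<in> \<hh>" for h
      using K_t[OF that, of n] K_left(2)[of 0 0 h] by simp
    then have "n = (\<lambda>i. 0)" by (intro rf_inject) (simp add: rf_simps)
    then show False using n by simp
  qed
  then obtain r where "r > 0" "K (t n) (t n) = complex_of_real r"
    using K_real_eigenvalues_pos[OF t_in_hh, of n] by (auto simp: rf_t)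
  then show ?thesis by (simp add: K_t t_in_hh rf_t)
qed

lemma K_hh_unique:
  assumes "x \<in> \<hh>" "y \<in> \<hh>" "\<And>h. h \<in> \<hh> \<Longrightarrow> K x h = K y h"
  shows "x = y"
proof -
  have mem: "x - y \<in> \<hh>" using assms subspace_diff subspace_hh by blast
  have "\<alpha> i (x - y) = 0" for i
  proof -
    have "K (x - y) (H i) = 0" using assms(3)[OF H_in_hh, of i] by (simp add: K_diff)
    then have "of_real (ef_form i) * \<alpha> i (x - y) = 0" using K_H[OF mem, of i] K_sym by metis
    then show ?thesis using ef_form_pos[of i] by simp
  qed
  then have "x - y = 0" using hh_separated[OF mem] by blast
  then show ?thesis by simp
qed

lemma K_grade_orthogonal:
  assumes x: "x \<in> grade n" and y: "y \<in> grade m" and K: "K x y \<noteq> 0"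
  shows "m = (\<lambda>i. - n i)"
proof (rule rf_inject)
  fix h assume h: "h \<in> \<hh>"
  have "K (br h x) y = - K x (br h y)"
    using K_invariant[of x h y] br_anti[of h x] by (simp add: K_minus)
  then have "rf n h * K x y = - (rf m h * K x y)" by (simp add: gradeD[OF x h] gradeD[OF y h] K_left K_right)
  then have "(rf n h + rf m h) * K x y = 0" by (simp add: algebra_simps)
  then have "rf n h + rf m h = 0" using K by simp
  then show "rf m h = rf (\<lambda>i. - n i) h" by (simp add: rf_simps eq_neg_iff_add_eq_0 add.commute)
qed

lemma K_nondegenerate: "x \<noteq> 0 \<Longrightarrow> \<exists>y. K x y \<noteq> 0"
proof (rule ccontr)
  assume x: "x \<noteq> 0" "\<nexists>y. K x y \<noteq> 0"
  define R where "R = {x. \<forall>y. K x y = 0}"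
  have K0: "K 0 y = 0" for y using K_left(2)[of 0 0 y] by simp
  have "lie_ideal s br R"
    unfolding lie_ideal_def
  proof (intro conjI allI ballI)
    show "subspace R" by (auto simp: subspace_def R_def K_left K0)
    fix z y assume "y \<in> R"
    then have "K (br y z) w = 0" for w by (simp add: K_invariant R_def)
    then show "br z y \<in> R" using br_anti[of z y] by (simp add: R_def K_minus)
  qed
  then have "R = UNIV" using ideal_cases[of R] x by (auto simp: R_def)
  then have "K (E i) (F i) = 0" for i by (auto simp: R_def)
  then show False using K_EF ef_form_pos by (metis less_irrefl of_real_eq_0_iff)
qed

lemma br_opposite:
  assumes e: "e \<in> grade n" and f: "f \<in> grade (\<lambda>i. - n i)"
  shows "br e f = s (K e f) (t n)"
proof (rule K_hh_unique)
  show "br e f \<in> \<hh>" using br_grade[OF e f] by (simp add: grade_zero)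
  show "s (K e f) (t n) \<in> \<hh>" by (rule subspace_scale[OF subspace_hh t_in_hh])
  fix h assume h: "h \<in> \<hh>"
  have "br f h = s (rf n h) f"
    using br_anti[of f h] gradeD[OF f h] by (simp add: rf_simps scale_minus_left)
  then show "K (br e f) h = K (s (K e f) (t n)) h"
    by (simp add: K_invariant K_right K_left K_t[OF h])
qed

lemma root_triple:
  assumes "grade n \<noteq> {0}"
  obtains e f where "e \<in> grade n" "f \<in> grade (\<lambda>i. - n i)" "K e f = c"
proof -
  obtain e where e: "e \<in> grade n" "e \<noteq> 0" using assms subspace_0[OF subspace_grade] by blast
  obtain x where x: "K e x \<noteq> 0" using K_nondegenerate[OF e(2)] by blast
  obtain T y where y: "finite T" "\<And>n. y n \<in> grade n" "x = (\<Sum>n\<in>T. y n)" by (rule grade_components[of x]) (rule that)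
  have sum: "K x e = (\<Sum>m\<in>T. K (y m) e)" by (simp add: y(3) K_sum_left)
  have "\<exists>m. K (y m) e \<noteq> 0"
  proof (rule ccontr)
    assume "\<not> ?thesis"
    then have "K x e = 0" by (simp add: sum)
    then show False using x K_sym[of e x] by simp
  qed
  then obtain m where m: "K (y m) e \<noteq> 0" by blast
  have "m = (\<lambda>i. - n i)"
    by (rule K_grade_orthogonal[OF e(1) y(2)]) (use m K_sym[of "y m" e] in simp)
  then have f: "y m \<in> grade (\<lambda>i. - n i)" "K e (y m) \<noteq> 0" using y(2)[of m] m K_sym[of "y m" e] by auto
  show ?thesis
    by (rule that[OF e(1) subspace_scale[OF subspace_grade f(1), of "c / K e (y m)"]])
      (use f in \<open>simp add: K_right\<close>)
qed

lemma coroot_eq: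
  assumes "is_coroot s br \<hh> (rf n) h" "n \<noteq> (\<lambda>i. 0)"
  shows "h = s (of_real (2 / gram n n)) (t n)"
proof -
  let ?X = "{br e f | e f. e \<in> root_space s br \<hh> (rf n) \<and> f \<in> root_space s br \<hh> (\<lambda>x. - rf n x)}"
  have "?X \<subseteq> range (\<lambda>c. s c (t n))"
  proof
    fix x assume "x \<in> ?X"
    then obtain e f where ef: "x = br e f" "e \<in> grade n" "f \<in> grade (\<lambda>i. - n i)"
      by (auto simp: grade_def root_space_def rf_simps)
    then show "x \<in> range (\<lambda>c. s c (t n))" using br_opposite[OF ef(2,3)] by blast
  qed
  moreover have "subspace (range (\<lambda>c. s c (t n)))"
    by (auto simp: subspace_def image_iff simp flip: scale_left_distrib)
  ultimately have "span ?X \<subseteq> range (\<lambda>c. s c (t n))" by (rule span_minimal)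
  then obtain c where c: "h = s c (t n)" using assms(1) by (auto simp: is_coroot_def)
  then have "c * of_real (gram n n) = 2"
    using assms(1) by (simp add: is_coroot_def rf_linear(2)[OF t_in_hh] rf_t)
  then have "c = of_real (2 / gram n n)" using gram_pos[OF assms(2)] by (simp add: field_simps)
  then show ?thesis using c by simp
qed

lemma dual_form_rf:
  assumes "c \<noteq> 0"
  shows "dual_form (\<lambda>x y. c * K x y) \<hh> (rf n) (rf n) = of_real (gram n n) / c"
proof -
  have "dual_vector (\<lambda>x y. c * K x y) \<hh> (rf n) = s (1 / c) (t n)"
    unfolding dual_vector_def
  proof (rule the_equality)
    show "s (1 / c) (t n) \<in> \<hh> \<and> (\<forall>h\<in>\<hh>. c * K (s (1 / c) (t n)) h = rf n h)"
      using assms by (simp add: K_left K_t subspace_scale[OF subspace_hh t_in_hh])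
    fix u assume u: "u \<in> \<hh> \<and> (\<forall>h\<in>\<hh>. c * K u h = rf n h)"
    show "u = s (1 / c) (t n)"
    proof (rule K_hh_unique)
      show "u \<in> \<hh>" "s (1 / c) (t n) \<in> \<hh>" using u subspace_scale[OF subspace_hh t_in_hh] by auto
      show "K u h = K (s (1 / c) (t n)) h" if "h \<in> \<hh>" for h
        using u that assms by (simp add: K_left K_t field_simps)
    qed
  qed
  then show ?thesis
    using assms by (simp add: dual_form_def K_left K_right K_t[OF t_in_hh] rf_t)
qed

section \<open>Generation by the Chevalley generators\<close>

lemma cas_grade:
  assumes "w \<in> grade n"
  shows "sl2_action.cas s (br (E i)) (br (F i)) (br (H i)) c w \<in> grade n"
proof -
  interpret sl2: sl2_action s "br (E i)" "br (F i)" "br (H i)" by (rule sl2_simple)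
  have "H i \<in> grade (\<lambda>j. 0)" by (simp add: grade_zero H_in_hh)
  then have H: "br (H i) w \<in> grade n" if "w \<in> grade n" for w using br_grade[of "H i" "\<lambda>j. 0" w n] that by simp
  moreover have "br (F i) (br (E i) w) \<in> grade n"
    using br_grade[OF F_grade br_grade[OF E_grade assms], of i i] by simp
  ultimately show ?thesis
    unfolding sl2.cas_def
    by (intro subspace_add[OF subspace_grade] subspace_diff[OF subspace_grade] subspace_scale[OF subspace_grade] H assms)
qed

text \<open>Since \<open>gram n n > 0\<close>, some simple root \<open>\<alpha>\<^sub>j\<close> occurs in \<open>n\<close> and pairs positively with it. Then \<open>ad E\<^sub>j\<close> maps the
  part below onto the part of degree \<open>n\<close>, which reduces the height.\<close>

lemma positive_grade_generated:
  assumes M: "subspace M" "\<And>x y. x \<in> M \<Longrightarrow> y \<in> M \<Longrightarrow> br x y \<in> M"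
    and gen: "\<And>i. E i \<in> M" "\<hh> \<subseteq> M" and n: "\<And>i. n i \<ge> 0"
  shows "grade n \<subseteq> M"
  using n
proof (induction "\<Sum>i\<in>UNIV. nat (n i)" arbitrary: n rule: less_induct)
  case less
  show ?case
  proof (cases "n = (\<lambda>i. 0)")
    case True
    then show ?thesis using gen by (simp add: grade_zero)
  next
    case False
    have "gram n n = (\<Sum>j\<in>UNIV. of_int (n j) * (\<Sum>i\<in>UNIV. of_int (n i) * G i j))"
      unfolding gram_def by (subst sum.swap) (simp add: sum_distrib_left ac_simps)
    then have "\<exists>j. of_int (n j) * (\<Sum>i\<in>UNIV. of_int (n i) * G i j) > 0"
      using gram_pos[OF False] by (metis (no_types, lifting) not_less sum_nonpos)
    then obtain j where j: "of_int (n j) * (\<Sum>i\<in>UNIV. of_int (n i) * G i j) > 0" by blast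
    have nj: "n j > 0" and Gj: "(\<Sum>i\<in>UNIV. of_int (n i) * G i j) > 0"
      using j less.prems[of j] by (auto simp: zero_less_mult_iff)
    interpret sl2: sl2_action s "br (E j)" "br (F j)" "br (H j)" by (rule sl2_simple)
    have "(\<Sum>i\<in>UNIV. nat (n i - unit j i)) < (\<Sum>i\<in>UNIV. nat (n i))"
      by (rule sum_strict_mono_ex1) (use nj in \<open>auto simp: unit_def intro!: exI[of _ j]\<close>)
    moreover have "n i - unit j i \<ge> 0" for i using nj less.prems[of i] by (simp add: unit_def)
    ultimately have IH: "grade (\<lambda>i. n i - unit j i) \<subseteq> M" by (rule less.hyps)
    show ?thesis
    proof
      fix x assume x: "x \<in> grade n"
      have "\<exists>u\<in>grade n. x = br (E j) (br (F j) u)"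
      proof (rule sl2.e_f_surj[OF subspace_grade])
        show "br (H j) w = s (complex_of_real (ef_form j * (\<Sum>i\<in>UNIV. of_int (n i) * G i j))) w"
          if "w \<in> grade n" for w
          using gradeD[OF that H_in_hh, of j] by (simp only: rf_H)
        show "ef_form j * (\<Sum>i\<in>UNIV. of_int (n i) * G i j) > 0" using Gj ef_form_pos[of j] by simp
      qed (use x cas_grade ad_E_nilpotent in auto)
      then obtain u where u: "u \<in> grade n" "x = br (E j) (br (F j) u)" by blast
      have "br (F j) u \<in> grade (\<lambda>i. n i - unit j i)" using br_grade[OF F_grade u(1), of j] by simp
      then show "x \<in> M" using IH u(2) M(2) gen(1) by blast
    qed
  qed
qed

text \<open>Parts of negative degree are handled by the opposite Chevalley data.\<close>

lemma generated:
  assumes M: "subspace M" "\<And>x y. x \<in> M \<Longrightarrow> y \<in> M \<Longrightarrow> br x y \<in> M"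
    and gen: "\<And>i. E i \<in> M" "\<And>i. F i \<in> M" "\<hh> \<subseteq> M"
  shows "M = UNIV"
proof -
  interpret op: chevalley_setting s br \<hh> "\<lambda>i h. - \<alpha> i h" F E "\<lambda>i. - H i" by (rule opposite)
  have op_grade: "op.grade n = grade (\<lambda>i. - n i)" for n
    unfolding op.grade_def grade_def op.rf_def rf_def by (simp add: sum_negf)
  have "grade n \<subseteq> M" for n
  proof (cases "grade n = {0}")
    case True
    then show ?thesis using subspace_0[OF M(1)] by simp
  next
    case False
    then consider "\<forall>i. n i \<ge> 0" | "\<forall>i. n i \<le> 0" using grade_sign by blast
    then show ?thesis
    proof cases
      case 1
      then show ?thesis using positive_grade_generated[OF M gen(1,3)] by blast
    next
      case 2
      then have "op.grade (\<lambda>i. - n i) \<subseteq> M" using op.positive_grade_generated[OF M gen(2,3)] by simp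
      then show ?thesis by (simp add: op_grade)
    qed
  qed
  then have "span (\<Union>n. grade n) \<subseteq> M" using M(1) by (intro span_minimal) auto
  then show ?thesis using root_decomposition by auto
qed

lemma reflect_grade:
  assumes "grade n \<noteq> {0}" "rf n (H j) = - of_nat p"
  shows "grade (\<lambda>i. n i + int p * unit j i) \<noteq> {0}"
proof -
  interpret sl2: sl2_action s "br (E j)" "br (F j)" "br (H j)" by (rule sl2_simple)
  interpret op: sl2_action s "br (F j)" "br (E j)" "\<lambda>w. - br (H j) w" by (rule sl2.opposite)
  obtain w where w: "w \<in> grade n" "w \<noteq> 0" using assms(1) subspace_0[OF subspace_grade] by blast
  interpret opc: chevalley_setting s br \<hh> "\<lambda>i h. - \<alpha> i h" F E "\<lambda>i. - H i" by (rule opposite)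
  have op_grade: "opc.grade n = grade (\<lambda>i. - n i)" for n
    unfolding opc.grade_def grade_def opc.rf_def rf_def by (simp add: sum_negf)
  have bij: "bij_betw (\<lambda>w. (br (F j) ^^ p) ((br (E j) ^^ p) w)) (grade n) (grade n)"
  proof (rule op.e_pow_f_pow_bij_betw[OF subspace_grade _ _ ad_F_nilpotent])
    show "- br (H j) w = s (of_nat p) w" if "w \<in> grade n" for w
      using gradeD[OF that H_in_hh, of j] assms(2) by (simp add: scale_minus_left)
    have eq: "br (- H j) = (\<lambda>w. - br (H j) w)" by (simp add: fun_eq_iff br_simps)
    show "op.cas c w \<in> grade n" if "w \<in> grade n" for c w
      using opc.cas_grade[of w "\<lambda>i. - n i" j c] that by (simp add: op_grade eq)
  qed
  have "(br (E j) ^^ p) w \<noteq> 0"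
  proof
    assume z: "(br (E j) ^^ p) w = 0"
    have z0: "(br (E j) ^^ p) 0 = 0" by (rule linD(3)[OF linear_funpow[OF linear_right]])
    have "w = 0"
      using inj_onD[OF bij_betw_imp_inj_on[OF bij], of w 0] w(1) subspace_0[OF subspace_grade] z z0 by simp
    then show False using w(2) by simp
  qed
  moreover have "(br (E j) ^^ q) w \<in> grade (\<lambda>i. n i + int q * unit j i)" for q
  proof (induction q)
    case (Suc q)
    show ?case using br_grade[OF E_grade Suc, of j] by (simp add: algebra_simps)
  qed (simp add: w)
  ultimately show ?thesis by blast
qed

end

section \<open>The highest root and the normalized form\<close>

locale highest_root_setting = chevalley_setting s br \<hh> \<alpha> E F H
  for s :: "complex \<Rightarrow> 'g::ab_group_add \<Rightarrow> 'g" and br :: "'g \<Rightarrow> 'g \<Rightarrow> 'g" and \<hh> :: "'g set"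
    and \<alpha> :: "'i::finite \<Rightarrow> 'g \<Rightarrow> complex" and E F H :: "'i \<Rightarrow> 'g" +
  fixes \<theta> :: "'g \<Rightarrow> complex" and H\<theta> :: 'g and B :: "'g \<Rightarrow> 'g \<Rightarrow> complex"
  assumes highest: "is_highest_root s br \<hh> \<alpha> \<theta>"
    and coroot: "is_coroot s br \<hh> \<theta> H\<theta>"
    and normalized: "normalized_killing_form s br \<hh> B"
begin

definition marks :: "'i \<Rightarrow> int" where
  "marks = (SOME n. \<theta> = rf n \<and> n \<noteq> (\<lambda>i. 0) \<and> grade n \<noteq> {0})"

lemma marks: "\<theta> = rf marks" "marks \<noteq> (\<lambda>i. 0)" "grade marks \<noteq> {0}"
proof -
  have "\<theta> \<in> roots s br \<hh>" using highest by (simp add: is_highest_root_def)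
  then have "\<exists>n. \<theta> = rf n \<and> n \<noteq> (\<lambda>i. 0) \<and> grade n \<noteq> {0}" using roots_cases by metis
  from someI_ex[OF this] show "\<theta> = rf marks" "marks \<noteq> (\<lambda>i. 0)" "grade marks \<noteq> {0}"
    unfolding marks_def by blast+
qed

lemma root_le_marks: "n \<noteq> (\<lambda>i. 0) \<Longrightarrow> grade n \<noteq> {0} \<Longrightarrow> n i \<le> marks i"
proof -
  assume n: "n \<noteq> (\<lambda>i. 0)" "grade n \<noteq> {0}"
  have "(\<lambda>h. \<theta> h - rf n h) \<in> nonneg_comb \<alpha>"
    using highest rf_in_roots[OF n] by (simp add: is_highest_root_def)
  moreover have "(\<lambda>h. \<theta> h - rf n h) = rf (\<lambda>i. marks i - n i)"
    by (simp add: fun_eq_iff rf_simps flip: marks(1))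
  ultimately have "rf (\<lambda>i. marks i - n i) \<in> nonneg_comb \<alpha>" by simp
  then have "marks i - n i \<ge> 0" by (rule nonneg_comb_rf)
  then show ?thesis by simp
qed

lemma marks_pos: "marks i \<ge> 1"
  using root_le_marks[OF unit_ne_0 grade_unit, of i i] by (simp add: unit_def)

lemma grade_le_marks: "grade n \<noteq> {0} \<Longrightarrow> n i \<le> marks i"
  using root_le_marks[of n i] marks_pos[of i] by fastforce

lemma grade_above_marks: "grade (\<lambda>i. marks i + unit j i) = {0}"
  using grade_le_marks[of "\<lambda>i. marks i + unit j i" j] by (auto simp: unit_def)

lemma marks_dominant: "(\<Sum>i\<in>UNIV. of_int (marks i) * G i j) \<ge> 0"
proof -
  interpret sl2: sl2_action s "br (E j)" "br (F j)" "br (H j)" by (rule sl2_simple)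
  obtain x where x: "x \<in> grade marks" "x \<noteq> 0" using marks(3) subspace_0[OF subspace_grade] by blast
  have "br (E j) x \<in> grade (\<lambda>i. marks i + unit j i)" using br_grade[OF E_grade x(1), of j] by (simp add: add.commute)
  then have Ex: "br (E j) x = 0" by (simp add: grade_above_marks)
  obtain N where "(br (F j) ^^ N) x = 0" using ad_F_nilpotent by blast
  then have "rf marks (H j) \<in> \<nat>"
    by (rule sl2.highest_weight_nat[OF gradeD[OF x(1) H_in_hh] Ex x(2)])
  then obtain l where "rf marks (H j) = of_nat l" by (auto elim: Nats_cases)
  then have "complex_of_real (ef_form j * (\<Sum>i\<in>UNIV. of_int (marks i) * G i j)) = of_real (real l)"
    by (simp add: rf_H)
  then have "ef_form j * (\<Sum>i\<in>UNIV. of_int (marks i) * G i j) = real l" by (simp only: of_real_eq_iff)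
  then show ?thesis using ef_form_pos[of j] by (metis mult_less_0_iff not_less of_nat_0_le_iff)
qed

lemma gram_simps:
  "gram (\<lambda>i. m i + n i) l = gram m l + gram n l" "gram l (\<lambda>i. m i + n i) = gram l m + gram l n"
  "gram (\<lambda>i. k * m i) l = of_int k * gram m l" "gram l (\<lambda>i. k * m i) = of_int k * gram l m"
  "gram (\<lambda>i. - m i) l = - gram m l" "gram l (\<lambda>i. - m i) = - gram l m"
  "gram (\<lambda>i. m i - n i) l = gram m l - gram n l" "gram l (\<lambda>i. m i - n i) = gram l m - gram l n"
  by (simp_all add: gram_def sum.distrib sum_distrib_left sum_negf sum_subtractf algebra_simps)

lemma gram_sym: "gram m n = gram n m"
proof -
  have eq: "of_int (m i) * of_int (n j) * G i j = of_int (n j) * of_int (m i) * G j i" for i j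
    using G_sym[of i j] by simp
  show ?thesis unfolding gram_def by (subst sum.swap) (intro sum.cong refl eq)
qed

lemma gram_unit: "gram m (unit j) = (\<Sum>i\<in>UNIV. of_int (m i) * G i j)"
proof -
  have "(\<Sum>l\<in>UNIV. of_int (m i) * of_int (unit j l) * G i l) =
      (\<Sum>l\<in>UNIV. if l = j then of_int (m i) * G i l else 0)" for i
    by (rule sum.cong) (auto simp: unit_def)
  then show ?thesis unfolding gram_def by simp
qed

lemma gram_unit_unit: "gram (unit i) (unit i) = 2 / ef_form i"
proof -
  have "(\<Sum>l\<in>UNIV. of_int (unit i l) * G l i) = (\<Sum>l\<in>UNIV. if l = i then G l i else 0)"
    by (rule sum.cong) (auto simp: unit_def)
  then show ?thesis by (simp add: gram_unit G_diag)
qed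

text \<open>The weights of the adjoint representation are stable under the simple reflections, so they satisfy
  the norm bound with respect to its highest weight.\<close>

lemma root_length_le: "grade n \<noteq> {0} \<Longrightarrow> gram n n \<le> gram marks marks"
proof -
  assume n: "grade n \<noteq> {0}"
  define P where "P = {p :: 'i \<Rightarrow> nat. grade (\<lambda>i. marks i - int (p i)) \<noteq> {0}}"
  define L where "L j = (\<Sum>i\<in>UNIV. of_int (marks i) * G i j)" for j
  define p where "p i = nat (marks i - n i)" for i
  have np: "n = (\<lambda>i. marks i - int (p i))" using grade_le_marks[OF n] by (simp add: p_def)
  have "(\<Sum>i\<in>UNIV. \<Sum>j\<in>UNIV. real (p i) * real (p j) * G i j) \<le> 2 * (\<Sum>j\<in>UNIV. real (p j) * L j)"
  proof (rule reflection_norm_bound[where P = P])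
    show "G j j > 0" for j using ef_form_pos[of j] by (simp add: G_diag)
    show "p \<in> P" using n np by (simp add: P_def)
    fix p j assume p: "p \<in> P" and neg: "L j - (\<Sum>i\<in>UNIV. real (p i) * G i j) < 0"
    let ?n = "\<lambda>i. marks i - int (p i)"
    define x where "x = L j - (\<Sum>i\<in>UNIV. real (p i) * G i j)"
    have rf: "rf ?n (H j) = of_real (ef_form j * x)"
      by (simp add: rf_H x_def L_def algebra_simps sum_subtractf)
    have "rf ?n (H j) \<in> \<int>" using p by (intro rf_H_Ints) (simp add: P_def)
    then obtain z where "complex_of_real (ef_form j * x) = of_int z" by (auto simp: rf elim: Ints_cases)
    then have z: "ef_form j * x = of_int z" by (metis of_real_eq_iff of_real_of_int_eq)
    have "ef_form j * x < 0" using neg ef_form_pos[of j] by (simp add: x_def mult_pos_neg)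
    then have "z < 0" using z by simp
    define q where "q = nat (- z)"
    have q: "ef_form j * x = - real q" using z \<open>z < 0\<close> by (simp add: q_def)
    have gs': "grade (\<lambda>i. ?n i + int q * unit j i) \<noteq> {0}"
      by (rule reflect_grade) (use p in \<open>auto simp: P_def rf q\<close>)
    then have "?n j + int q * unit j j \<le> marks j" by (rule grade_le_marks)
    then have qp: "q \<le> p j" by (simp add: unit_def)
    have "(\<lambda>i. marks i - int ((p(j := p j - q)) i)) = (\<lambda>i. ?n i + int q * unit j i)"
      using qp by (auto simp: unit_def)
    then have "p(j := p j - q) \<in> P" using gs' by (simp only: P_def mem_Collect_eq not_False_eq_True)
    moreover have "real (p j - q) = real (p j) + 2 * x / G j j"
      using qp q ef_form_pos[of j] by (simp add: G_diag mult.commute)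
    ultimately show "\<exists>m. p(j := m) \<in> P \<and>
        real m = real (p j) + 2 * (L j - (\<Sum>i\<in>UNIV. real (p i) * G i j)) / G j j"
      unfolding x_def by blast
  qed (use marks_dominant G_sym in \<open>auto simp: L_def\<close>)
  moreover have "(\<Sum>i\<in>UNIV. \<Sum>j\<in>UNIV. real (p i) * real (p j) * G i j) = gram (\<lambda>i. int (p i)) (\<lambda>i. int (p i))"
    by (simp add: gram_def)
  moreover have "(\<Sum>j\<in>UNIV. real (p j) * L j) = gram marks (\<lambda>i. int (p i))"
    unfolding gram_def L_def by (subst sum.swap) (simp add: sum_distrib_left ac_simps)
  moreover have "gram n n = gram marks marks - 2 * gram marks (\<lambda>i. int (p i)) + gram (\<lambda>i. int (p i)) (\<lambda>i. int (p i))"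
    unfolding np by (simp add: gram_simps gram_sym[of "\<lambda>i. int (p i)" marks])
  ultimately show ?thesis by simp
qed

text \<open>The factor by which the normalized form differs from the Killing form, see \<open>B_eq\<close> below.\<close>

definition norm_const :: real where
  "norm_const = gram marks marks / 2"

lemma norm_const_pos: "norm_const > 0"
  using gram_pos[OF marks(2)] by (simp add: norm_const_def)

text \<open>As \<open>\<theta>\<close> is a longest root, it has the length of the root to which the normalization applies. That
  condition determines the scalar, which is complex a priori, and makes it a positive real number.\<close>

lemma B_eq: "B = (\<lambda>x y. of_real norm_const * K x y)"
proof -
  obtain c where c: "B = (\<lambda>x y. c * K x y)"
    using normalized by (auto simp: normalized_killing_form_def)
  have "roots s br \<hh> \<subseteq> rf ` {n. grade n \<noteq> {0}}" using roots_cases by blast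
  then have fin: "finite (roots s br \<hh>)" using finite_support finite_surj by blast
  have \<theta>: "\<theta> \<in> roots s br \<hh>" using highest by (simp add: is_highest_root_def)
  define f where "f \<beta> = Re (dual_form B \<hh> \<beta> \<beta>)" for \<beta>
  have "Max (f ` roots s br \<hh>) \<in> f ` roots s br \<hh>" using fin \<theta> by (intro Max_in) auto
  then obtain \<beta> where \<beta>: "\<beta> \<in> roots s br \<hh>" "f \<beta> = Max (f ` roots s br \<hh>)" by auto
  then have max: "f \<gamma> \<le> f \<beta>" if "\<gamma> \<in> roots s br \<hh>" for \<gamma> using fin that by simp
  then have "long_root s br \<hh> B \<beta>" using \<beta>(1) by (simp add: long_root_def f_def)
  then have two: "dual_form B \<hh> \<beta> \<beta> = 2" using normalized by (simp add: normalized_killing_form_def)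
  have c0: "c \<noteq> 0" using two by (auto simp: c dual_form_def)
  obtain n where n: "\<beta> = rf n" "grade n \<noteq> {0}" "n \<noteq> (\<lambda>i. 0)" using roots_cases[OF \<beta>(1)] by metis
  have cn: "c = of_real (gram n n / 2)"
    using two c0 by (simp add: c n(1) dual_form_rf field_simps)
  have pos: "gram n n > 0" by (rule gram_pos[OF n(3)])
  have "f \<theta> \<le> 2" using max[OF \<theta>] two by (simp add: f_def)
  moreover have "f \<theta> = 2 * gram marks marks / gram n n"
    using dual_form_rf[OF c0, of marks] by (simp add: f_def c cn flip: marks(1))
  ultimately have "gram marks marks \<le> gram n n" using pos by (simp add: field_simps)
  then have "gram n n = gram marks marks" using root_length_le[OF n(2)] by simp
  then show ?thesis by (simp add: c cn norm_const_def)
qed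

lemma B_dual_form_simple: "dual_form B \<hh> (\<alpha> i) (\<alpha> i) = of_real (2 / (norm_const * ef_form i))"
proof -
  have "\<alpha> i = rf (unit i)" by (simp add: fun_eq_iff rf_simps)
  then show ?thesis using norm_const_pos by (simp add: B_eq dual_form_rf gram_unit_unit)
qed

lemma B_dual_form_highest: "dual_form B \<hh> \<theta> \<theta> = 2"
  using dual_form_rf[of "of_real norm_const" marks] norm_const_pos by (simp add: B_eq norm_const_def flip: marks(1))

lemma H\<theta>_eq: "H\<theta> = s (of_real (1 / norm_const)) (t marks)"
  using coroot_eq[of marks H\<theta>] coroot marks(2) by (simp add: norm_const_def flip: marks(1))

lemma highest_root_triple:
  obtains E\<theta> F\<theta> where "E\<theta> \<in> grade marks" "F\<theta> \<in> grade (\<lambda>i. - marks i)" "B E\<theta> F\<theta> = 1" "br E\<theta> F\<theta> = H\<theta>"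
proof -
  obtain e f where ef: "e \<in> grade marks" "f \<in> grade (\<lambda>i. - marks i)" "K e f = of_real (1 / norm_const)"
    by (rule root_triple[OF marks(3)])
  show ?thesis
    by (rule that[OF ef(1,2)]) (use norm_const_pos in \<open>simp_all add: B_eq ef br_opposite[OF ef(1,2)] H\<theta>_eq\<close>)
qed

lemma H\<theta>_in_hh: "H\<theta> \<in> \<hh>"
  unfolding H\<theta>_eq by (rule subspace_scale[OF subspace_hh t_in_hh])

lemma rf_H\<theta>: "rf n H\<theta> = of_real (gram n marks / norm_const)"
  by (simp add: H\<theta>_eq rf_linear t_in_hh rf_t)

lemma B_EF: "B (E i) (F i) = of_real (norm_const * ef_form i)"
  by (simp add: B_eq K_EF)

lemma B_sym: "B x y = B y x"
  by (simp add: B_eq K_sym[of x y])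

lemma B_zero: "B 0 x = 0" "B x 0 = 0"
  using K_left(2)[of 0 0 x] K_right(2)[of x 0 0] by (simp_all add: B_eq)

end

section \<open>Loop operators on the module\<close>

locale affine_module = highest_root_setting s br \<hh> \<alpha> E F H \<theta> H\<theta> B
  for s :: "complex \<Rightarrow> 'g::ab_group_add \<Rightarrow> 'g" and br :: "'g \<Rightarrow> 'g \<Rightarrow> 'g" and \<hh> :: "'g set"
    and \<alpha> :: "'i::finite \<Rightarrow> 'g \<Rightarrow> complex" and E F H :: "'i \<Rightarrow> 'g"
    and \<theta> :: "'g \<Rightarrow> complex" and H\<theta> :: 'g and B :: "'g \<Rightarrow> 'g \<Rightarrow> complex" +
  fixes \<omega> :: "'i \<Rightarrow> 'g" and k :: nat and \<Lambda> :: "'g \<Rightarrow> complex"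
    and sV :: "complex \<Rightarrow> 'v::ab_group_add \<Rightarrow> 'v" and act :: "'g affine \<Rightarrow> 'v \<Rightarrow> 'v"
    and v :: 'v and \<mu> :: complex and L0 :: "'v \<Rightarrow> 'v"
  assumes coweights: "fundamental_coweights \<hh> \<alpha> \<omega>"
    and integrable: "integrable_weight s \<hh> H H\<theta> k \<Lambda>"
    and hw_module: "irreducible_highest_weight_module s br \<hh> B E k \<Lambda> sV act v"
    and degree: "is_degree_operator sV act v \<mu> L0"
begin

definition lop :: "'g \<Rightarrow> int \<Rightarrow> 'v \<Rightarrow> 'v" where
  "lop a n = act (loop a n)"

lemma lie_module: "lie_module (affine_scale s) (affine_bracket br B) sV act"
  using hw_module by (simp add: irreducible_highest_weight_module_def)

lemma linear_act_left: "Vector_Spaces.linear (affine_scale s) sV (\<lambda>x. act x w)"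
  and linear_act: "Vector_Spaces.linear sV sV (act x)"
  and act_bracket: "act (affine_bracket br B x y) w = act x (act y w) - act y (act x w)"
  using lie_module unfolding lie_module_def by blast+

sublocale V: complex_vector_space sV
  using linear_act by (auto simp: complex_vector_space_def Vector_Spaces.linear_def)

lemma act_add: "act (x + y) w = act x w + act y w" and act_scale: "act (affine_scale s c x) w = sV c (act x w)"
proof -
  interpret f: module_hom "affine_scale s" sV "\<lambda>x. act x w"
    using linear_act_left unfolding Vector_Spaces.linear_def by auto
  show "act (x + y) w = act x w + act y w" "act (affine_scale s c x) w = sV c (act x w)"
    by (simp_all add: f.add f.scale)
qed

lemma act_sum: "finite A \<Longrightarrow> act (\<Sum>x\<in>A. f x) w = (\<Sum>x\<in>A. act (f x) w)"
proof (induction A rule: finite_induct)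
  case empty
  show ?case using act_add[of 0 0 w] by simp
qed (simp add: act_add)

lemma act_central: "act central w = sV (of_nat k) w"
  using hw_module by (simp add: irreducible_highest_weight_module_def)

lemma loop_add: "loop (a + b) n = loop a n + loop b n"
  by (simp add: loop_def single_add)

lemma loop_scale: "loop (s c a) n = affine_scale s c (loop a n)"
  by (auto simp: loop_def affine_scale_def intro!: poly_mapping_eqI
      simp: Poly_Mapping.map.rep_eq when_def lookup_single)

lemma lin_lop: "Vector_Spaces.linear sV sV (lop a n)"
  unfolding lop_def by (rule linear_act)

lemmas lop_simps = linD[OF lin_lop]

lemma lop_add: "lop (a + b) n w = lop a n w + lop b n w" and lop_scale: "lop (s c a) n w = sV c (lop a n w)"
  by (simp_all add: lop_def loop_add loop_scale act_add act_scale)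

lemma lop_left: "lop 0 n w = 0" "lop (- a) n w = - lop a n w" "lop (a - b) n w = lop a n w - lop b n w"
proof -
  show zero: "lop 0 n w = 0" using lop_add[of 0 0 n w] by simp
  show minus: "lop (- a) n w = - lop a n w" for a
    using lop_add[of a "- a" n w] zero by (simp add: eq_neg_iff_add_eq_0 add.commute)
  show "lop (a - b) n w = lop a n w - lop b n w" using lop_add[of a "- b" n w] minus[of b] by simp
qed

lemma lop_sum: "lop (\<Sum>x\<in>A. f x) n w = (\<Sum>x\<in>A. lop (f x) n w)"
  by (induction A rule: infinite_finite_induct) (simp_all add: lop_left lop_add)

lemma lop_comm:
  "lop a m (lop b n w) = lop b n (lop a m w) + lop (br a b) (m + n) w +
     (if m + n = 0 then sV (of_int m * B a b * of_nat k) w else 0)"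
proof -
  have split: "(Poly_Mapping.single (m + n) c, z) = loop c (m + n) + affine_scale s z central" for c z
    by (auto simp: loop_def affine_scale_def central_def intro!: poly_mapping_eqI
        simp: Poly_Mapping.map.rep_eq when_def lookup_single)
  have "lop a m (lop b n w) - lop b n (lop a m w) = act (affine_bracket br B (loop a m) (loop b n)) w"
    by (simp add: act_bracket lop_def)
  also have "\<dots> = lop (br a b) (m + n) w +
      sV (if m + n = 0 then of_int m * B a b * of_nat k else 0) w"
    unfolding affine_bracket_loop[where B = B, OF lie_algebra_axioms B_zero] split act_add act_scale act_central
    by (simp add: lop_def)
  finally show ?thesis by (simp add: algebra_simps)
qed

lemma submoduleI:
  assumes "V.subspace W" "\<And>a n w. w \<in> W \<Longrightarrow> lop a n w \<in> W"
  shows "submodule sV act W"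
  unfolding submodule_def
proof (intro conjI allI ballI assms(1))
  fix x :: "'g affine" and w assume w: "w \<in> W"
  obtain f z where x: "x = (f, z)" by (cases x)
  have snd_sum: "snd (\<Sum>a\<in>A. g a) = (\<Sum>a\<in>A. snd (g a))" for A and g :: "int \<Rightarrow> 'g affine"
    by (induction A rule: infinite_finite_induct) auto
  have fst_sum: "fst (\<Sum>a\<in>A. g a) = (\<Sum>a\<in>A. fst (g a))" for A and g :: "int \<Rightarrow> 'g affine"
    by (induction A rule: infinite_finite_induct) auto
  have f: "f = (\<Sum>n\<in>Poly_Mapping.keys f. Poly_Mapping.single n (Poly_Mapping.lookup f n))"
    by (rule poly_mapping_eqI)
      (auto simp: lookup_sum lookup_single when_def in_keys_iff sum.delta)
  have "x = (\<Sum>n\<in>Poly_Mapping.keys f. loop (Poly_Mapping.lookup f n) n) + affine_scale s z central"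
  proof (rule prod_eqI)
    have "Poly_Mapping.map (s z) (0 :: int \<Rightarrow>\<^sub>0 'g) = 0"
      by (rule poly_mapping_eqI) (simp add: Poly_Mapping.map.rep_eq when_def)
    then show "fst x = fst ((\<Sum>n\<in>Poly_Mapping.keys f. loop (Poly_Mapping.lookup f n) n) +
        affine_scale s z central)"
      using f by (simp add: x fst_sum loop_def affine_scale_def central_def)
    show "snd x = snd ((\<Sum>n\<in>Poly_Mapping.keys f. loop (Poly_Mapping.lookup f n) n) +
        affine_scale s z central)"
      by (simp add: x snd_sum loop_def affine_scale_def central_def)
  qed
  then have "act x w = (\<Sum>n\<in>Poly_Mapping.keys f. lop (Poly_Mapping.lookup f n) n w) + sV (z * of_nat k) w"
    by (simp add: act_add act_sum lop_def act_scale act_central)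
  then show "act x w \<in> W"
    using assms w by (auto intro!: V.subspace_add V.subspace_sum V.subspace_scale)
qed

lemma irreducible:
  assumes "V.subspace W" "\<And>a n w. w \<in> W \<Longrightarrow> lop a n w \<in> W" "w \<in> W" "w \<noteq> 0"
  shows "W = UNIV"
proof -
  have "W = {0} \<or> W = UNIV"
    using hw_module submoduleI[OF assms(1,2)]
    by (auto simp: irreducible_highest_weight_module_def irreducible_module_def)
  then show ?thesis using assms(3,4) by auto
qed

text \<open>The loop algebra is generated by \<open>\<gg>\<close> together with one nonzero element in each of the degrees \<open>1\<close>
  and \<open>-1\<close>: the elements whose degree \<open>n\<close> copies preserve \<open>W\<close> form an ideal of \<open>\<gg>\<close>.\<close>

lemma loop_generated:
  assumes W: "V.subspace W"
    and gen: "\<And>i w. w \<in> W \<Longrightarrow> lop (E i) 0 w \<in> W" "\<And>i w. w \<in> W \<Longrightarrow> lop (F i) 0 w \<in> W"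
      "\<And>h w. h \<in> \<hh> \<Longrightarrow> w \<in> W \<Longrightarrow> lop h 0 w \<in> W"
    and up: "x \<noteq> 0" "\<And>w. w \<in> W \<Longrightarrow> lop x 1 w \<in> W"
    and down: "y \<noteq> 0" "\<And>w. w \<in> W \<Longrightarrow> lop y (- 1) w \<in> W"
    and "w \<in> W"
  shows "lop a n w \<in> W"
proof -
  define M where "M n = {a. \<forall>w\<in>W. lop a n w \<in> W}" for n
  have sub: "subspace (M n)" for n
    unfolding subspace_def M_def
    by (auto simp: lop_left lop_add lop_scale intro!: V.subspace_add[OF W] V.subspace_scale[OF W] V.subspace_0[OF W])
  have brM: "br a b \<in> M (m + n)" if ab: "a \<in> M m" "b \<in> M n" for a b m n
  proof -
    have "lop (br a b) (m + n) w = lop a m (lop b n w) - lop b n (lop a m w) -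
        sV (if m + n = 0 then of_int m * B a b * of_nat k else 0) w" for w
      using lop_comm[of a m b n w] by simp
    then show ?thesis
      using ab W unfolding M_def by (auto intro!: V.subspace_diff V.subspace_scale)
  qed
  have M0: "M 0 = UNIV"
  proof (rule generated[OF sub])
    show "br a b \<in> M 0" if "a \<in> M 0" "b \<in> M 0" for a b using brM[OF that] by simp
  qed (use gen in \<open>auto simp: M_def\<close>)
  have ideal: "M n = UNIV" if z: "z \<in> M n" "z \<noteq> 0" for z n
  proof -
    have "lie_ideal s br (M n)"
      unfolding lie_ideal_def using sub brM[of _ 0 _ n] M0 by auto
    then show ?thesis using ideal_cases z by blast
  qed
  obtain c d where cd: "br c d \<noteq> 0" using simple by (auto simp: fd_simple_lie_algebra_def)
  have M1: "M 1 = UNIV" "M (- 1) = UNIV"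
    using ideal[of x 1] ideal[of y "- 1"] up down by (auto simp: M_def)
  have pos: "M (int n) = UNIV" for n
  proof (induction n)
    case (Suc n)
    have "br c d \<in> M (1 + int n)" by (rule brM) (use M1 Suc in auto)
    then show ?case using ideal[OF _ cd, of "1 + int n"] by (simp add: add.commute)
  qed (simp add: M0)
  have neg: "M (- int n) = UNIV" for n
  proof (induction n)
    case (Suc n)
    have "br c d \<in> M (- 1 + - int n)" by (rule brM) (use M1 Suc in auto)
    then show ?case using ideal[OF _ cd, of "- 1 + - int n"] by (simp add: add.commute)
  qed (simp add: M0)
  have "M n = UNIV" using pos[of "nat n"] neg[of "nat (- n)"] by (cases "n \<ge> 0") auto
  then show ?thesis using \<open>w \<in> W\<close> by (auto simp: M_def)
qed

text \<open>The vectors killed by some power of \<open>a(m)\<close> form a submodule: commuting \<open>a(m)\<close> past \<open>y(n)\<close> produces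
  brackets of \<open>y\<close> with \<open>a\<close>, which vanish after finitely many steps, and scalars.\<close>

lemma nilpotent_on_module:
  assumes ad: "\<And>y. \<exists>N. (br a ^^ N) y = 0" and u: "(lop a m ^^ N) u = 0" "u \<noteq> 0"
  shows "\<exists>N. (lop a m ^^ N) w = 0"
proof -
  have lin: "Vector_Spaces.linear sV sV (lop a m ^^ N)" for N by (rule V.linear_funpow[OF lin_lop])
  define W where "W = {w. \<exists>N. (lop a m ^^ N) w = 0}"
  have mono: "(lop a m ^^ (N + M)) w = 0" if "(lop a m ^^ N) w = 0" for N M w
    using that by (subst add.commute) (simp add: funpow_add linD[OF lin])
  have step: "w \<in> W" if "lop a m w \<in> W" for w
  proof -
    from that obtain N where "(lop a m ^^ N) (lop a m w) = 0" by (auto simp: W_def)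
    then have "(lop a m ^^ Suc N) w = 0" by (simp add: funpow_swap1)
    then show ?thesis unfolding W_def by blast
  qed
  have W: "V.subspace W"
    unfolding V.subspace_def
  proof (intro conjI ballI allI)
    show "0 \<in> W" by (auto simp: W_def intro: exI[of _ 0])
    fix y z assume "y \<in> W" "z \<in> W"
    then obtain N M where "(lop a m ^^ N) y = 0" "(lop a m ^^ M) z = 0" by (auto simp: W_def)
    then have "(lop a m ^^ (N + M)) (y + z) = 0"
      using mono[of N y M] mono[of M z N] by (simp add: linD[OF lin] add.commute)
    then show "y + z \<in> W" by (auto simp: W_def)
  next
    fix c y assume "y \<in> W"
    then obtain N where "(lop a m ^^ N) y = 0" by (auto simp: W_def)
    then have "(lop a m ^^ N) (sV c y) = 0" by (simp add: linD[OF lin])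
    then show "sV c y \<in> W" by (auto simp: W_def)
  qed
  have "lop y n w \<in> W" if "(br a ^^ M) y = 0" "(lop a m ^^ N) w = 0" for M N y n w
    using that
  proof (induction M arbitrary: y n w N)
    case 0
    then show ?case using V.subspace_0[OF W] by (simp add: lop_left)
  next
    case (Suc M)
    show ?case
      using Suc.prems(2)
    proof (induction N arbitrary: w)
      case 0
      then show ?case using V.subspace_0[OF W] by (simp add: lop_simps)
    next
      case (Suc N)
      have "lop y n (lop a m w) \<in> W" by (rule Suc.IH) (use Suc.prems in \<open>simp add: funpow_swap1\<close>)
      moreover have "lop (br a y) (m + n) w \<in> W"
        by (rule \<open>\<And>y n w N. (br a ^^ M) y = 0 \<Longrightarrow> (lop a m ^^ N) w = 0 \<Longrightarrow> lop y n w \<in> W\<close>[of _ "Suc N"])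
          (use Suc.prems \<open>(br a ^^ Suc M) y = 0\<close> in \<open>simp_all add: funpow_swap1\<close>)
      moreover have "w \<in> W" using Suc.prems by (auto simp: W_def simp del: funpow.simps)
      ultimately have "lop a m (lop y n w) \<in> W"
        unfolding lop_comm[of a m y n w] using V.subspace_0[OF W]
        by (auto intro!: V.subspace_add[OF W] V.subspace_scale[OF W])
      then show ?case by (rule step)
    qed
  qed
  then have "lop y n w \<in> W" if "w \<in> W" for y n w
    using ad[of y] that by (auto simp: W_def)
  then have "W = UNIV" by (rule irreducible[OF W _ _ u(2)]) (use u in \<open>auto simp: W_def\<close>)
  then show ?thesis by (auto simp: W_def)
qed

lemma v_ne_0: "v \<noteq> 0" and lop_pos_v: "n > 0 \<Longrightarrow> lop a n v = 0" and lop_E_v: "lop (E i) 0 v = 0"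
  and lop_hh_v: "h \<in> \<hh> \<Longrightarrow> lop h 0 v = sV (\<Lambda> h) v"
  using hw_module by (auto simp: irreducible_highest_weight_module_def lop_def)

text \<open>The central term in \<open>[x(m), y(-m)]\<close> shifts the third operator by the constant \<open>m \<langle>x, y\<rangle> k\<close>.\<close>

lemma lop_sl2:
  assumes xy: "x \<in> grade n" "y \<in> grade (\<lambda>i. - n i)" and two: "rf n (br x y) = 2"
  shows "sl2_action sV (lop x m) (lop y (- m)) (\<lambda>w. lop (br x y) 0 w + sV (of_int m * B x y * of_nat k) w)"
proof (intro sl2_action.intro sl2_action_axioms.intro lin_lop)
  have hh: "br x y \<in> \<hh>" using br_grade[OF xy] by (simp add: grade_zero)
  show "complex_vector_space sV" ..
  show "Vector_Spaces.linear sV sV (\<lambda>w. lop (br x y) 0 w + sV (of_int m * B x y * of_nat k) w)"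
    by (rule V.linearI) (simp_all add: lop_simps V.scale_right_distrib V.scale_left_commute)
  show "lop x m (lop y (- m) w) - lop y (- m) (lop x m w) = lop (br x y) 0 w + sV (of_int m * B x y * of_nat k) w"
    for w using lop_comm[of x m y "- m" w] by simp
  have hx: "br (br x y) x = s 2 x" and hy: "br (br x y) y = s (- 2) y"
    using gradeD[OF xy(1) hh] gradeD[OF xy(2) hh] two by (simp_all add: rf_simps)
  show "lop (br x y) 0 (lop x m w) + sV (of_int m * B x y * of_nat k) (lop x m w) -
      lop x m (lop (br x y) 0 w + sV (of_int m * B x y * of_nat k) w) = sV 2 (lop x m w)" for w
    using lop_comm[of "br x y" 0 x m w] by (simp add: hx lop_simps lop_scale)
  show "lop (br x y) 0 (lop y (- m) w) + sV (of_int m * B x y * of_nat k) (lop y (- m) w) -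
      lop y (- m) (lop (br x y) 0 w + sV (of_int m * B x y * of_nat k) w) = sV (- 2) (lop y (- m) w)" for w
    using lop_comm[of "br x y" 0 y "- m" w] by (simp add: hy lop_simps lop_scale lop_left)
qed

end

section \<open>Weights of the module\<close>

context affine_module
begin

text \<open>Weights are functions on \<open>'i option\<close>: \<open>Some j\<close> records the eigenvalue of the fundamental coweight
  \<open>\<omega> j\<close>, and \<open>None\<close> that of \<open>L(0)\<close>.\<close>

definition wop :: "'i option \<Rightarrow> 'v \<Rightarrow> 'v" where
  "wop a = (case a of None \<Rightarrow> L0 | Some j \<Rightarrow> lop (\<omega> j) 0)"

definition wsp :: "('i option \<Rightarrow> complex) \<Rightarrow> 'v set" where
  "wsp \<tau> = joint_eigenspace sV wop UNIV \<tau>"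

text \<open>The effect on a weight of a loop operator \<open>x(m)\<close> with \<open>x\<close> of degree \<open>n\<close> in the root grading.\<close>

definition shift :: "('i option \<Rightarrow> complex) \<Rightarrow> ('i \<Rightarrow> int) \<Rightarrow> int \<Rightarrow> 'i option \<Rightarrow> complex" where
  "shift \<tau> n m = (\<lambda>a. case a of None \<Rightarrow> \<tau> None - of_int m | Some j \<Rightarrow> \<tau> (Some j) + of_int (n j))"

text \<open>The eigenvalue of \<open>h(0)\<close> on a space of weight \<open>\<tau>\<close>: for \<open>h \<in> \<hh>\<close> the coordinates with respect to the
  fundamental coweights are the values of the simple roots.\<close>

definition hval :: "('i option \<Rightarrow> complex) \<Rightarrow> 'g \<Rightarrow> complex" where
  "hval \<tau> h = (\<Sum>j\<in>UNIV. \<alpha> j h * \<tau> (Some j))"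

lemma lin_L0: "Vector_Spaces.linear sV sV L0"
  and L0_lop: "L0 (lop a n w) = lop a n (L0 w) - sV (of_int n) (lop a n w)"
  and L0_v: "L0 v = sV \<mu> v"
proof -
  have d: "Vector_Spaces.linear sV sV L0"
    "L0 (act (loop a n) w) - act (loop a n) (L0 w) = sV (- of_int n) (act (loop a n) w)"
    "L0 v = sV \<mu> v"
    using degree unfolding is_degree_operator_def by blast+
  then show "Vector_Spaces.linear sV sV L0" "L0 v = sV \<mu> v" by auto
  show "L0 (lop a n w) = lop a n (L0 w) - sV (of_int n) (lop a n w)"
    using d(2) by (simp add: lop_def V.scale_minus_left algebra_simps)
qed

lemma lin_wop: "Vector_Spaces.linear sV sV (wop a)"
  by (cases a) (simp_all add: wop_def lin_L0 lin_lop)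

lemma subspace_wsp: "V.subspace (wsp \<tau>)"
  unfolding wsp_def by (rule V.subspace_joint_eigenspace[OF lin_wop])

lemma wspD: "w \<in> wsp \<tau> \<Longrightarrow> L0 w = sV (\<tau> None) w" "w \<in> wsp \<tau> \<Longrightarrow> lop (\<omega> j) 0 w = sV (\<tau> (Some j)) w"
  unfolding wsp_def joint_eigenspace_def
  by (metis (mono_tags, lifting) UNIV_I mem_Collect_eq option.case wop_def)+

lemma wspI: "L0 w = sV (\<tau> None) w \<Longrightarrow> (\<And>j. lop (\<omega> j) 0 w = sV (\<tau> (Some j)) w) \<Longrightarrow> w \<in> wsp \<tau>"
  unfolding wsp_def joint_eigenspace_def wop_def by (auto split: option.split)

lemma \<omega>_in_hh: "\<omega> j \<in> \<hh>" and \<alpha>_\<omega>: "\<alpha> i (\<omega> j) = (if i = j then 1 else 0)"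
  using coweights by (auto simp: fundamental_coweights_def)

lemma rf_\<omega>: "rf n (\<omega> j) = of_int (n j)"
  by (simp add: rf_def \<alpha>_\<omega> if_distrib[of "\<lambda>z. _ * z"] cong: if_cong)

lemma hh_expand: "h \<in> \<hh> \<Longrightarrow> h = (\<Sum>j\<in>UNIV. s (\<alpha> j h) (\<omega> j))"
proof -
  assume h: "h \<in> \<hh>"
  have mem: "(\<Sum>j\<in>J. s (\<alpha> j h) (\<omega> j)) \<in> \<hh>" for J
    by (intro subspace_sum[OF subspace_hh] subspace_scale[OF subspace_hh] \<omega>_in_hh)
  have al: "\<alpha> i (\<Sum>j\<in>J. s (\<alpha> j h) (\<omega> j)) = (\<Sum>j\<in>J. \<alpha> j h * \<alpha> i (\<omega> j))" if "finite J" for i J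
    using that
  proof (induction J rule: finite_induct)
    case empty
    show ?case using \<alpha>_linear(2)[OF h, of i 0] by simp
  next
    case (insert x J)
    then show ?case by (simp add: \<alpha>_linear mem subspace_scale[OF subspace_hh \<omega>_in_hh] \<omega>_in_hh)
  qed
  let ?x = "h - (\<Sum>j\<in>UNIV. s (\<alpha> j h) (\<omega> j))"
  have "?x = 0"
  proof (rule hh_separated)
    show x: "?x \<in> \<hh>" using h mem by (rule subspace_diff[OF subspace_hh])
    fix i
    have "\<alpha> i (\<Sum>j\<in>UNIV. s (\<alpha> j h) (\<omega> j)) = \<alpha> i h"
      unfolding al[OF finite_UNIV] by (simp add: \<alpha>_\<omega> if_distrib[of "\<lambda>z. _ * z"] cong: if_cong)
    moreover have "\<alpha> i h = \<alpha> i ?x + \<alpha> i (\<Sum>j\<in>UNIV. s (\<alpha> j h) (\<omega> j))"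
      using \<alpha>_linear(1)[OF x mem, of i UNIV] by simp
    ultimately show "\<alpha> i ?x = 0" by simp
  qed
  then show ?thesis by simp
qed

lemma lop_hh_wsp: "h \<in> \<hh> \<Longrightarrow> w \<in> wsp \<tau> \<Longrightarrow> lop h 0 w = sV (hval \<tau> h) w"
proof -
  assume h: "h \<in> \<hh>" and w: "w \<in> wsp \<tau>"
  have "lop h 0 w = lop (\<Sum>j\<in>UNIV. s (\<alpha> j h) (\<omega> j)) 0 w" using hh_expand[OF h] by simp
  also have "\<dots> = sV (hval \<tau> h) w"
    by (simp add: lop_sum lop_scale wspD[OF w] hval_def V.scale_sum_left)
  finally show ?thesis .
qed

lemma lop_wsp:
  assumes x: "x \<in> grade n" and w: "w \<in> wsp \<tau>"
  shows "lop x m w \<in> wsp (shift \<tau> n m)"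
proof (rule wspI)
  show "L0 (lop x m w) = sV (shift \<tau> n m None) (lop x m w)"
    by (simp add: L0_lop wspD[OF w] lop_simps shift_def V.scale_left_diff_distrib)
  show "lop (\<omega> j) 0 (lop x m w) = sV (shift \<tau> n m (Some j)) (lop x m w)" for j
    using lop_comm[of "\<omega> j" 0 x m w]
    by (simp add: gradeD[OF x \<omega>_in_hh] rf_\<omega> lop_scale wspD[OF w] lop_simps shift_def V.scale_left_distrib)
qed

lemma lop_pow_wsp:
  assumes x: "x \<in> grade n" and w: "w \<in> wsp \<tau>"
  shows "(lop x m ^^ p) w \<in> wsp (shift \<tau> (\<lambda>j. int p * n j) (int p * m))"
proof (induction p)
  case 0
  have "shift \<tau> (\<lambda>j. 0) 0 = \<tau>" by (auto simp: shift_def split: option.split)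
  then show ?case using w by simp
next
  case (Suc p)
  have "shift (shift \<tau> (\<lambda>j. int p * n j) (int p * m)) n m =
      shift \<tau> (\<lambda>j. int (Suc p) * n j) (int (Suc p) * m)"
    by (auto simp: shift_def algebra_simps split: option.split)
  then show ?case using lop_wsp[OF x Suc, of m] by simp
qed

section \<open>The affine Chevalley generators\<close>

text \<open>Root vectors \<open>(E\<^sub>\<theta>, F\<^sub>\<theta>)\<close> for \<open>\<theta>\<close> and \<open>-\<theta>\<close>. The affine Chevalley generators below are indexed by
  \<open>'i option\<close>, where \<open>None\<close> stands for the affine simple root \<open>\<delta> - \<theta>\<close> with raising operator \<open>F\<^sub>\<theta>(1)\<close> and
  lowering operator \<open>E\<^sub>\<theta>(-1)\<close>. The operators for \<open>a\<close> come from root vectors \<open>e_gen a\<close>, \<open>f_gen a\<close> for the finite parts \<open>\<plusminus>aroot a\<close> of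
  the affine simple roots, in degrees \<open>\<plusminus>deg a\<close>, and \<open>gform a\<close> is the value of the form on them.\<close>

definition highest_pair :: "'g \<times> 'g" where
  "highest_pair = (SOME p. fst p \<in> grade marks \<and> snd p \<in> grade (\<lambda>i. - marks i) \<and> B (fst p) (snd p) = 1 \<and>
     br (fst p) (snd p) = H\<theta>)"

definition aroot :: "'i option \<Rightarrow> 'i \<Rightarrow> int" where
  "aroot a = (case a of None \<Rightarrow> (\<lambda>i. - marks i) | Some i \<Rightarrow> unit i)"

definition deg :: "'i option \<Rightarrow> int" where
  "deg a = (case a of None \<Rightarrow> 1 | Some i \<Rightarrow> 0)"

definition e_gen :: "'i option \<Rightarrow> 'g" where
  "e_gen a = (case a of None \<Rightarrow> snd highest_pair | Some i \<Rightarrow> E i)"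

definition f_gen :: "'i option \<Rightarrow> 'g" where
  "f_gen a = (case a of None \<Rightarrow> fst highest_pair | Some i \<Rightarrow> F i)"

definition gform :: "'i option \<Rightarrow> real" where
  "gform a = (case a of None \<Rightarrow> 1 | Some i \<Rightarrow> norm_const * ef_form i)"

definition raise :: "'i option \<Rightarrow> 'v \<Rightarrow> 'v" where
  "raise a = lop (e_gen a) (deg a)"

definition lower :: "'i option \<Rightarrow> 'v \<Rightarrow> 'v" where
  "lower a = lop (f_gen a) (- deg a)"

definition coroot_op :: "'i option \<Rightarrow> 'v \<Rightarrow> 'v" where
  "coroot_op a = (\<lambda>w. lop (br (e_gen a) (f_gen a)) 0 w + sV (of_int (deg a) * B (e_gen a) (f_gen a) * of_nat k) w)"

lemma highest_pair: "fst highest_pair \<in> grade marks" "snd highest_pair \<in> grade (\<lambda>i. - marks i)" "B (fst highest_pair) (snd highest_pair) = 1"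
  "br (fst highest_pair) (snd highest_pair) = H\<theta>"
proof -
  have "\<exists>p. fst p \<in> grade marks \<and> snd p \<in> grade (\<lambda>i. - marks i) \<and> B (fst p) (snd p) = 1 \<and>
     br (fst p) (snd p) = H\<theta>"
    using highest_root_triple by (metis fst_conv snd_conv)
  from someI_ex[OF this] show "fst highest_pair \<in> grade marks" "snd highest_pair \<in> grade (\<lambda>i. - marks i)"
    "B (fst highest_pair) (snd highest_pair) = 1" "br (fst highest_pair) (snd highest_pair) = H\<theta>"
    unfolding highest_pair_def by blast+
qed

lemma e_gen_grade: "e_gen a \<in> grade (aroot a)" and f_gen_grade: "f_gen a \<in> grade (\<lambda>i. - aroot a i)"
  and B_gen: "B (e_gen a) (f_gen a) = of_real (gform a)" and gform_pos: "gform a > 0"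
  using E_grade F_grade highest_pair B_EF ef_form_pos norm_const_pos B_sym[of "snd highest_pair" "fst highest_pair"]
  by (cases a; simp add: e_gen_def f_gen_def aroot_def gform_def)+

lemma aroot_norm: "gform a * gram (aroot a) (aroot a) = 2 * norm_const"
proof (cases a)
  case None
  then show ?thesis by (simp add: gform_def aroot_def gram_simps norm_const_def)
next
  case (Some i)
  then show ?thesis using ef_form_pos[of i] by (simp add: gform_def aroot_def gram_unit_unit)
qed

lemma br_gen: "br (e_gen a) (f_gen a) = s (of_real (gform a / norm_const)) (t (aroot a))"
proof -
  have "K (e_gen a) (f_gen a) = of_real (gform a / norm_const)"
    using B_gen[of a] norm_const_pos by (simp add: B_eq field_simps)
  then show ?thesis using br_opposite[OF e_gen_grade f_gen_grade, of a] by simp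
qed

lemma generator_triple: "rf (aroot a) (br (e_gen a) (f_gen a)) = 2"
proof -
  have "complex_of_real (gform a / norm_const) * complex_of_real (gram (aroot a) (aroot a)) = of_real (gform a * gram (aroot a) (aroot a) / norm_const)"
    by simp
  then show ?thesis using norm_const_pos by (simp add: br_gen rf_linear t_in_hh rf_t aroot_norm)
qed

lemma sl2_generators: "sl2_action sV (raise a) (lower a) (coroot_op a)"
  unfolding raise_def lower_def coroot_op_def
by (rule lop_sl2[OF e_gen_grade f_gen_grade generator_triple])

lemma grade_opposite_zero: "grade n = {0} \<Longrightarrow> grade (\<lambda>i. - n i) = {0}"
proof (rule ccontr)
  assume n: "grade n = {0}" and nz: "grade (\<lambda>i. - n i) \<noteq> {0}"
  obtain e f where "f \<in> grade (\<lambda>i. - (- n i))" "K e f = 1" by (rule root_triple[OF nz, of 1])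
  then have "K e 0 = 1" using n by auto
  then show False using K_right(2)[of e 0 0] by auto
qed

lemma grade_aroot_diff:
  assumes "a \<noteq> b"
  shows "grade (\<lambda>i. aroot a i - aroot b i) = {0}"
proof (cases a; cases b)
  fix i j assume ab: "a = Some i" "b = Some j"
  show ?thesis
  proof (rule ccontr)
    assume "\<not> ?thesis"
    then have "grade (\<lambda>l. unit i l - unit j l) \<noteq> {0}" using ab by (simp add: aroot_def)
    then have "(\<forall>l. unit i l - unit j l \<ge> 0) \<or> (\<forall>l. unit i l - unit j l \<le> 0)" by (rule grade_sign)
    moreover have "unit i i - unit j i = 1" "unit i j - unit j j = - 1"
      using assms ab by (auto simp: unit_def)
    ultimately show False by (metis neg_le_0_iff_le not_one_le_zero zero_le_one zero_neq_neg_one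
          order_antisym)
  qed
next
  fix i assume ab: "a = Some i" "b = None"
  then show ?thesis using grade_above_marks[of i] by (simp add: aroot_def add.commute)
next
  fix j assume ab: "a = None" "b = Some j"
  then show ?thesis using grade_opposite_zero[OF grade_above_marks[of j]] by (simp add: aroot_def)
qed (use assms in auto)

lemma raise_lower_comm:
  assumes "a \<noteq> b"
  shows "raise a (lower b w) = lower b (raise a w)"
proof -
  have "br (e_gen a) (f_gen b) \<in> grade (\<lambda>i. aroot a i - aroot b i)"
    using br_grade[OF e_gen_grade f_gen_grade, of a b] by simp
  then have "br (e_gen a) (f_gen b) = 0" using grade_aroot_diff[OF assms] by simp
  moreover have "deg a = 0 \<or> deg a + - deg b \<noteq> 0" using assms by (cases a; cases b) (auto simp: deg_def)
  ultimately show ?thesis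
    using lop_comm[of "e_gen a" "deg a" "f_gen b" "- deg b" w] by (auto simp: raise_def lower_def lop_left)
qed

lemma raise_lower: "raise a (lower a w) = lower a (raise a w) + coroot_op a w"
  using sl2_action.ef[OF sl2_generators, of a w] by (simp add: algebra_simps)

lemma br_gen_hh: "br (e_gen a) (f_gen a) \<in> \<hh>"
  unfolding br_gen by (rule subspace_scale[OF subspace_hh t_in_hh])

text \<open>The weight \<open>\<tau> - \<Sum>n\<^sub>a\<alpha>\<^sub>a\<close>, the sum running over the affine simple roots. Lowering by \<open>\<delta> - \<theta>\<close> adds \<open>\<theta>\<close> to the
  finite part and \<open>1\<close> to the \<open>L(0)\<close> eigenvalue.\<close>

definition cone :: "('i option \<Rightarrow> complex) \<Rightarrow> ('i option \<Rightarrow> nat) \<Rightarrow> 'i option \<Rightarrow> complex" where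
  "cone \<tau> n = (\<lambda>a. case a of None \<Rightarrow> \<tau> None + of_nat (n None)
     | Some j \<Rightarrow> \<tau> (Some j) - of_nat (n (Some j)) + of_nat (n None) * of_int (marks j))"

lemma cone_inject: "cone \<tau> n = cone \<tau> n' \<Longrightarrow> n = n'"
proof -
  assume eq: "cone \<tau> n = cone \<tau> n'"
  have None: "n None = n' None" using fun_cong[OF eq, of None] by (simp add: cone_def)
  moreover have "n (Some j) = n' (Some j)" for j
    using fun_cong[OF eq, of "Some j"] None by (simp add: cone_def)
  ultimately show ?thesis by (metis ext option.exhaust)
qed

lemma cone_cone: "cone (cone \<tau> n) n' = cone \<tau> (\<lambda>a. n a + n' a)"
  by (auto simp: cone_def algebra_simps split: option.split)

lemma cone_0: "cone \<tau> (\<lambda>a. 0) = \<tau>"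
  by (auto simp: cone_def split: option.split)

lemma cone_upd: "shift (cone \<tau> n) (\<lambda>i. - aroot a i) (- deg a) = cone \<tau> (n(a := Suc (n a)))"
  by (cases a) (auto simp: cone_def shift_def aroot_def deg_def unit_def algebra_simps fun_eq_iff
      split: option.split)

lemma lower_cone: "w \<in> wsp (cone \<tau> n) \<Longrightarrow> lower a w \<in> wsp (cone \<tau> (n(a := Suc (n a))))"
  unfolding lower_def using lop_wsp[OF f_gen_grade, of w "cone \<tau> n" a "- deg a"] by (simp add: cone_upd)

lemma lower_pow_cone: "w \<in> wsp \<tau> \<Longrightarrow> (lower a ^^ N) w \<in> wsp (cone \<tau> ((\<lambda>b. 0)(a := N)))"
proof (induction N)
  case (Suc N)
  show ?case
    using lower_cone[OF Suc.IH[OF Suc.prems], of a] by (simp only: funpow.simps o_apply fun_upd_same fun_upd_upd)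
next
  case 0
  have "(\<lambda>b. 0)(a := 0) = (\<lambda>b. 0 :: nat)" by auto
  then show ?case using 0 by (simp add: cone_0)
qed

section \<open>Singular vectors\<close>

lemma linear_preserves_span:
  assumes f: "Vector_Spaces.linear sV sV f" and w: "w \<in> V.span X"
    and X: "\<And>x. x \<in> X \<Longrightarrow> f x \<in> V.span X"
  shows "f w \<in> V.span X"
  using w
proof (induction rule: V.span_induct_alt)
  case base
  then show ?case by (simp add: linD[OF f] V.span_zero)
next
  case (step c x y)
  then show ?case by (simp add: linD[OF f] X V.span_add V.span_scale)
qed

text \<open>The span of all monomials in the lowering operators applied to \<open>u\<close> is stable under the Cartan part,
  and moving a raising operator to the right through a monomial stays in it until it kills \<open>u\<close>. So it is
  stable under affine Chevalley generators, hence it is the whole irreducible module.\<close>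

lemma singular_vector_span:
  assumes u: "u \<in> wsp \<tau>" "u \<noteq> 0" and sing: "\<And>a. raise a u = 0"
  shows "V.span (\<Union>n. wsp (cone \<tau> n)) = UNIV"
proof -
  define m where "m as = foldr lower as u" for as
  define W where "W = V.span (range m)"
  have mW: "m as \<in> W" for as unfolding W_def by (rule V.span_base) simp
  have sub: "V.subspace W" by (simp add: W_def)
  have wt: "\<exists>n. m as \<in> wsp (cone \<tau> n)" for as
  proof (induction as)
    case Nil
    then show ?case using u(1) by (auto simp: m_def cone_0 intro: exI[of _ "\<lambda>a. 0"])
  next
    case (Cons a as)
    then show ?case using lower_cone by (fastforce simp: m_def)
  qed
  have lower_W: "lower a w \<in> W" if "w \<in> W" for a w
    using that unfolding W_def lower_def
  proof (rule linear_preserves_span[OF lin_lop])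
    fix x assume "x \<in> range m"
    then obtain as where "x = m as" by blast
    then have "lop (f_gen a) (- deg a) x = m (a # as)" by (simp add: m_def lower_def)
    then show "lop (f_gen a) (- deg a) x \<in> V.span (range m)" using mW by (simp add: W_def)
  qed
  have hh_m: "lop h 0 (m as) \<in> W" if "h \<in> \<hh>" for h as
    using wt[of as] lop_hh_wsp[OF that, of "m as"] mW[of as] V.subspace_scale[OF sub] by auto
  have hh_W: "lop h 0 w \<in> W" if "h \<in> \<hh>" "w \<in> W" for h w
    using that(2) unfolding W_def
    by (rule linear_preserves_span[OF lin_lop]) (use hh_m[OF that(1)] in \<open>auto simp: W_def\<close>)
  have coroot_op_W: "coroot_op a w \<in> W" if "w \<in> W" for a w
    unfolding coroot_op_def using hh_W[OF br_gen_hh that] that V.subspace_add[OF sub] V.subspace_scale[OF sub] by blast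
  have raise_m: "raise a (m as) \<in> W" for a as
  proof (induction as)
    case Nil
    then show ?case using V.subspace_0[OF sub] by (simp add: m_def sing)
  next
    case (Cons b as)
    have eq: "m (b # as) = lower b (m as)" by (simp add: m_def)
    show ?case
    proof (cases "a = b")
      case True
      then show ?thesis
        unfolding eq using raise_lower[of b "m as"] lower_W[OF Cons] coroot_op_W[OF mW] V.subspace_add[OF sub] by simp
    next
      case False
      then show ?thesis unfolding eq using raise_lower_comm[OF False] lower_W[OF Cons] by simp
    qed
  qed
  have raise_W: "raise a w \<in> W" if "w \<in> W" for a w
    using that unfolding W_def raise_def
    by (rule linear_preserves_span[OF lin_lop]) (use raise_m in \<open>auto simp: W_def raise_def\<close>)
  have ne: "snd highest_pair \<noteq> 0" "fst highest_pair \<noteq> 0" using highest_pair(3) B_zero by auto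
  have "W = UNIV"
  proof (rule irreducible[OF sub _ _ u(2)])
    show "u \<in> W" using mW[of "[]"] by (simp add: m_def)
    show "lop x n w \<in> W" if "w \<in> W" for x n w
    proof (rule loop_generated[OF sub _ _ _ ne(1) _ ne(2) _ that])
      show "lop (E i) 0 w \<in> W" if "w \<in> W" for i w
        using raise_W[OF that, of "Some i"] by (simp add: raise_def e_gen_def deg_def)
      show "lop (F i) 0 w \<in> W" if "w \<in> W" for i w
        using lower_W[OF that, of "Some i"] by (simp add: lower_def f_gen_def deg_def)
      show "lop (snd highest_pair) 1 w \<in> W" if "w \<in> W" for w
        using raise_W[OF that, of None] by (simp add: raise_def e_gen_def deg_def)
      show "lop (fst highest_pair) (- 1) w \<in> W" if "w \<in> W" for w
        using lower_W[OF that, of None] by (simp add: lower_def f_gen_def deg_def)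
    qed (rule hh_W)
  qed
  moreover have "range m \<subseteq> (\<Union>n. wsp (cone \<tau> n))" using wt by blast
  ultimately show ?thesis using V.span_mono[of "range m" "\<Union>n. wsp (cone \<tau> n)"] by (auto simp: W_def)
qed

lemma singular_vector_cone:
  assumes u: "u \<in> wsp \<tau>" "u \<noteq> 0" and sing: "\<And>a. raise a u = 0" and \<sigma>: "wsp \<sigma> \<noteq> {0}"
  obtains n where "\<sigma> = cone \<tau> n"
proof -
  obtain w where w: "w \<in> wsp \<sigma>" "w \<noteq> 0" using \<sigma> V.subspace_0[OF subspace_wsp] by blast
  have sp: "V.span (\<Union>\<tau>\<in>range (cone \<tau>). joint_eigenspace sV wop UNIV \<tau>) = UNIV"
    using singular_vector_span[OF u sing] by (simp add: wsp_def)
  have "\<sigma> \<in> range (cone \<tau>)"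
  proof (rule ccontr)
    assume out: "\<sigma> \<notin> range (cone \<tau>)"
    have "w = 0"
    proof (rule V.joint_eigenvector_outside[OF lin_wop])
      show "w \<in> V.span (\<Union>\<tau>\<in>range (cone \<tau>). joint_eigenspace sV wop UNIV \<tau>)" by (simp only: sp UNIV_I)
      show "w \<in> joint_eigenspace sV wop UNIV \<sigma>" using w by (simp add: wsp_def)
      show "\<exists>a\<in>UNIV. \<tau>' a \<noteq> \<sigma> a" if "\<tau>' \<in> range (cone \<tau>)" for \<tau>'
        using that out by (metis UNIV_I ext)
    qed (metis UNIV_I ext)
    then show False using w by simp
  qed
  then show ?thesis using that by blast
qed

definition \<tau>0 :: "'i option \<Rightarrow> complex" where
  "\<tau>0 a = (case a of None \<Rightarrow> \<mu> | Some j \<Rightarrow> \<Lambda> (\<omega> j))"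

lemma v_wsp: "v \<in> wsp \<tau>0"
  by (rule wspI) (simp_all add: \<tau>0_def L0_v lop_hh_v \<omega>_in_hh)

lemma raise_v: "raise a v = 0"
  by (cases a) (simp_all add: raise_def e_gen_def deg_def lop_pos_v lop_E_v)

lemma weight_in_cone:
  assumes "wsp \<sigma> \<noteq> {0}" obtains n where "\<sigma> = cone \<tau>0 n"
  using singular_vector_cone[OF v_wsp v_ne_0 raise_v assms] .

text \<open>Otherwise the whole module, including \<open>v\<close>, would lie below the weight of \<open>u\<close>, which is strictly below that
  of \<open>v\<close>.\<close>

lemma singular_vector_zero:
  assumes u: "u \<in> wsp (cone \<tau>0 n)" and sing: "\<And>a. raise a u = 0" and n: "n a \<noteq> 0"
  shows "u = 0"
proof (rule ccontr)
  assume "u \<noteq> 0"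
  moreover have "wsp \<tau>0 \<noteq> {0}" using v_wsp v_ne_0 by blast
  ultimately obtain n' where "\<tau>0 = cone (cone \<tau>0 n) n'" using singular_vector_cone[OF u _ sing] by blast
  then have "cone \<tau>0 (\<lambda>a. 0) = cone \<tau>0 (\<lambda>a. n a + n' a)" by (simp add: cone_cone cone_0)
  from fun_cong[OF cone_inject[OF this], of a] n show False by simp
qed

lemma ad_e_gen_nilpotent: "\<exists>N. (br (e_gen a) ^^ N) y = 0" and ad_f_gen_nilpotent: "\<exists>N. (br (f_gen a) ^^ N) y = 0"
proof -
  have "aroot a \<noteq> (\<lambda>i. 0)" by (cases a) (use marks(2) unit_ne_0 in \<open>auto simp: aroot_def fun_eq_iff\<close>)
  then show "\<exists>N. (br (e_gen a) ^^ N) y = 0" "\<exists>N. (br (f_gen a) ^^ N) y = 0"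
    by (auto intro!: ad_nilpotent[OF e_gen_grade] ad_nilpotent[OF f_gen_grade] simp: fun_eq_iff)
qed

lemma raise_nilpotent: "\<exists>N. (raise a ^^ N) w = 0"
  unfolding raise_def
  by (rule nilpotent_on_module[OF ad_e_gen_nilpotent _ v_ne_0, where N = 1]) (use raise_v[of a] in \<open>simp add: raise_def\<close>)

text \<open>By the \<open>sl\<^sub>2\<close> relations the power \<open>N + 1\<close> of the lowering operator turns \<open>v\<close> into a singular vector.\<close>

lemma lower_nilpotent:
  assumes "coroot_op a v = sV (of_nat N) v"
  shows "\<exists>N. (lower a ^^ N) w = 0"
proof -
  interpret sl2: sl2_action sV "raise a" "lower a" "coroot_op a" by (rule sl2_generators)
  have "(lower a ^^ Suc N) v = 0"
  proof (rule singular_vector_zero[OF lower_pow_cone[OF v_wsp], of "Suc N" a a])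
    fix c
    show "raise c ((lower a ^^ Suc N) v) = 0"
    proof (cases "c = a")
      case True
      then show ?thesis using sl2.e_f_pow[OF assms raise_v, of N] by simp
    next
      case False
      have "raise c ((lower a ^^ M) v) = 0" for M
      proof (induction M)
        case (Suc M)
        then show ?case using raise_lower_comm[OF False] sl2.lin_simps(3) by (simp add: sl2.lin_simps)
      qed (simp add: raise_v)
      then show ?thesis .
    qed
  qed simp
  then show ?thesis unfolding lower_def using nilpotent_on_module[OF ad_f_gen_nilpotent _ v_ne_0] by blast
qed

end

section \<open>Reflections of weight spaces\<close>

context affine_module
begin

text \<open>The weight, in the sense of \<open>sl\<^sub>2\<close>, of a space of weight \<open>\<tau>\<close> for the triple with raising operator \<open>x(m)\<close> and
  lowering operator \<open>y(-m)\<close>.\<close>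

definition sl2_weight :: "'g \<Rightarrow> 'g \<Rightarrow> int \<Rightarrow> ('i option \<Rightarrow> complex) \<Rightarrow> complex" where
  "sl2_weight x y m \<tau> = hval \<tau> (br x y) + of_int m * B x y * of_nat k"

lemma hval_shift: "hval (shift \<tau> n m) h = hval \<tau> h + rf n h"
  by (simp add: hval_def shift_def rf_def algebra_simps sum.distrib)

lemma shift_shift: "shift (shift \<tau> n m) n' m' = shift \<tau> (\<lambda>i. n i + n' i) (m + m')"
  by (auto simp: shift_def fun_eq_iff split: option.split)

lemma shift_0: "shift \<tau> (\<lambda>i. 0) 0 = \<tau>"
  by (auto simp: shift_def fun_eq_iff split: option.split)

lemma reflection_bij_betw:
  assumes xy: "x \<in> grade n" "y \<in> grade (\<lambda>i. - n i)" and two: "rf n (br x y) = 2"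
    and nil: "\<And>w. \<exists>N. (lop x m ^^ N) w = 0" "\<And>w. \<exists>N. (lop y (- m) ^^ N) w = 0"
    and p: "sl2_weight x y m \<tau> = of_nat p"
  shows "bij_betw (lop y (- m) ^^ p) (wsp \<tau>) (wsp (shift \<tau> (\<lambda>i. - (int p * n i)) (- (int p * m))))"
proof -
  interpret sl2: sl2_action sV "lop x m" "lop y (- m)"
    "\<lambda>w. lop (br x y) 0 w + sV (of_int m * B x y * of_nat k) w"
    by (rule lop_sl2[OF xy two])
  have hh: "br x y \<in> \<hh>" using br_grade[OF xy] by (simp add: grade_zero)
  have h: "lop (br x y) 0 w + sV (of_int m * B x y * of_nat k) w = sV (sl2_weight x y m \<sigma>) w"
    if "w \<in> wsp \<sigma>" for w \<sigma>
    by (simp add: lop_hh_wsp[OF hh that] sl2_weight_def V.scale_left_distrib)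
  have cas: "sl2.cas c w \<in> wsp \<sigma>" if w: "w \<in> wsp \<sigma>" for w \<sigma> c
  proof -
    have "lop y (- m) (lop x m w) \<in> wsp \<sigma>"
      using lop_wsp[OF xy(2) lop_wsp[OF xy(1) w, of m], of "- m"] by (simp add: shift_shift shift_0)
    then show ?thesis
      unfolding sl2.cas_def h[OF w] using w
      by (auto simp: lop_simps h[OF w] lop_hh_wsp[OF hh w]
          intro!: V.subspace_add[OF subspace_wsp] V.subspace_diff[OF subspace_wsp] V.subspace_scale[OF subspace_wsp])
  qed
  let ?\<tau> = "shift \<tau> (\<lambda>i. - (int p * n i)) (- (int p * m))"
  have p': "sl2_weight x y m ?\<tau> = - of_nat p"
  proof -
    have "rf (\<lambda>i. - (int p * n i)) (br x y) = - of_nat p * 2"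
      using two rf_simps(4)[of "- int p" n "br x y"] by simp
    then show ?thesis using p by (simp add: sl2_weight_def hval_shift)
  qed
  show ?thesis
  proof (rule sl2.f_pow_bij_betw[OF subspace_wsp _ cas subspace_wsp _ cas _ _ nil])
    show "(lop y (- m) ^^ p) w \<in> wsp ?\<tau>" if "w \<in> wsp \<tau>" for w
      using lop_pow_wsp[OF xy(2) that, of p "- m"] by simp
    show "(lop x m ^^ p) w \<in> wsp \<tau>" if "w \<in> wsp ?\<tau>" for w
      using lop_pow_wsp[OF xy(1) that, of p m] by (simp add: shift_shift shift_0)
  qed (use h p p' in auto)
qed

lemma reflection_opposite:
  assumes xy: "x \<in> grade n" "y \<in> grade (\<lambda>i. - n i)" and two: "rf n (br x y) = 2"
  shows "y \<in> grade (\<lambda>i. - n i)" "x \<in> grade (\<lambda>i. - (- n i))" "rf (\<lambda>i. - n i) (br y x) = 2"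
    "sl2_weight y x (- m) \<tau> = - sl2_weight x y m \<tau>"
proof -
  have hh: "br x y \<in> \<hh>" using br_grade[OF xy] by (simp add: grade_zero)
  have eq: "br y x = s (- 1) (br x y)" using br_anti[of y x] by (simp add: scale_minus_left)
  show "y \<in> grade (\<lambda>i. - n i)" "x \<in> grade (\<lambda>i. - (- n i))" using xy by simp_all
  show "rf (\<lambda>i. - n i) (br y x) = 2" unfolding eq using two hh by (simp add: rf_simps rf_linear del: scale_minus_left)
  have "hval \<tau> (s (- 1) (br x y)) = - hval \<tau> (br x y)"
    using hh by (simp add: hval_def \<alpha>_linear sum_negf del: scale_minus_left)
  then show "sl2_weight y x (- m) \<tau> = - sl2_weight x y m \<tau>" by (simp add: sl2_weight_def eq B_sym[of y x] del: scale_minus_left)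
qed

lemma reflection_bij_betw_neg:
  assumes xy: "x \<in> grade n" "y \<in> grade (\<lambda>i. - n i)" and two: "rf n (br x y) = 2"
    and nil: "\<And>w. \<exists>N. (lop x m ^^ N) w = 0" "\<And>w. \<exists>N. (lop y (- m) ^^ N) w = 0"
    and p: "sl2_weight x y m \<tau> = - of_nat p"
  shows "bij_betw (lop x m ^^ p) (wsp \<tau>) (wsp (shift \<tau> (\<lambda>i. int p * n i) (int p * m)))"
  using reflection_bij_betw[OF reflection_opposite(1-3)[OF xy two], of "- m" \<tau> p] nil p
    reflection_opposite(4)[OF xy two, of m \<tau>] by simp

lemma sl2_weight_Ints:
  assumes xy: "x \<in> grade n" "y \<in> grade (\<lambda>i. - n i)" and two: "rf n (br x y) = 2"
    and nil: "\<And>w. \<exists>N. (lop x m ^^ N) w = 0" "\<And>w. \<exists>N. (lop y (- m) ^^ N) w = 0"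
    and \<tau>: "wsp \<tau> \<noteq> {0}"
  shows "sl2_weight x y m \<tau> \<in> \<int>"
proof -
  interpret sl2: sl2_action sV "lop x m" "lop y (- m)"
    "\<lambda>w. lop (br x y) 0 w + sV (of_int m * B x y * of_nat k) w"
    by (rule lop_sl2[OF xy two])
  have hh: "br x y \<in> \<hh>" using br_grade[OF xy] by (simp add: grade_zero)
  obtain w where w: "w \<in> wsp \<tau>" "w \<noteq> 0" using \<tau> V.subspace_0[OF subspace_wsp] by blast
  show ?thesis
    by (rule sl2.eigenvalue_Ints[OF _ w(2) nil])
      (simp add: lop_hh_wsp[OF hh w(1)] sl2_weight_def V.scale_left_distrib)
qed

text \<open>The reflection is stated for an arbitrary complex \<open>sl\<^sub>2\<close> weight. When it is not an integer, the weight
  space and its mirror image both vanish.\<close>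

lemma reflection_dim:
  assumes xy: "x \<in> grade n" "y \<in> grade (\<lambda>i. - n i)" and two: "rf n (br x y) = 2"
    and nil: "\<And>w. \<exists>N. (lop x m ^^ N) w = 0" "\<And>w. \<exists>N. (lop y (- m) ^^ N) w = 0"
    and \<tau>': "\<And>j. \<tau>' (Some j) = \<tau> (Some j) - sl2_weight x y m \<tau> * of_int (n j)" "\<tau>' None = \<tau> None + sl2_weight x y m \<tau> * of_int m"
  shows "V.dim (wsp \<tau>) = V.dim (wsp \<tau>')"
proof -
  define R where "R \<sigma> a = (case a of None \<Rightarrow> \<sigma> None + sl2_weight x y m \<sigma> * of_int m
      | Some j \<Rightarrow> \<sigma> (Some j) - sl2_weight x y m \<sigma> * of_int (n j))" for \<sigma> a
  have dim: "V.dim (wsp \<sigma>) = V.dim (wsp (R \<sigma>))" if \<sigma>: "wsp \<sigma> \<noteq> {0}" for \<sigma>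
  proof -
    obtain z where z: "sl2_weight x y m \<sigma> = of_int z" using sl2_weight_Ints[OF xy two nil \<sigma>] by (auto elim: Ints_cases)
    show ?thesis
    proof (cases "z \<ge> 0")
      case True
      then have p: "sl2_weight x y m \<sigma> = of_nat (nat z)" using z by simp
      have "R \<sigma> = shift \<sigma> (\<lambda>i. - (int (nat z) * n i)) (- (int (nat z) * m))"
        using True by (auto simp: R_def z shift_def fun_eq_iff split: option.split)
      then show ?thesis
        using V.dim_bij_betw[OF V.linear_funpow[OF lin_lop] subspace_wsp
            reflection_bij_betw[OF xy two nil p]] by simp
    next
      case False
      then have p: "sl2_weight x y m \<sigma> = - of_nat (nat (- z))" using z by simp
      have "R \<sigma> = shift \<sigma> (\<lambda>i. int (nat (- z)) * n i) (int (nat (- z)) * m)"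
        using False by (auto simp: R_def z shift_def fun_eq_iff split: option.split)
      then show ?thesis
        using V.dim_bij_betw[OF V.linear_funpow[OF lin_lop] subspace_wsp
            reflection_bij_betw_neg[OF xy two nil p]] by simp
    qed
  qed
  have "hval (R \<sigma>) (br x y) = hval \<sigma> (br x y) - sl2_weight x y m \<sigma> * rf n (br x y)" for \<sigma>
    by (simp add: hval_def R_def rf_def algebra_simps sum_subtractf sum_distrib_left)
  then have evR: "sl2_weight x y m (R \<sigma>) = - sl2_weight x y m \<sigma>" for \<sigma>
    using two by (simp add: sl2_weight_def)
  have RR: "R (R \<sigma>) = \<sigma>" for \<sigma>
    unfolding R_def[of "R \<sigma>"] evR by (auto simp: R_def fun_eq_iff split: option.split)
  have "\<tau>' = R \<tau>" using \<tau>' by (auto simp: R_def fun_eq_iff split: option.split)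
  moreover have "V.dim (wsp \<tau>) = V.dim (wsp (R \<tau>))"
  proof (cases "wsp \<tau> = {0}")
    case zero: True
    show ?thesis
    proof (cases "wsp (R \<tau>) = {0}")
      case True
      then show ?thesis by (simp only: zero)
    next
      case False
      show ?thesis using dim[OF False] by (simp only: RR)
    qed
  qed (rule dim)
  ultimately show ?thesis by simp
qed

section \<open>The norm bound for weights\<close>

lemma sum_option: "(\<Sum>a\<in>UNIV. f a) = f None + (\<Sum>i\<in>UNIV. f (Some (i :: 'i)))"
  by (simp add: UNIV_option_conv sum.reindex)

text \<open>The finite part of \<open>\<Sum>n\<^sub>a\<alpha>\<^sub>a\<close>: the coefficient of \<open>\<delta> - \<theta>\<close> contributes a multiple of \<open>-\<theta>\<close>.\<close>

definition \<gamma> :: "('i option \<Rightarrow> nat) \<Rightarrow> 'i \<Rightarrow> int" where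
  "\<gamma> n j = int (n (Some j)) - int (n None) * marks j"

text \<open>The value of \<open>\<Lambda>\<close> on \<open>t n\<close>, that is, the pairing of \<open>\<Lambda>\<close> with \<open>n\<close> for the dual of the Killing form.\<close>

definition \<Lambda>_form :: "('i \<Rightarrow> int) \<Rightarrow> real" where
  "\<Lambda>_form n = (\<Sum>j\<in>UNIV. of_int (n j) / ef_form j * Re (\<Lambda> (H j)))"

text \<open>The pairing of the affine highest weight with an affine simple root for the normalized form; the
  level pairs with \<open>\<delta>\<close>.\<close>

definition hw_label :: "'i option \<Rightarrow> real" where
  "hw_label a = \<Lambda>_form (aroot a) / norm_const + of_int (deg a) * real k"

lemma \<Lambda>_dual: "\<Lambda> \<in> dual_space s \<hh>" and \<Lambda>_H: "\<Lambda> (H i) \<in> \<nat>" and \<Lambda>_H\<theta>: "Re (\<Lambda> H\<theta>) \<le> real k"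
  using integrable by (auto simp: integrable_weight_def)

lemma \<Lambda>_linear:
  "x \<in> \<hh> \<Longrightarrow> y \<in> \<hh> \<Longrightarrow> \<Lambda> (x + y) = \<Lambda> x + \<Lambda> y" "x \<in> \<hh> \<Longrightarrow> \<Lambda> (s c x) = c * \<Lambda> x"
  using \<Lambda>_dual by (auto simp: dual_space_def)

lemma \<Lambda>_sum:
  assumes "finite J" "\<And>j. j \<in> J \<Longrightarrow> h j \<in> \<hh>"
  shows "\<Lambda> (\<Sum>j\<in>J. s (c j) (h j)) = (\<Sum>j\<in>J. c j * \<Lambda> (h j))"
  using assms
proof (induction J rule: finite_induct)
  case empty
  show ?case using \<Lambda>_linear(2)[OF subspace_0[OF subspace_hh], of 0] by simp
next
  case (insert x J)
  have "(\<Sum>j\<in>J. s (c j) (h j)) \<in> \<hh>" "s (c x) (h x) \<in> \<hh>"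
    using insert.prems by (auto intro!: subspace_sum[OF subspace_hh] subspace_scale[OF subspace_hh])
  then show ?case using insert by (simp add: \<Lambda>_linear)
qed

lemma \<Lambda>_H_real: "\<Lambda> (H i) = of_real (Re (\<Lambda> (H i)))" "Re (\<Lambda> (H i)) \<ge> 0"
  using \<Lambda>_H[of i] by (auto elim!: Nats_cases)

lemma \<Lambda>_t: "\<Lambda> (t n) = of_real (\<Lambda>_form n)"
proof -
  have "\<Lambda> (t n) = (\<Sum>j\<in>UNIV. of_real (of_int (n j) / ef_form j) * \<Lambda> (H j))"
    unfolding t_def by (rule \<Lambda>_sum) (auto simp: H_in_hh)
  also have "\<dots> = (\<Sum>j\<in>UNIV. of_real (of_int (n j) / ef_form j) * of_real (Re (\<Lambda> (H j))))"
    using \<Lambda>_H_real(1) by metis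
  finally show ?thesis by (simp add: \<Lambda>_form_def)
qed

lemma hval_\<tau>0: "h \<in> \<hh> \<Longrightarrow> hval \<tau>0 h = \<Lambda> h"
proof -
  assume h: "h \<in> \<hh>"
  have "\<Lambda> h = \<Lambda> (\<Sum>j\<in>UNIV. s (\<alpha> j h) (\<omega> j))" using hh_expand[OF h] by simp
  also have "\<dots> = (\<Sum>j\<in>UNIV. \<alpha> j h * \<Lambda> (\<omega> j))" by (rule \<Lambda>_sum) (auto simp: \<omega>_in_hh)
  finally show ?thesis by (simp add: hval_def \<tau>0_def)
qed

lemma hval_cone: "hval (cone \<tau> n) h = hval \<tau> h - rf (\<gamma> n) h"
  by (simp add: hval_def cone_def rf_def \<gamma>_def algebra_simps sum.distrib sum_subtractf)

lemma \<Lambda>_form_simps: "\<Lambda>_form (\<lambda>i. - n i) = - \<Lambda>_form n" "\<Lambda>_form (\<lambda>i. l * n i) = of_int l * \<Lambda>_form n"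
  by (simp_all add: \<Lambda>_form_def sum_negf sum_distrib_left algebra_simps)

lemma gram_expand: "gram m l = (\<Sum>i\<in>UNIV. of_int (m i) * gram (unit i) l)"
proof -
  have "gram (unit i) l = (\<Sum>j\<in>UNIV. of_int (l j) * G i j)" for i
    using gram_unit[of l i] gram_sym[of "unit i" l] by (simp add: G_sym[of _ i])
  then show ?thesis by (simp add: gram_def sum_distrib_left mult.assoc)
qed

lemma \<Lambda>_form_unit: "\<Lambda>_form (unit i) = Re (\<Lambda> (H i)) / ef_form i"
proof -
  have "\<Lambda>_form (unit i) = (\<Sum>j\<in>UNIV. if j = i then Re (\<Lambda> (H j)) / ef_form j else 0)"
    unfolding \<Lambda>_form_def by (rule sum.cong) (auto simp: unit_def)
  then show ?thesis by simp
qed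

lemma gram_\<gamma>: "gram (\<gamma> n) l = (\<Sum>a\<in>UNIV. real (n a) * gram (aroot a) l)"
proof -
  have "gram (\<gamma> n) l = gram (\<lambda>j. int (n (Some j))) l - real (n None) * gram marks l"
    unfolding \<gamma>_def by (simp add: gram_simps)
  then show ?thesis
    using gram_expand[of "\<lambda>j. int (n (Some j))" l] by (simp add: sum_option aroot_def gram_simps)
qed

lemma \<Lambda>_form_\<gamma>: "\<Lambda>_form (\<gamma> n) = (\<Sum>a\<in>UNIV. real (n a) * \<Lambda>_form (aroot a))"
proof -
  have "\<Lambda>_form (\<gamma> n) = (\<Sum>j\<in>UNIV. real (n (Some j)) * \<Lambda>_form (unit j)) - real (n None) * \<Lambda>_form marks"
    unfolding \<Lambda>_form_unit
    by (simp add: \<Lambda>_form_def \<gamma>_def algebra_simps sum_subtractf sum_distrib_left diff_divide_distrib)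
  then show ?thesis by (simp add: sum_option aroot_def \<Lambda>_form_simps)
qed

lemma hw_label_nonneg: "hw_label a \<ge> 0"
proof (cases a)
  case None
  have "\<Lambda> H\<theta> = of_real (\<Lambda>_form marks / norm_const)"
    by (simp add: H\<theta>_eq \<Lambda>_linear t_in_hh \<Lambda>_t)
  then show ?thesis using \<Lambda>_H\<theta> None by (simp add: hw_label_def aroot_def deg_def \<Lambda>_form_simps)
next
  case (Some i)
  then show ?thesis using \<Lambda>_H_real(2)[of i] ef_form_pos[of i] norm_const_pos by (simp add: hw_label_def aroot_def deg_def \<Lambda>_form_unit)
qed

lemma sl2_weight_cone:
  "sl2_weight (e_gen a) (f_gen a) (deg a) (cone \<tau>0 n) =
     of_real (gform a * (hw_label a - (\<Sum>b\<in>UNIV. real (n b) * (gram (aroot b) (aroot a) / norm_const))))"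
proof -
  have "hval (cone \<tau>0 n) (br (e_gen a) (f_gen a)) = \<Lambda> (br (e_gen a) (f_gen a)) - rf (\<gamma> n) (br (e_gen a) (f_gen a))"
    by (simp add: hval_cone hval_\<tau>0 br_gen_hh)
  also have "\<dots> = of_real (gform a / norm_const * (\<Lambda>_form (aroot a) - gram (\<gamma> n) (aroot a)))"
    by (simp add: br_gen \<Lambda>_linear rf_linear t_in_hh \<Lambda>_t rf_t algebra_simps)
  finally have hval: "hval (cone \<tau>0 n) (br (e_gen a) (f_gen a)) =
      of_real (gform a / norm_const * (\<Lambda>_form (aroot a) - gram (\<gamma> n) (aroot a)))" .
  have "sl2_weight (e_gen a) (f_gen a) (deg a) (cone \<tau>0 n) = of_real (gform a * (hw_label a - gram (\<gamma> n) (aroot a) / norm_const))"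
    unfolding sl2_weight_def hval B_gen hw_label_def by (simp add: algebra_simps diff_divide_distrib)
  also have "gram (\<gamma> n) (aroot a) / norm_const = (\<Sum>b\<in>UNIV. real (n b) * (gram (aroot b) (aroot a) / norm_const))"
    by (simp add: gram_\<gamma> sum_divide_distrib)
  finally show ?thesis .
qed

lemma cone_add: "shift (cone \<tau> n) (\<lambda>i. - (int q * aroot a i)) (- (int q * deg a)) = cone \<tau> (n(a := n a + q))"
  by (cases a) (auto simp: cone_def shift_def aroot_def deg_def unit_def algebra_simps fun_eq_iff
      split: option.split)

text \<open>The norm bound for a module on which the lowering operators in \<open>J\<close> act locally nilpotently, restricted
  to weights below \<open>\<Lambda>\<close> by the simple roots in \<open>J\<close>. Since \<open>\<delta>\<close> is isotropic, only the finite part of the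
  difference enters the quadratic term, and the level appears through the linear term.\<close>

lemma weight_norm_le:
  assumes nil: "\<And>a w. a \<in> J \<Longrightarrow> \<exists>N. (lower a ^^ N) w = 0"
    and n: "\<And>a. a \<notin> J \<Longrightarrow> n a = 0" "wsp (cone \<tau>0 n) \<noteq> {0}"
  shows "gram (\<gamma> n) (\<gamma> n) / norm_const \<le> 2 * (\<Lambda>_form (\<gamma> n) / norm_const + real (n None) * real k)"
proof -
  define P where "P = {n. (\<forall>a. a \<notin> J \<longrightarrow> n a = 0) \<and> wsp (cone \<tau>0 n) \<noteq> {0}}"
  define g where "g a b = gram (aroot a) (aroot b) / norm_const" for a b
  have restrict: "(\<Sum>a\<in>J. real (n a) * f a) = (\<Sum>a\<in>UNIV. real (n a) * f a)" if "n \<in> P" for n f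
    by (rule sum.mono_neutral_left) (use that in \<open>auto simp: P_def\<close>)
  have "(\<Sum>a\<in>J. \<Sum>b\<in>J. real (n a) * real (n b) * g a b) \<le> 2 * (\<Sum>a\<in>J. real (n a) * hw_label a)"
  proof (rule reflection_norm_bound[where P = P])
    show "g a b = g b a" for a b using gram_sym by (simp add: g_def)
    show "g a a > 0" for a
    proof -
      have "gform a * gram (aroot a) (aroot a) > 0" using aroot_norm[of a] norm_const_pos by simp
      then show ?thesis using gform_pos[of a] norm_const_pos by (simp add: g_def zero_less_mult_iff)
    qed
    show "hw_label a \<ge> 0" for a by (rule hw_label_nonneg)
    show "n \<in> P" using n by (simp add: P_def)
    fix p a assume p: "p \<in> P" and a: "a \<in> J" and neg: "hw_label a - (\<Sum>b\<in>J. real (p b) * g b a) < 0"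
    define x where "x = hw_label a - (\<Sum>b\<in>J. real (p b) * g b a)"
    have sl2_weight: "sl2_weight (e_gen a) (f_gen a) (deg a) (cone \<tau>0 p) = of_real (gform a * x)"
      by (simp only: sl2_weight_cone x_def restrict[OF p] g_def)
    have nil': "\<exists>N. (lop (e_gen a) (deg a) ^^ N) w = 0" "\<exists>N. (lop (f_gen a) (- deg a) ^^ N) w = 0" for w
      using raise_nilpotent[of a w] nil[OF a, of w] by (simp_all add: raise_def lower_def)
    have ne: "wsp (cone \<tau>0 p) \<noteq> {0}" using p by (simp add: P_def)
    have "sl2_weight (e_gen a) (f_gen a) (deg a) (cone \<tau>0 p) \<in> \<int>"
      by (rule sl2_weight_Ints[OF e_gen_grade f_gen_grade generator_triple nil' ne])
    then obtain z where "complex_of_real (gform a * x) = of_int z" by (auto simp: sl2_weight elim: Ints_cases)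
    then have z: "gform a * x = of_int z" by (metis of_real_eq_iff of_real_of_int_eq)
    have "gform a * x < 0" using neg gform_pos[of a] by (simp add: x_def mult_pos_neg)
    then have z0: "z < 0" using z by simp
    define q where "q = nat (- z)"
    have q: "gform a * x = - real q" using z z0 by (simp add: q_def)
    have evq: "sl2_weight (e_gen a) (f_gen a) (deg a) (cone \<tau>0 p) = - of_nat q" by (simp add: sl2_weight q)
    let ?\<sigma> = "shift (cone \<tau>0 p) (\<lambda>i. int q * aroot a i) (int q * deg a)"
    have "wsp ?\<sigma> \<noteq> {0}"
    proof
      assume "wsp ?\<sigma> = {0}"
      then have "bij_betw (lop (e_gen a) (deg a) ^^ q) (wsp (cone \<tau>0 p)) {0}"
        using reflection_bij_betw_neg[OF e_gen_grade f_gen_grade generator_triple nil' evq] by simp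
      moreover have "(lop (e_gen a) (deg a) ^^ q) 0 = 0" by (rule linD(3)[OF V.linear_funpow[OF lin_lop]])
      moreover have "0 \<in> wsp (cone \<tau>0 p)" by (rule V.subspace_0[OF subspace_wsp])
      ultimately have "wsp (cone \<tau>0 p) \<subseteq> {0}"
        unfolding bij_betw_def by (metis image_eqI inj_onD singletonD singletonI subsetI)
      then show False using ne \<open>0 \<in> wsp (cone \<tau>0 p)\<close> by blast
    qed
    then obtain p' where p': "?\<sigma> = cone \<tau>0 p'" by (rule weight_in_cone)
    have "cone \<tau>0 p = shift ?\<sigma> (\<lambda>i. - (int q * aroot a i)) (- (int q * deg a))"
      by (simp add: shift_shift shift_0)
    also have "\<dots> = cone \<tau>0 (p'(a := p' a + q))" unfolding p' by (rule cone_add)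
    finally have pp': "p = p'(a := p' a + q)" by (rule cone_inject)
    then have "p' = p(a := p' a)" "real (p' a) = real (p a) - real q" by (simp_all add: fun_eq_iff)
    moreover have "2 * x / g a a = - real q"
    proof -
      have "g a a = 2 / gform a" using aroot_norm[of a] gform_pos[of a] norm_const_pos by (simp add: g_def field_simps)
      then show ?thesis using q gform_pos[of a] by (simp add: mult.commute)
    qed
    moreover have "p' \<in> P"
    proof -
      have "p' c = 0" if "c \<notin> J" for c using that p a pp' by (auto simp: P_def fun_eq_iff split: if_splits)
      then show ?thesis using \<open>wsp ?\<sigma> \<noteq> {0}\<close> by (simp add: P_def p')
    qed
    ultimately show "\<exists>m. p(a := m) \<in> P \<and>
        real m = real (p a) + 2 * (hw_label a - (\<Sum>b\<in>J. real (p b) * g b a)) / g a a"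
      unfolding x_def by (intro exI[of _ "p' a"]) simp
  qed auto
  moreover have nP: "n \<in> P" using n by (simp add: P_def)
  have "(\<Sum>a\<in>J. \<Sum>b\<in>J. real (n a) * real (n b) * g a b) = gram (\<gamma> n) (\<gamma> n) / norm_const"
  proof -
    have "(\<Sum>b\<in>J. real (n a) * real (n b) * g a b) = real (n a) * (gram (aroot a) (\<gamma> n) / norm_const)" for a
    proof -
      have "(\<Sum>b\<in>J. real (n a) * real (n b) * g a b) = real (n a) * (\<Sum>b\<in>J. real (n b) * g b a)"
        by (simp add: sum_distrib_left mult.assoc g_def gram_sym[of "aroot a"])
      also have "(\<Sum>b\<in>J. real (n b) * g b a) = gram (\<gamma> n) (aroot a) / norm_const"
        unfolding restrict[OF nP] by (simp add: gram_\<gamma> g_def sum_divide_distrib)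
      finally show ?thesis by (simp add: gram_sym[of "aroot a"])
    qed
    then have "(\<Sum>a\<in>J. \<Sum>b\<in>J. real (n a) * real (n b) * g a b) =
        (\<Sum>a\<in>J. real (n a) * (gram (aroot a) (\<gamma> n) / norm_const))" by simp
    also have "\<dots> = gram (\<gamma> n) (\<gamma> n) / norm_const"
      unfolding restrict[OF nP] by (simp add: gram_\<gamma>[of n "\<gamma> n"] sum_divide_distrib)
    finally show ?thesis .
  qed
  moreover have "(\<Sum>a\<in>J. real (n a) * hw_label a) = \<Lambda>_form (\<gamma> n) / norm_const + real (n None) * real k"
  proof -
    have "(\<Sum>a\<in>UNIV. real (n a) * (of_int (deg a) * real k)) = real (n None) * real k"
      by (simp add: sum_option deg_def)
    then show ?thesis
      unfolding restrict[OF nP] hw_label_def by (simp add: distrib_left sum.distrib \<Lambda>_form_\<gamma> sum_divide_distrib)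
  qed
  ultimately show ?thesis by simp
qed

section \<open>Integrability\<close>

text \<open>The vector \<open>y(-m)\<^sup>N v\<close> has weight \<open>\<Lambda> - N(\<delta>' + m\<delta>)\<close> with a finite root lattice element \<open>\<delta>' \<noteq> 0\<close>. In the norm bound
  the left hand side grows like \<open>N\<^sup>2\<close> and the right hand side like \<open>N\<close>.\<close>

lemma power_vanishes:
  assumes nil: "\<And>a w. a \<in> J \<Longrightarrow> \<exists>N. (lower a ^^ N) w = 0" "range Some \<subseteq> J" "m \<noteq> 0 \<Longrightarrow> None \<in> J"
    and y: "y \<in> grade (\<lambda>i. - \<delta> i)" and \<delta>: "\<delta> \<noteq> (\<lambda>i. 0)"
  shows "\<exists>N. (lop y (- int m) ^^ N) v = 0"
proof -
  define c where "c = \<Lambda>_form \<delta> / norm_const + real m * real k"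
  have g: "gram \<delta> \<delta> / norm_const > 0" using gram_pos[OF \<delta>] norm_const_pos by simp
  obtain N0 :: nat where "2 * c / (gram \<delta> \<delta> / norm_const) < real N0" using reals_Archimedean2 by blast
  then have "2 * c < real N0 * (gram \<delta> \<delta> / norm_const)" by (simp only: pos_divide_less_eq[OF g])
  also have "\<dots> \<le> real (Suc N0) * (gram \<delta> \<delta> / norm_const)" using g by (intro mult_right_mono) auto
  finally obtain N where N: "N > 0" "2 * c < real N * (gram \<delta> \<delta> / norm_const)" by blast
  have "(lop y (- int m) ^^ N) v = 0"
  proof (rule ccontr)
    assume ne: "(lop y (- int m) ^^ N) v \<noteq> 0"
    have "(lop y (- int m) ^^ N) v \<in> wsp (shift \<tau>0 (\<lambda>j. int N * - \<delta> j) (int N * - int m))"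
      by (rule lop_pow_wsp[OF y v_wsp])
    then have ne': "wsp (shift \<tau>0 (\<lambda>j. int N * - \<delta> j) (int N * - int m)) \<noteq> {0}" using ne by blast
    then obtain n where n: "shift \<tau>0 (\<lambda>j. int N * - \<delta> j) (int N * - int m) = cone \<tau>0 n"
      by (rule weight_in_cone)
    have "complex_of_nat (n None) = of_nat (N * m)"
      using fun_cong[OF n, of None] by (simp add: shift_def cone_def)
    then have nN: "n None = N * m" by (simp only: of_nat_eq_iff)
    have "complex_of_int (\<gamma> n j) = of_int (int N * \<delta> j)" for j
      using fun_cong[OF n, of "Some j"] by (simp add: shift_def cone_def \<gamma>_def algebra_simps)
    then have \<gamma>: "\<gamma> n = (\<lambda>j. int N * \<delta> j)" by (simp only: of_int_eq_iff fun_eq_iff) simp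
    have "gram (\<gamma> n) (\<gamma> n) / norm_const \<le> 2 * (\<Lambda>_form (\<gamma> n) / norm_const + real (n None) * real k)"
    proof (rule weight_norm_le[OF nil(1)])
      show "n a = 0" if "a \<notin> J" for a
        using that nil(2,3) nN by (cases a) auto
      show "wsp (cone \<tau>0 n) \<noteq> {0}" using ne' n by simp
    qed
    then have "real N * (real N * (gram \<delta> \<delta> / norm_const)) \<le> real N * (2 * c)"
      unfolding \<gamma> nN c_def by (simp add: gram_simps \<Lambda>_form_simps algebra_simps)
    moreover have "real N * (2 * c) < real N * (real N * (gram \<delta> \<delta> / norm_const))"
      using N by (intro mult_strict_left_mono) auto
    ultimately show False by (rule leD[THEN notE])
  qed
  then show ?thesis by blast
qed

lemma lower_Some_nilpotent: "\<exists>N. (lower (Some i) ^^ N) w = 0"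
proof -
  obtain N where N: "\<Lambda> (H i) = of_nat N" using \<Lambda>_H[of i] by (auto elim: Nats_cases)
  have "coroot_op (Some i) v = sV (of_nat N) v"
    using lop_hh_v[OF H_in_hh, of i] by (simp add: coroot_op_def e_gen_def f_gen_def deg_def EF N)
  then show ?thesis by (rule lower_nilpotent)
qed

text \<open>The assumptions give \<open>\<Lambda>(H\<^sub>\<theta>) \<le> k\<close>, but integrality of \<open>\<Lambda>(H\<^sub>\<theta>)\<close> has to be derived: it is the weight of \<open>v\<close> for the
  triple of \<open>\<theta>\<close> in degree \<open>0\<close>, whose lowering operator is nilpotent on \<open>v\<close> by the bound for the finite simple
  reflections.\<close>

lemma lower_None_nilpotent: "\<exists>N. (lower None ^^ N) w = 0"
proof -
  let ?e = "fst highest_pair" and ?f = "snd highest_pair"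
  have two: "rf marks (br ?e ?f) = 2"
    using norm_const_pos by (simp add: highest_pair(4) rf_H\<theta>) (simp add: norm_const_def)
  interpret sl2: sl2_action sV "lop ?e 0" "lop ?f (- 0)"
    "\<lambda>w. lop (br ?e ?f) 0 w + sV (of_int 0 * B ?e ?f * of_nat k) w"
    by (rule lop_sl2[OF highest_pair(1,2) two])
  have "\<exists>N. (lop ?f (- int 0) ^^ N) v = 0"
    by (rule power_vanishes[where J = "range Some", OF _ _ _ highest_pair(2) marks(2)])
      (use lower_Some_nilpotent in auto)
  then obtain N where N: "(lop ?f (- 0) ^^ N) v = 0" by auto
  have "lop ?e 0 v = 0"
  proof (rule ccontr)
    assume ne: "lop ?e 0 v \<noteq> 0"
    then have "wsp (shift \<tau>0 marks 0) \<noteq> {0}" using lop_wsp[OF highest_pair(1) v_wsp, of 0] by blast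
    then obtain n where n: "shift \<tau>0 marks 0 = cone \<tau>0 n" by (rule weight_in_cone)
    have n0: "n None = 0" using fun_cong[OF n, of None] by (simp add: shift_def cone_def)
    have "complex_of_int (marks j) = of_int (- int (n (Some j)))" for j
      using fun_cong[OF n, of "Some j"] n0 by (simp add: shift_def cone_def)
    then have "marks j = - int (n (Some j))" for j by (simp only: of_int_eq_iff)
    then show False using marks_pos by (metis neg_0_le_iff_le of_nat_0_le_iff order_trans not_one_le_zero
          neg_le_0_iff_le)
  qed
  moreover have "lop (br ?e ?f) 0 v + sV (of_int 0 * B ?e ?f * of_nat k) v = sV (\<Lambda> H\<theta>) v"
    by (simp add: highest_pair(4) lop_hh_v H\<theta>_in_hh)
  ultimately have "\<Lambda> H\<theta> \<in> \<nat>" using sl2.highest_weight_nat[OF _ _ v_ne_0 N] by blast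
  then obtain l where l: "\<Lambda> H\<theta> = of_nat l" by (auto elim: Nats_cases)
  then have lk: "l \<le> k" using \<Lambda>_H\<theta> by simp
  have "br ?f ?e = - H\<theta>" using br_anti[of ?f ?e] highest_pair(4) by simp
  then have "coroot_op None v = sV (of_nat k) v - sV (\<Lambda> H\<theta>) v"
    using B_gen[of None] by (simp add: coroot_op_def e_gen_def f_gen_def deg_def gform_def lop_left lop_hh_v H\<theta>_in_hh)
  then have "coroot_op None v = sV (of_nat (k - l)) v"
    using lk by (simp add: l of_nat_diff V.scale_left_diff_distrib)
  then show ?thesis by (rule lower_nilpotent)
qed

lemma E_nilpotent: "m \<ge> 0 \<Longrightarrow> \<exists>N. (lop (E i) m ^^ N) w = 0"
proof -
  assume "m \<ge> 0"
  then have "lop (E i) m v = 0" using lop_E_v lop_pos_v by (cases "m = 0") auto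
  then have "(lop (E i) m ^^ 1) v = 0" by simp
  then show ?thesis by (rule nilpotent_on_module[OF ad_E_nilpotent _ v_ne_0])
qed

lemma F_nilpotent: "\<exists>N. (lop (F i) (- int m) ^^ N) w = 0"
proof -
  have "\<exists>N. (lower a ^^ N) w = 0" for a w
    using lower_Some_nilpotent lower_None_nilpotent by (cases a) auto
  then have "\<exists>N. (lop (F i) (- int m) ^^ N) v = 0"
    by (intro power_vanishes[where J = UNIV, OF _ _ _ F_grade unit_ne_0]) auto
  then show ?thesis using nilpotent_on_module[OF ad_F_nilpotent _ v_ne_0] by blast
qed

section \<open>Translation of the character by a coroot\<close>

lemma character_wsp: "affine_character sV act \<omega> L0 (n, r) = V.dim (wsp (\<lambda>a. case a of None \<Rightarrow> r | Some j \<Rightarrow> n j))"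
proof -
  have "{w. (\<forall>j. act (loop (\<omega> j) 0) w = sV (n j) w) \<and> L0 w = sV r w} =
      wsp (\<lambda>a. case a of None \<Rightarrow> r | Some j \<Rightarrow> n j)"
    by (auto simp: lop_def dest: wspD intro!: wspI)
  then show ?thesis by (simp add: affine_character_def)
qed

text \<open>The composition of the two reflections belonging to \<open>\<alpha>\<^sub>i\<close> in degrees \<open>0\<close> and \<open>1\<close>. The constant is
  \<open>\<langle>E\<^sub>i, F\<^sub>i\<rangle> k\<close>.\<close>

lemma character_translation:
  "affine_character sV act \<omega> L0 =
     times_xq_power i (of_real (norm_const * ef_form i) * of_nat k)
       (subst_xq (\<lambda>j. \<alpha> j (H i)) (affine_character sV act \<omega> L0))"
proof (rule ext, clarify)
  fix n :: "'i \<Rightarrow> complex" and r :: complex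
  define wt where "wt n r = (\<lambda>a. case a of None \<Rightarrow> r | Some j \<Rightarrow> n j)" for n :: "'i \<Rightarrow> complex" and r :: complex
  define z where "z = (\<Sum>j\<in>UNIV. n j * \<alpha> j (H i))"
  define c where "c = complex_of_real (norm_const * ef_form i) * of_nat k"
  let ?n1 = "n(i := n i - z)" and ?n2 = "n(i := n i - c)"
  have upd: "(\<Sum>j\<in>UNIV. (n(i := n i - d)) j * \<alpha> j (H i)) = z - 2 * d" for d
  proof -
    have "(\<Sum>j\<in>UNIV. (n(i := n i - d)) j * \<alpha> j (H i)) = (\<Sum>j\<in>UNIV. n j * \<alpha> j (H i) - (if j = i then d * \<alpha> j (H i) else 0))"
      by (rule sum.cong) (auto simp: algebra_simps)
    then show ?thesis by (simp add: sum_subtractf z_def \<alpha>_H)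
  qed
  have hval: "hval (wt n r) (H i) = (\<Sum>j\<in>UNIV. n j * \<alpha> j (H i))" for n r
    by (simp add: hval_def wt_def mult.commute)
  have two: "rf (unit i) (br (E i) (F i)) = 2" by (simp add: EF rf_simps \<alpha>_H)
  have ev0: "sl2_weight (E i) (F i) 0 (wt n r) = z" by (simp add: sl2_weight_def EF hval z_def)
  have ev1: "sl2_weight (E i) (F i) 1 (wt ?n1 r) = c - z"
    by (simp add: sl2_weight_def EF hval upd B_EF c_def del: fun_upd_apply)
  have "V.dim (wsp (wt n r)) = V.dim (wsp (wt ?n1 r))"
  proof (rule reflection_dim[OF E_grade F_grade two, of 0])
    show "\<exists>N. (lop (F i) (- 0) ^^ N) w = 0" for w using F_nilpotent[of i 0 w] by simp
  qed (use E_nilpotent[of 0 i] ev0 in \<open>auto simp: wt_def unit_def\<close>)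
  also have "\<dots> = V.dim (wsp (wt ?n2 (r + (c - z))))"
  proof (rule reflection_dim[OF E_grade F_grade two, of 1])
    show "\<exists>N. (lop (F i) (- 1) ^^ N) w = 0" for w using F_nilpotent[of i 1 w] by simp
    show "wt ?n2 (r + (c - z)) (Some j) = wt ?n1 r (Some j) - sl2_weight (E i) (F i) 1 (wt ?n1 r) * of_int (unit i j)" for j
      unfolding ev1 by (simp add: wt_def unit_def)
    show "wt ?n2 (r + (c - z)) None = wt ?n1 r None + sl2_weight (E i) (F i) 1 (wt ?n1 r) * of_int 1"
      unfolding ev1 by (simp add: wt_def)
  qed (use E_nilpotent[of 1 i] in auto)
  also have "r + (c - z) = r - c - (\<Sum>j\<in>UNIV. ?n2 j * \<alpha> j (H i))"
    unfolding upd by simp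
  finally show "affine_character sV act \<omega> L0 (n, r) =
     times_xq_power i (of_real (norm_const * ef_form i) * of_nat k)
       (subst_xq (\<lambda>j. \<alpha> j (H i)) (affine_character sV act \<omega> L0)) (n, r)"
    unfolding times_xq_power_apply subst_xq_apply character_wsp c_def[symmetric] wt_def .
qed

end

theorem theorem2p3:
  fixes s :: "complex \<Rightarrow> 'g::ab_group_add \<Rightarrow> 'g"
    and br :: "'g \<Rightarrow> 'g \<Rightarrow> 'g"
    and \<hh> :: "'g set"
    and B :: "'g \<Rightarrow> 'g \<Rightarrow> complex"
    and \<alpha> :: "'i::finite \<Rightarrow> 'g \<Rightarrow> complex"
    and E F H \<omega> :: "'i \<Rightarrow> 'g"
    and \<theta> :: "'g \<Rightarrow> complex" and H\<theta> :: 'g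
    and k :: nat and \<Lambda> :: "'g \<Rightarrow> complex"
    and sV :: "complex \<Rightarrow> 'v::ab_group_add \<Rightarrow> 'v"
    and act :: "'g affine \<Rightarrow> 'v \<Rightarrow> 'v"
    and v :: 'v and L0 :: "'v \<Rightarrow> 'v"
  assumes "fd_simple_lie_algebra s br"
    and "cartan_subalgebra s br \<hh>"
    and "normalized_killing_form s br \<hh> B"
    and "simple_roots s br \<hh> \<alpha>"
    and "chevalley_generators s br \<hh> \<alpha> E F H"
    and "fundamental_coweights \<hh> \<alpha> \<omega>"
    and "is_highest_root s br \<hh> \<alpha> \<theta>" and "is_coroot s br \<hh> \<theta> H\<theta>"
    and "k > 0"
    and "integrable_weight s \<hh> H H\<theta> k \<Lambda>"
    and "irreducible_highest_weight_module s br \<hh> B E k \<Lambda> sV act v"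
    and "is_degree_operator sV act v (conformal_weight s br \<hh> B \<alpha> H\<theta> k \<Lambda>) L0"
  shows "(\<forall>i. affine_character sV act \<omega> L0 =
            times_xq_power i (2 / dual_form B \<hh> (\<alpha> i) (\<alpha> i) * of_nat k)
              (subst_xq (\<lambda>j. \<alpha> j (H i)) (affine_character sV act \<omega> L0))) \<and>
         (simply_laced s br \<hh> B \<longrightarrow>
           (\<forall>i. affine_character sV act \<omega> L0 =
              times_xq_power i (of_nat k)
                (subst_xq (\<lambda>j. \<alpha> j (H i)) (affine_character sV act \<omega> L0))))"
proof -
  have "lie_algebra s br" using assms(1) by (simp add: fd_simple_lie_algebra_def)
  then interpret affine_module s br \<hh> \<alpha> E F H \<theta> H\<theta> B \<omega> k \<Lambda> sV act v
    "conformal_weight s br \<hh> B \<alpha> H\<theta> k \<Lambda>" L0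
    using assms
    by (intro affine_module.intro affine_module_axioms.intro highest_root_setting.intro
        highest_root_setting_axioms.intro chevalley_setting.intro chevalley_setting_axioms.intro)
  have K: "2 / dual_form B \<hh> (\<alpha> i) (\<alpha> i) = of_real (norm_const * ef_form i)" for i
    using norm_const_pos ef_form_pos[of i] by (simp add: B_dual_form_simple)
  have "\<alpha> i \<in> roots s br \<hh>" for i using assms(4) by (simp add: simple_roots_def)
  moreover have "\<theta> \<in> roots s br \<hh>" using assms(7) by (simp add: is_highest_root_def)
  ultimately have "dual_form B \<hh> (\<alpha> i) (\<alpha> i) = 2" if "simply_laced s br \<hh> B" for i
    using that B_dual_form_highest by (metis simply_laced_def)
  then have "of_real (norm_const * ef_form i) * of_nat k = (of_nat k :: complex)" if "simply_laced s br \<hh> B" for i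
    using that K[of i] by simp
  then show ?thesis using character_translation K by metis
qed

end
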